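(* Let $x>0$ and assume that all non-trivial zeros of $\zeta(s)$ are simple. Then there exists a sequence of positive numbers $(T_j)_{j\ge1}$ with $T_j\to\infty$ such that \begin{align*} \frac{x}{2}\sum_{n=1}^\infty n\lambda(n)e^{-\pi n^2x^2/4}&=\frac{1}{4\sqrt2\,x^2}\sum_{n=1}^\infty nc(n)e^{-\pi n^2/(8x^2)}\Big(K_{1/4}\Big(\frac{\pi n^2}{8x^2}\Big)+K_{3/4}\Big(\frac{\pi n^2}{8x^2}\Big)\Big)+\frac{\pi^{1/4}}{2\sqrt{x}\,\Gamma(\frac14)\zeta(\frac12)}\\ &\quad+\lim_{j\to\infty}\sum_{|\gamma_m|<T_j}\frac{\zeta(2\rho_m)}{\zeta'(\rho_m)}\frac{\Gamma(\rho_m)}{\Gamma(\rho_m/2)}(\sqrt{\pi}x)^{-\rho_m}. \end{align*}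
   Context: $\lambda(n)$ is the Liouville function. $c(n)=m\mu(k)$ if $n=m^2k$ with $k$ squarefree; equivalently $\sum c(n)n^{-s}=\zeta(2s-1)/\zeta(s)$ for $\operatorname{Re}(s)>1$. $K_\nu$ is the modified Bessel function of the second kind. Non-trivial zeros of $\zeta$ are $\rho_m=\beta_m+i\gamma_m$, $m\in\mathbb{Z}$, $\rho_{-m}=\beta_m-i\gamma_m$. *)

theory Defs
  imports "HOL-Complex_Analysis.Complex_Analysis"
    "HOL-Computational_Algebra.Computational_Algebra"
begin

(* The Riemann zeta function, i.e. the analytic continuation of the Dirichlet series to the
   complex plane without 1. The value 0 at the pole is a convention that makes the continuation
   unique as a total function. *)
definition zeta :: "complex \<Rightarrow> complex" where
  "zeta = (THE f. f holomorphic_on (- {1}) \<and> f 1 = 0 \<and>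
     (\<forall>s. Re s > 1 \<longrightarrow> (\<lambda>n. of_nat (Suc n) powr (- s)) sums f s))"

(* The condition s \<noteq> 1 discards the conventional value at the pole. *)
definition nontrivial_zeros :: "complex set" where
  "nontrivial_zeros =
     {s. s \<noteq> 1 \<and> zeta s = 0 \<and> (\<forall>k::nat. k \<ge> 1 \<longrightarrow> s \<noteq> - 2 * of_nat k)}"

definition liouville :: "nat \<Rightarrow> int" where
  "liouville n = (- 1) ^ size (prime_factorization n)"

definition moebius :: "nat \<Rightarrow> int" where
  "moebius n = (if squarefree n then (- 1) ^ card (prime_factors n) else 0)"

(* c(n) = m \<mu>(k) where n = m^2 k with k squarefree, cf. squarefree_decompose *)
definition c_coeff :: "nat \<Rightarrow> int" where
  "c_coeff n = int (square_part n) * moebius (squarefree_part n)"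

(* Principal branch. rGamma is the reciprocal Gamma function, so the terms with a pole of
   Gamma (\<nu> + k + 1) vanish as they should. *)
definition Bessel_I :: "complex \<Rightarrow> complex \<Rightarrow> complex" where
  "Bessel_I \<nu> z =
     (\<Sum>k. (z / 2) powr (\<nu> + 2 * of_nat k) * rGamma (\<nu> + of_nat k + 1) / fact k)"

definition Bessel_K :: "complex \<Rightarrow> complex \<Rightarrow> complex" where
  "Bessel_K \<nu> z =
     (let K = (\<lambda>\<mu>. of_real pi / 2 * (Bessel_I (- \<mu>) z - Bessel_I \<mu> z) / sin (\<mu> * of_real pi))
      in if \<nu> \<in> \<int> then Lim (at \<nu>) K else K \<nu>)"

end

theory Submission imports Defs "HOL-Real_Asymp.Real_Asymp" begin

text \<open>
  Consider \<open>\<Gamma>(s) / \<Gamma>(s/2) * \<zeta>(2s) / \<zeta>(s) * (sqrt \<pi> x)\<^sup>-\<^sup>s\<close> and move the line of integration from \<open>Re s = 5/4\<close>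
  to \<open>Re s = -1/4\<close>; the residues crossed are those at \<open>1/2\<close> and at the zeros of \<open>\<zeta>\<close>. On the right
  line \<open>\<zeta>(2s) / \<zeta>(s)\<close> is the Dirichlet series of \<open>\<lambda>\<close>. On the left line the functional equation, used at
  \<open>s\<close> and at \<open>2s\<close>, gives with \<open>w = 1 - s\<close> the kernel \<open>\<Gamma>(w - 1/2) / \<Gamma>(w/2)\<close> times
  \<open>\<zeta>(2w - 1) / \<zeta>(w)\<close>, the Dirichlet series of \<open>c\<close>. Both series are integrated termwise; the inverse
  Mellin transforms of the two kernels are found by moving the line to \<open>-\<infinity>\<close> and summing residues, which
  yields the Gaussian and the Bessel functions.

  The heights \<open>T\<^sub>j\<close> must keep \<open>1 / \<zeta>\<close> smaller on the horizontal segments than \<open>exp (T/4)\<close>, because the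
  kernel decays like \<open>exp (-T/2)\<close>. A disc of fixed radius around \<open>2 + i T\<close> contains \<open>O(log T)\<close> zeros by
  Jensen's inequality. Dividing them out by Blaschke factors leaves a function without zeros, which
  is bounded below, and some height is at distance at least \<open>const / log T\<close> from all of them, so
  that \<open>log \<bar>1 / \<zeta>\<bar> = O(log\<^sup>2 T)\<close> there.
\<close>

section \<open>Moving a vertical line of integration\<close>

text \<open>On the strip 2 s has real part down to -1/2, so zeta must be controlled to the left of
  Re s = 0; hence the trapezoidal rule. As \<open>zeta\<close> is a definite description, its
  existence on the whole punctured plane has to be proved as well. The functional equation serves
  both that purpose and the reflection. It comes from an identity between sums of nonnegative terms
  on the real segment (-1, 0), where Tonelli justifies every interchange, and the identity theorem
  spreads it. Simplicity of the zeros enters twice: it makes the residues explicit, and it ensures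
  that dividing once by each zero leaves a function without zeros. That zeta(1/2) is not 0 separates
  the pole of zeta(2 s) from the zeros. The totalised values of \<open>Gamma\<close> and of division
  at isolated points are wrong for a contour argument, so inside the strip the integrand is replaced
  by a quotient built from \<open>zeta1\<close>.\<close>

lemma rectangle_residue_bound:
  fixes a b T B :: real and f :: "complex \<Rightarrow> complex"
  assumes ab: "a < b" and T: "0 < T" and S: "open S" "convex S"
    and sub: "cbox (Complex a (-T)) (Complex b T) \<subseteq> S"
    and P: "finite P" and hol: "f holomorphic_on S - P"
    and disj: "P \<inter> (cbox (Complex a (-T)) (Complex b T) - box (Complex a (-T)) (Complex b T)) = {}"
    and B: "\<And>\<sigma>. a \<le> \<sigma> \<Longrightarrow> \<sigma> \<le> b \<Longrightarrow> norm (f (Complex \<sigma> T)) \<le> B"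
           "\<And>\<sigma>. a \<le> \<sigma> \<Longrightarrow> \<sigma> \<le> b \<Longrightarrow> norm (f (Complex \<sigma> (-T))) \<le> B"
  shows "norm (integral {-T..T} (\<lambda>t. f (Complex b t)) - integral {-T..T} (\<lambda>t. f (Complex a t))
           - 2 * pi * (\<Sum>p\<in>P \<inter> box (Complex a (-T)) (Complex b T). residue f p)) \<le> 2 * (b - a) * B"
proof -
  define a1 a2 a3 a4 where "a1 = Complex a (-T)" and "a2 = Complex b (-T)"
    and "a3 = Complex b T" and "a4 = Complex a T"
  note d = a1_def a2_def a3_def a4_def
  have B0: "0 \<le> B"
    using B(1)[of a] ab norm_ge_zero order_trans by (metis less_imp_le order_refl)
  have img: "path_image (rectpath a1 a3) = cbox a1 a3 - box a1 a3"
    using ab T by (intro path_image_rectpath_cbox_minus_box) (auto simp: d)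
  have pieces: "path_image (rectpath a1 a3) = closed_segment a1 a2 \<union> closed_segment a2 a3 \<union>
      closed_segment a3 a4 \<union> closed_segment a4 a1"
    by (simp add: rectpath_def Let_def path_image_join d Un_assoc)
  have imgS: "path_image (rectpath a1 a3) \<subseteq> S - P"
    using sub disj unfolding img by (auto simp: d)
  have cont: "continuous_on (S - P) f"
    using hol by (rule holomorphic_on_imp_continuous_on)
  have ci: "f contour_integrable_on linepath p q" if "closed_segment p q \<subseteq> path_image (rectpath a1 a3)" for p q
    by (intro contour_integrable_continuous_linepath continuous_on_subset[OF cont]) (use that imgS in auto)
  have cis: "f contour_integrable_on linepath a1 a2" "f contour_integrable_on linepath a2 a3"
     "f contour_integrable_on linepath a3 a4" "f contour_integrable_on linepath a4 a1"
    by (intro ci; simp add: pieces; blast)+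
  have "contour_integral (rectpath a1 a3) f =
     contour_integral (linepath a1 a2) f + contour_integral (linepath a2 a3) f +
     contour_integral (linepath a3 a4) f + contour_integral (linepath a4 a1) f"
    using cis by (simp add: rectpath_def Let_def d add.assoc)
  moreover have "contour_integral (rectpath a1 a3) f =
      2 * pi * \<i> * (\<Sum>p\<in>P. winding_number (rectpath a1 a3) p * residue f p)"
  proof (rule Residue_theorem[OF S(1) convex_connected[OF S(2)] P hol])
    show "\<forall>z. z \<notin> S \<longrightarrow> winding_number (rectpath a1 a3) z = 0"
      using sub ab T by (intro allI impI winding_number_rectpath_outside) (auto simp: d)
  qed (use imgS in auto)
  moreover have "(\<Sum>p\<in>P. winding_number (rectpath a1 a3) p * residue f p) = (\<Sum>p\<in>P \<inter> box a1 a3. residue f p)"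
  proof (rule sum.mono_neutral_cong_right[OF P])
    show "\<forall>i\<in>P - P \<inter> box a1 a3. winding_number (rectpath a1 a3) i * residue f i = 0"
    proof
      fix i assume i: "i \<in> P - P \<inter> box a1 a3"
      then have "i \<notin> cbox a1 a3" using disj by (auto simp: d)
      then have "winding_number (rectpath a1 a3) i = 0"
        using ab T by (intro winding_number_rectpath_outside) (auto simp: d)
      then show "winding_number (rectpath a1 a3) i * residue f i = 0" by simp
    qed
  qed (auto simp: winding_number_rectpath)
  ultimately have eq: "2 * pi * \<i> * (\<Sum>p\<in>P \<inter> box a1 a3. residue f p) =
     contour_integral (linepath a1 a2) f + contour_integral (linepath a2 a3) f +
     contour_integral (linepath a3 a4) f + contour_integral (linepath a4 a1) f" by simp
  \<comment> \<open>On a vertical segment dz = i dt; this i cancels the one in the residue theorem,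
    so the statement has 2 pi without i.\<close>
  have r: "contour_integral (linepath a2 a3) f = \<i> * integral {-T..T} (\<lambda>t. f (Complex b t))"
  proof -
    have "(f has_contour_integral contour_integral (linepath a2 a3) f) (linepath a2 a3)"
      using cis(2) has_contour_integral_integral by blast
    then have "((\<lambda>t. f (Complex b t)) has_integral (-\<i> * contour_integral (linepath a2 a3) f)) {-T..T}"
      using T by (subst (asm) has_contour_integral_linepath_same_Re_iff) (auto simp: d)
    then show ?thesis by (simp add: integral_unique)
  qed
  have l: "contour_integral (linepath a4 a1) f = - (\<i> * integral {-T..T} (\<lambda>t. f (Complex a t)))"
  proof -
    have "f contour_integrable_on linepath a1 a4"
      by (rule ci) (auto simp: pieces closed_segment_commute)
    then have "(f has_contour_integral contour_integral (linepath a1 a4) f) (linepath a1 a4)"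
      using has_contour_integral_integral by blast
    then have "((\<lambda>t. f (Complex a t)) has_integral (-\<i> * contour_integral (linepath a1 a4) f)) {-T..T}"
      using T by (subst (asm) has_contour_integral_linepath_same_Re_iff) (auto simp: d)
    moreover have "contour_integral (linepath a4 a1) f = - contour_integral (linepath a1 a4) f"
      by (metis contour_integral_reversepath reversepath_linepath valid_path_linepath)
    ultimately show ?thesis by (simp add: integral_unique)
  qed
  have n1: "norm (contour_integral (linepath a1 a2) f) \<le> B * norm (a2 - a1)"
    using cis(1) B0 B(2) ab by (intro contour_integral_bound_linepath)
      (auto simp: d closed_segment_same_Im closed_segment_eq_real_ivl complex_eq_iff intro!: B
         | metis complex.collapse)+
  have n2: "norm (contour_integral (linepath a3 a4) f) \<le> B * norm (a4 - a3)"
    using cis(3) B0 B(1) ab by (intro contour_integral_bound_linepath)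
      (auto simp: d closed_segment_same_Im closed_segment_eq_real_ivl complex_eq_iff intro!: B
         | metis complex.collapse)+
  have len: "norm (a2 - a1) = b - a" "norm (a4 - a3) = b - a"
    using ab by (auto simp: d cmod_def)
  have "\<i> * (integral {-T..T} (\<lambda>t. f (Complex b t)) - integral {-T..T} (\<lambda>t. f (Complex a t))
           - 2 * pi * (\<Sum>p\<in>P \<inter> box a1 a3. residue f p)) =
      - (contour_integral (linepath a1 a2) f + contour_integral (linepath a3 a4) f)"
    using eq unfolding r l by (simp add: algebra_simps)
  then have "norm (integral {-T..T} (\<lambda>t. f (Complex b t)) - integral {-T..T} (\<lambda>t. f (Complex a t))
           - 2 * pi * (\<Sum>p\<in>P \<inter> box a1 a3. residue f p)) =
      norm (contour_integral (linepath a1 a2) f + contour_integral (linepath a3 a4) f)"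
    by (metis norm_minus_cancel norm_mult norm_ii mult_1)
  also have "\<dots> \<le> 2 * (b - a) * B"
    using norm_triangle_le[OF add_mono[OF n1 n2]] len by (simp add: algebra_simps)
  finally show ?thesis unfolding d .
qed

text \<open>Dominated convergence with majorant |g|. It links the gauge integrals over
  \<open>{-T..T}\<close> coming from the contour to Lebesgue integrals over the whole line.\<close>

lemma integral_symmetric_interval_tendsto:
  fixes g :: "real \<Rightarrow> complex"
  assumes g: "integrable lborel g" and T: "filterlim T at_top sequentially"
  shows "(\<lambda>j. integral {-T j..T j} g) \<longlonglongrightarrow> integral\<^sup>L lborel g"
proof -
  have "integral {-T j..T j} g = (LINT t|lborel. indicator {-T j..T j} t *\<^sub>R g t)" for j
  proof -
    have "set_integrable lborel {-T j..T j} g"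
      unfolding set_integrable_def using g by (intro integrable_mult_indicator) auto
    then show ?thesis
      using set_borel_integral_eq_integral(2)[of "{-T j..T j}" g]
      by (simp add: set_lebesgue_integral_def)
  qed
  moreover have "(\<lambda>j. LINT t|lborel. indicator {-T j..T j} t *\<^sub>R g t) \<longlonglongrightarrow> integral\<^sup>L lborel g"
  proof (rule integral_dominated_convergence[where w="\<lambda>t. norm (g t)"])
    show "AE t in lborel. (\<lambda>j. indicator {-T j..T j} t *\<^sub>R g t) \<longlonglongrightarrow> g t"
    proof (rule AE_I2)
      fix t :: real
      have "eventually (\<lambda>j. \<bar>t\<bar> \<le> T j) sequentially"
        using T by (simp add: filterlim_at_top)
      then have "eventually (\<lambda>j. indicator {-T j..T j} t *\<^sub>R g t = g t) sequentially"
        by eventually_elim (auto simp: indicator_def)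
      then show "(\<lambda>j. indicator {-T j..T j} t *\<^sub>R g t) \<longlonglongrightarrow> g t"
        by (rule tendsto_eventually)
    qed
  qed (use g in \<open>auto simp: indicator_def\<close>)
  ultimately show ?thesis by simp
qed

text \<open>The horizontal sides cost at most 2 (b - a) \<open>\<epsilon> j\<close>, which tends to
  0, and the two vertical integrals converge separately. So the residue sums converge along the
  heights \<open>T j\<close>.\<close>

lemma strip_residue_limit:
  fixes f :: "complex \<Rightarrow> complex" and T \<epsilon> :: "nat \<Rightarrow> real"
  assumes ab: "a' < a" "a < b" "b < b'"
    and hol: "f holomorphic_on {z. a' < Re z \<and> Re z < b'} - P"
    and P: "\<And>p. p \<in> P \<Longrightarrow> a < Re p \<and> Re p < b" "\<And>R. finite {p \<in> P. \<bar>Im p\<bar> < R}"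
    and T: "\<And>j. T j > 0" "filterlim T at_top sequentially"
    and avoid: "\<And>j p. p \<in> P \<Longrightarrow> \<bar>Im p\<bar> \<noteq> T j"
    and eps: "\<epsilon> \<longlonglongrightarrow> 0"
    and B: "\<And>j z. a \<le> Re z \<Longrightarrow> Re z \<le> b \<Longrightarrow> \<bar>Im z\<bar> = T j \<Longrightarrow> norm (f z) \<le> \<epsilon> j"
    and int: "integrable lborel (\<lambda>t. f (Complex a t))" "integrable lborel (\<lambda>t. f (Complex b t))"
  shows "(\<lambda>j. 2 * pi * (\<Sum>p | p \<in> P \<and> \<bar>Im p\<bar> < T j. residue f p)) \<longlonglongrightarrow>
           (LINT t|lborel. f (Complex b t)) - (LINT t|lborel. f (Complex a t))"
proof -
  let ?I = "\<lambda>j. integral {-T j..T j} (\<lambda>t. f (Complex b t)) - integral {-T j..T j} (\<lambda>t. f (Complex a t))"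
  let ?R = "\<lambda>j. 2 * pi * (\<Sum>p | p \<in> P \<and> \<bar>Im p\<bar> < T j. residue f p)"
  have bd: "norm (?I j - ?R j) \<le> 2 * (b - a) * \<epsilon> j" for j
  proof -
    \<comment> \<open>The residue theorem wants an open set around the closed rectangle. One extra
      unit of height keeps the number of poles finite; \<open>a'\<close> and \<open>b'\<close> give
      the room at the sides.\<close>
    define S where "S = box (Complex a' (- (T j + 1))) (Complex b' (T j + 1))"
    define Q where "Q = {p \<in> P. \<bar>Im p\<bar> < T j + 1}"
    have eq: "Q \<inter> box (Complex a (-T j)) (Complex b (T j)) = {p. p \<in> P \<and> \<bar>Im p\<bar> < T j}"
      using P(1) unfolding Q_def by (force simp: in_box_complex_iff)
    have "norm (?I j - 2 * pi * (\<Sum>p\<in>Q \<inter> box (Complex a (-T j)) (Complex b (T j)). residue f p)) \<le> 2 * (b - a) * \<epsilon> j"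
    proof (rule rectangle_residue_bound)
      show "open S" "convex S" unfolding S_def by (auto intro: open_box convex_box)
      show "cbox (Complex a (-T j)) (Complex b (T j)) \<subseteq> S"
        using ab by (auto simp: S_def in_box_complex_iff in_cbox_complex_iff)
      show "finite Q" unfolding Q_def by (rule P)
      show "f holomorphic_on S - Q"
        by (rule holomorphic_on_subset[OF hol]) (auto simp: S_def Q_def in_box_complex_iff)
      show "Q \<inter> (cbox (Complex a (-T j)) (Complex b (T j)) - box (Complex a (-T j)) (Complex b (T j))) = {}"
        using P(1) avoid[of _ j] unfolding Q_def
        by (force simp: in_box_complex_iff in_cbox_complex_iff)
      show "norm (f (Complex \<sigma> (T j))) \<le> \<epsilon> j" "norm (f (Complex \<sigma> (- T j))) \<le> \<epsilon> j"
        if "a \<le> \<sigma>" "\<sigma> \<le> b" for \<sigma>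
        using that T(1)[of j] by (auto intro!: B)
    qed (use ab T in auto)
    then show ?thesis unfolding eq .
  qed
  have "(\<lambda>j. ?I j - ?R j) \<longlonglongrightarrow> 0"
  proof (rule Lim_null_comparison[where g="\<lambda>j. 2 * (b - a) * \<epsilon> j"])
    show "(\<lambda>j. 2 * (b - a) * \<epsilon> j) \<longlonglongrightarrow> 0"
      using tendsto_mult_left[OF eps, of "2 * (b - a)"] by simp
  qed (use bd in auto)
  moreover have "?I \<longlonglongrightarrow> (LINT t|lborel. f (Complex b t)) - (LINT t|lborel. f (Complex a t))"
    by (intro tendsto_diff integral_symmetric_interval_tendsto int T)
  ultimately have "(\<lambda>j. ?I j - (?I j - ?R j)) \<longlonglongrightarrow> (LINT t|lborel. f (Complex b t)) - (LINT t|lborel. f (Complex a t)) - 0"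
    by (rule tendsto_diff[rotated])
  then show ?thesis by simp
qed

lemma integrable_vertical_line:
  fixes g :: "real \<Rightarrow> complex"
  assumes cont: "continuous_on UNIV g" and \<delta>: "\<delta> > 0"
    and B: "\<And>t. \<bar>t\<bar> \<ge> 1 \<Longrightarrow> norm (g t) \<le> C * exp (- \<delta> * \<bar>t\<bar>)"
  shows "integrable lborel g"
proof -
  have "bounded (g ` {-1..1})"
    by (intro compact_imp_bounded compact_continuous_image continuous_on_subset[OF cont]) auto
  then obtain M where M: "\<And>t. t \<in> {-1..1} \<Longrightarrow> norm (g t) \<le> M"
    unfolding bounded_iff by blast
  \<comment> \<open>The factor exp \<delta> makes up for the decay on |t| < 1, where only the bound
    \<open>M\<close> is available.\<close>
  define D where "D = max \<bar>M\<bar> 0 * exp \<delta> + \<bar>C\<bar>"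
  have bd: "norm (g t) \<le> D * exp (- \<delta> * \<bar>t\<bar>)" for t
  proof (cases "\<bar>t\<bar> \<ge> 1")
    case True
    have "C * exp (- \<delta> * \<bar>t\<bar>) \<le> D * exp (- \<delta> * \<bar>t\<bar>)"
      unfolding D_def by (intro mult_right_mono) (auto intro: add_increasing)
    then show ?thesis using B[OF True] by linarith
  next
    case False
    then have "norm (g t) \<le> \<bar>M\<bar>" using M[of t] abs_ge_self[of M] by (simp add: abs_le_iff) linarith
    also have "\<dots> = \<bar>M\<bar> * exp \<delta> * exp (- \<delta>)" by (simp add: exp_minus)
    also have "\<dots> \<le> D * exp (- \<delta> * \<bar>t\<bar>)"
      unfolding D_def using False \<delta> by (intro mult_mono) (auto simp: mult_le_cancel_left1)
    finally show ?thesis .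
  qed
  have e: "integrable lborel (\<lambda>t. exp (- \<delta> * \<bar>t\<bar>))"
  proof -
    have "(\<lambda>t. exp (- \<delta> * t)) absolutely_integrable_on {0..}"
      using \<delta> by (intro nonnegative_absolutely_integrable_1 integrable_on_exp_minus_to_infinity) auto
    then have 1: "integrable lborel (\<lambda>t. indicator {0..} t *\<^sub>R exp (- \<delta> * t))"
      unfolding set_integrable_def by (subst (asm) integrable_completion) auto
    then have 2: "integrable lborel (\<lambda>t. indicator {0..} (-t) *\<^sub>R exp (- \<delta> * (-t)))"
      using lborel_integrable_real_affine[OF 1, of "-1" 0] by simp
    show ?thesis
      by (rule Bochner_Integration.integrable_bound[OF Bochner_Integration.integrable_add[OF 1 2]])
         (auto simp: indicator_def abs_if)
  qed
  show ?thesis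
    by (rule Bochner_Integration.integrable_bound[OF integrable_mult_right[OF e, of D]])
       (use bd in \<open>auto intro!: borel_measurable_continuous_onI cont order_trans[OF _ abs_ge_self]\<close>)
qed

section \<open>Decay of the Gamma function on vertical lines\<close>

text \<open>In Gauss's product for |Gamma(\<sigma> + i t)| / Gamma(\<sigma>) every factor (\<sigma>
  + k) / |\<sigma> + k + i t| increases with \<sigma>. Decay on one vertical line thus yields decay
  on all lines to its left.\<close>

lemma norm_Gamma_ratio_mono:
  fixes \<sigma> \<tau> t :: real
  assumes "0 < \<sigma>" "\<sigma> \<le> \<tau>"
  shows "norm (Gamma (Complex \<sigma> t)) * Gamma \<tau> \<le> norm (Gamma (Complex \<tau> t)) * Gamma \<sigma>"
proof (rule LIMSEQ_le)
  show "(\<lambda>n. norm (Gamma_series (Complex \<sigma> t) n) * Gamma_series \<tau> n) \<longlonglongrightarrow> norm (Gamma (Complex \<sigma> t)) * Gamma \<tau>"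
    by (intro tendsto_intros)
  show "(\<lambda>n. norm (Gamma_series (Complex \<tau> t) n) * Gamma_series \<sigma> n) \<longlonglongrightarrow> norm (Gamma (Complex \<tau> t)) * Gamma \<sigma>"
    by (intro tendsto_intros)
  have "norm (Gamma_series (Complex \<sigma> t) n) * Gamma_series \<tau> n
       \<le> norm (Gamma_series (Complex \<tau> t) n) * Gamma_series \<sigma> n" for n
  proof -
    have pos: "0 < pochhammer r (n + 1)" if "r > 0" for r :: real
      using that by (intro pochhammer_pos)
    have npos: "0 < norm (pochhammer (Complex r t) (n + 1))" if "r > 0" for r :: real
    proof -
      have "pochhammer (Complex r t) (n + 1) \<noteq> 0"
      proof
        assume "pochhammer (Complex r t) (n + 1) = 0"
        then obtain k where "Complex r t = - of_nat k" by (auto simp only: pochhammer_eq_0_iff)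
        then show False using that by (simp add: complex_eq_iff)
      qed
      then show ?thesis by simp
    qed
    have step: "(\<sigma> + i) * norm (Complex \<tau> t + of_nat i) \<le> (\<tau> + i) * norm (Complex \<sigma> t + of_nat i)" for i :: nat
    proof (rule power2_le_imp_le)
      have "(\<sigma> + i)\<^sup>2 * t\<^sup>2 \<le> (\<tau> + i)\<^sup>2 * t\<^sup>2"
        using assms by (intro mult_right_mono power_mono) auto
      then have "(\<sigma> + i)\<^sup>2 * ((\<tau> + i)\<^sup>2 + t\<^sup>2) \<le> (\<tau> + i)\<^sup>2 * ((\<sigma> + i)\<^sup>2 + t\<^sup>2)"
        by (simp add: algebra_simps)
      then show "((\<sigma> + i) * norm (Complex \<tau> t + of_nat i))\<^sup>2 \<le> ((\<tau> + i) * norm (Complex \<sigma> t + of_nat i))\<^sup>2"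
        by (simp add: power_mult_distrib cmod_power2)
    qed (use assms in auto)
    have "pochhammer \<sigma> (n + 1) * norm (pochhammer (Complex \<tau> t) (n + 1))
        \<le> pochhammer \<tau> (n + 1) * norm (pochhammer (Complex \<sigma> t) (n + 1))"
      unfolding pochhammer_prod prod_norm[symmetric] prod.distrib[symmetric]
      using step assms by (intro prod_mono) auto
    then have le: "pochhammer \<sigma> (n + 1) / norm (pochhammer (Complex \<sigma> t) (n + 1))
        \<le> pochhammer \<tau> (n + 1) / norm (pochhammer (Complex \<tau> t) (n + 1))"
      using npos[of \<sigma>] npos[of \<tau>] assms by (simp add: divide_simps mult.commute)
    have G: "norm (Gamma_series (Complex r t) n) =
        Gamma_series r n * (pochhammer r (n + 1) / norm (pochhammer (Complex r t) (n + 1)))" if "r > 0" for r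
      using pos[OF that] npos[OF that]
      by (simp add: Gamma_series_def norm_mult norm_divide divide_simps)
    have "0 \<le> Gamma_series \<sigma> n * Gamma_series \<tau> n"
      using pos[of \<sigma>] pos[of \<tau>] assms by (simp add: Gamma_series_def)
    from mult_left_mono[OF le this] show ?thesis
      using assms by (simp add: G mult_ac)
  qed
  then show "\<exists>N. \<forall>n\<ge>N. norm (Gamma_series (Complex \<sigma> t) n) * Gamma_series \<tau> n
       \<le> norm (Gamma_series (Complex \<tau> t) n) * Gamma_series \<sigma> n" by blast
qed

text \<open>Reflection gives |Gamma(1 + i t)|^2 = pi t / sinh(pi t), and one more factor 1 + i t
  leads to the line Re = 2. Only the rate 1 of the true rate pi/2 is kept; the surplus absorbs the
  powers of t.\<close>

lemma norm_Gamma_2_decay: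
  assumes t: "\<bar>t\<bar> \<ge> 1 / 2"
  shows "norm (Gamma (Complex 2 t)) \<le> 11 * exp (- \<bar>t\<bar>)"
proof -
  define z where "z = \<i> * of_real t"
  have nz: "1 + z \<notin> \<int>\<^sub>\<le>\<^sub>0" "z \<notin> \<int>\<^sub>\<le>\<^sub>0" 
    using t by (auto simp: z_def complex_eq_iff elim!: nonpos_Ints_cases)
  have G2: "Gamma (Complex 2 t) = (1 + z) * Gamma (1 + z)"
    using Gamma_plus1[OF nz(1)] by (simp add: z_def Complex_eq add_ac)
  have G1: "Gamma (1 + z) * Gamma (1 - z) = z * (of_real pi / sin (of_real pi * z))"
    using Gamma_plus1[OF nz(2)] by (simp add: add.commute mult.assoc flip: Gamma_reflection_complex)
  have "Gamma (1 - z) = cnj (Gamma (1 + z))"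
    by (simp add: cnj_Gamma z_def)
  then have "norm (Gamma (1 + z)) ^ 2 = norm (Gamma (1 + z) * Gamma (1 - z))"
    by (simp add: norm_mult power2_eq_square)
  also have "\<dots> = \<bar>t\<bar> * pi / norm (sin (of_real pi * z))"
    unfolding G1 by (simp add: z_def norm_mult norm_divide)
  also have "sin (of_real pi * z) = \<i> * of_real (sinh (pi * t))"
  proof -
    have "exp (- complex_of_real (pi * t)) = of_real (exp (- (pi * t)))"
         "exp (complex_of_real (pi * t)) = of_real (exp (pi * t))"
      by (simp_all only: exp_of_real flip: of_real_minus)
    then show ?thesis
      by (simp add: sin_exp_eq z_def sinh_def mult_ac field_simps)
  qed
  also have "norm \<dots> = sinh (pi * \<bar>t\<bar>)"
  proof (cases "t \<ge> 0")
    case False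
    then have "sinh (pi * t) < 0" by (simp add: mult_pos_neg)
    then show ?thesis using False by (simp add: norm_mult)
  qed (simp add: norm_mult)
  finally have G1': "norm (Gamma (1 + z)) ^ 2 = \<bar>t\<bar> * pi / sinh (pi * \<bar>t\<bar>)" .
  have x: "pi * \<bar>t\<bar> \<ge> 3 * \<bar>t\<bar>" using pi_gt3 by (intro mult_right_mono) auto
  have "exp (- (pi * \<bar>t\<bar>)) \<le> exp (-1)" using x t by simp
  also have "exp (-1 :: real) \<le> 1 / 2"
    using exp_ge_add_one_self[of "1::real"] by (simp add: exp_minus field_simps)
  finally have "exp (- (pi * \<bar>t\<bar>)) \<le> 1 / 2" .
  have sh: "exp (3 * \<bar>t\<bar>) / 4 \<le> sinh (pi * \<bar>t\<bar>)"
  proof -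
    have "A / 4 \<le> (B - e) / 2" if "e \<le> 1 / 2" "A \<le> B" "1 \<le> A" for A B e :: real
      using that by simp
    then show ?thesis unfolding sinh_field_def
      using \<open>exp (- (pi * \<bar>t\<bar>)) \<le> 1 / 2\<close> x by (metis exp_le_cancel_iff one_le_exp_iff abs_ge_zero mult_nonneg_nonneg zero_le_numeral)
  qed
  have "norm (Gamma (1 + z)) ^ 2 \<le> \<bar>t\<bar> * pi / (exp (3 * \<bar>t\<bar>) / 4)"
    unfolding G1' using sh by (intro divide_left_mono) (auto intro!: mult_pos_pos less_le_trans[OF _ sh])
  moreover have "norm (1 + z) ^ 2 = 1 + \<bar>t\<bar>\<^sup>2"
    by (simp add: cmod_power2 z_def)
  ultimately have "norm (Gamma (Complex 2 t)) ^ 2 \<le> (1 + \<bar>t\<bar>\<^sup>2) * (\<bar>t\<bar> * pi / (exp (3 * \<bar>t\<bar>) / 4))"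
    unfolding G2 norm_mult power_mult_distrib by (metis mult_left_mono zero_le_power2)
  also have "\<dots> = 4 * pi * (\<bar>t\<bar> + \<bar>t\<bar>^3) * exp (- 3 * \<bar>t\<bar>)"
    by (simp add: exp_minus field_simps power3_eq_cube power2_eq_square)
  also have "\<dots> \<le> 4 * 4 * (exp \<bar>t\<bar> + 6 * exp \<bar>t\<bar>) * exp (- 3 * \<bar>t\<bar>)"
  proof (intro mult_right_mono mult_mono add_mono)
    show "\<bar>t\<bar> \<le> exp \<bar>t\<bar>" using exp_ge_add_one_self[of "\<bar>t\<bar>"] by linarith
    have "\<bar>t\<bar>^3 / 6 \<le> (\<Sum>k<4. \<bar>t\<bar>^k / fact k)"
      by (simp add: eval_nat_numeral)
    also have "\<dots> \<le> exp \<bar>t\<bar>"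
      unfolding exp_def by (auto intro!: sum_le_suminf summable_exp simp: divide_inverse mult.commute)
    finally show "\<bar>t\<bar>^3 \<le> 6 * exp \<bar>t\<bar>" by simp
  qed (use pi_less_4 in auto)
  \<comment> \<open>Origin of the constant: 16 * 7 = 112 does not exceed 11^2 = 121.\<close>
  also have "\<dots> = (11 * exp (- \<bar>t\<bar>))\<^sup>2 * (112 / 121)"
    by (simp add: power_mult_distrib flip: exp_double exp_add)
  also have "\<dots> \<le> (11 * exp (- \<bar>t\<bar>))\<^sup>2 * 1"
    by (intro mult_left_mono) auto
  finally have "norm (Gamma (Complex 2 t)) ^ 2 \<le> (11 * exp (- \<bar>t\<bar>))\<^sup>2" by simp
  then show ?thesis by (rule power2_le_imp_le) simp
qed

lemma norm_Gamma_decay: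
  assumes "0 < l"
  obtains C where "C \<ge> 0" "\<And>z. l \<le> Re z \<Longrightarrow> Re z \<le> 2 \<Longrightarrow> \<bar>Im z\<bar> \<ge> 1 / 2 \<Longrightarrow> norm (Gamma z) \<le> C * exp (- \<bar>Im z\<bar>)"
proof -
  have "compact ((Gamma :: real \<Rightarrow> real) ` {l..2})"
    using assms by (intro compact_continuous_image continuous_on_Gamma) (auto elim!: nonpos_Ints_cases)
  then obtain M where M: "\<And>\<sigma>. l \<le> \<sigma> \<Longrightarrow> \<sigma> \<le> 2 \<Longrightarrow> \<bar>Gamma \<sigma> :: real\<bar> \<le> M"
    by (force dest: compact_imp_bounded simp: bounded_iff)
  show thesis
  proof (rule that[of "11 * \<bar>M\<bar>"])
    fix z assume z: "l \<le> Re z" "Re z \<le> 2" "\<bar>Im z\<bar> \<ge> 1 / 2"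
    have "Gamma (2::real) = 1"
      using Gamma_fact[of 1, where 'a=real] by simp
    then have "norm (Gamma z) \<le> norm (Gamma (Complex 2 (Im z))) * Gamma (Re z)"
      using norm_Gamma_ratio_mono[of "Re z" 2 "Im z"] z assms by simp
    also have "\<dots> \<le> (11 * exp (- \<bar>Im z\<bar>)) * \<bar>M\<bar>"
      using M[of "Re z"] z assms by (intro mult_mono norm_Gamma_2_decay) auto
    finally show "norm (Gamma z) \<le> 11 * \<bar>M\<bar> * exp (- \<bar>Im z\<bar>)" by (simp add: mult_ac)
  qed auto
qed

section \<open>Mellin inversion of quotients of Gamma functions\<close>

text \<open>a = 0 is the kernel of the original integrand, a = 1/2 the kernel after the reflection w
  = 1 - s. With \<open>rGamma\<close>, which is entire, the only possible poles are the points a -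
  k.\<close>

definition hker :: "real \<Rightarrow> complex \<Rightarrow> complex" where
  "hker a w = Gamma (w - of_real a) * rGamma (w / 2)"

lemma hker_shift:
  assumes "w - of_real a \<noteq> 0" "w - of_real a + 1 \<noteq> 0"
  shows "hker a w = hker a (w + 2) * (w / 2) / ((w - of_real a) * (w - of_real a + 1))"
proof (cases "w - of_real a \<in> \<int>\<^sub>\<le>\<^sub>0")
  \<comment> \<open>At a pole \<open>Gamma\<close> has the default value 0. Since 0 and -1 are
    excluded, w + 2 - a is a pole too, and both sides vanish.\<close>
  case True
  then obtain n where n: "w - of_real a = - of_nat n" by (auto elim: nonpos_Ints_cases')
  then have "n \<noteq> 0" "n \<noteq> 1" using assms by auto
  then obtain m where "n = Suc (Suc m)" by (metis One_nat_def not0_implies_Suc)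
  then have "w + 2 - of_real a = - of_nat m" using n by (simp add: algebra_simps)
  then show ?thesis using True by (simp add: hker_def Gamma_nonpos_Int)
next
  case False
  then have 1: "Gamma (w - of_real a + 1) = (w - of_real a) * Gamma (w - of_real a)"
    by (rule Gamma_plus1)
  have "w - of_real a + 1 \<notin> \<int>\<^sub>\<le>\<^sub>0"
  proof
    assume "w - of_real a + 1 \<in> \<int>\<^sub>\<le>\<^sub>0"
    then obtain n where "w - of_real a + 1 = - of_nat n" by (auto elim: nonpos_Ints_cases')
    then have "w - of_real a = - of_nat (Suc n)" by (simp add: algebra_simps)
    then show False using False by (metis minus_of_nat_in_nonpos_Ints)
  qed
  then have 2: "Gamma (w - of_real a + 1 + 1) = (w - of_real a + 1) * Gamma (w - of_real a + 1)"
    by (rule Gamma_plus1)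
  have 3: "rGamma (w / 2) = (w / 2) * rGamma (w / 2 + 1)" by (simp only: rGamma_plus1)
  define v where "v = w - of_real a"
  have "hker a (w + 2) = Gamma (v + 1 + 1) * rGamma (w / 2 + 1)"
    by (simp add: hker_def v_def algebra_simps add_divide_distrib)
  moreover have "hker a w = Gamma v * (w / 2 * rGamma (w / 2 + 1))"
    by (subst 3[symmetric]) (simp add: hker_def v_def)
  moreover have "Gamma (v + 1 + 1) = (v + 1) * (v * Gamma v)" "v \<noteq> 0" "v + 1 \<noteq> 0"
    using assms 1 2 unfolding v_def[symmetric] by simp_all
  ultimately show ?thesis
    unfolding v_def[symmetric] by (simp only: nonzero_eq_divide_eq mult_eq_0_iff not_False_eq_True simp_thms mult_ac)
qed

text \<open>Duplication splits Gamma(w - a) into Gamma(z) Gamma(z + 1/2) with z = (w - a) / 2. The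
  quotient Gamma(z) / Gamma(w/2) is bounded by \<open>norm_Gamma_ratio_mono\<close>, because Re z is
  at most Re w / 2, and Gamma(z + 1/2) supplies the decay.\<close>

lemma hker_decay_right:
  assumes a: "0 \<le> a" "a \<le> 1 / 2"
  obtains C where "C \<ge> 0"
    "\<And>w. 1 \<le> Re w \<Longrightarrow> Re w \<le> 3 \<Longrightarrow> \<bar>Im w\<bar> \<ge> 1 \<Longrightarrow> norm (hker a w) \<le> C * exp (- \<bar>Im w\<bar> / 2)"
proof -
  obtain C where C: "C \<ge> 0" "\<And>z. 1 / 2 \<le> Re z \<Longrightarrow> Re z \<le> 2 \<Longrightarrow> \<bar>Im z\<bar> \<ge> 1 / 2 \<Longrightarrow> norm (Gamma z) \<le> C * exp (- \<bar>Im z\<bar>)"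
    using norm_Gamma_decay[of "1/2"] by (metis half_gt_zero zero_less_one)
  have "continuous_on {1..3} (\<lambda>\<sigma>::real. Gamma ((\<sigma> - a) / 2) / Gamma (\<sigma> / 2))"
    using a by (intro continuous_on_divide continuous_on_compose2[OF continuous_on_Gamma[of "{0<..}"]] continuous_intros)
      (auto simp: Gamma_eq_zero_iff elim!: nonpos_Ints_cases)
  then have "bounded ((\<lambda>\<sigma>::real. Gamma ((\<sigma> - a) / 2) / Gamma (\<sigma> / 2)) ` {1..3})"
    by (intro compact_imp_bounded compact_continuous_image) auto
  then obtain M where M: "\<And>\<sigma>. 1 \<le> \<sigma> \<Longrightarrow> \<sigma> \<le> 3 \<Longrightarrow> \<bar>Gamma ((\<sigma> - a) / 2) / Gamma (\<sigma> / 2) :: real\<bar> \<le> M"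
    by (force simp: bounded_iff)
  then have M0: "M \<ge> 0" by (meson abs_ge_zero order_trans one_le_numeral order_refl)
  show thesis
  proof (rule that[of "4 * C * M"])
    fix w assume w: "1 \<le> Re w" "Re w \<le> 3" "\<bar>Im w\<bar> \<ge> 1"
    define z where "z = (w - of_real a) / 2"
    have z: "Re z = (Re w - a) / 2" "Im z = Im w / 2" by (simp_all add: z_def)
    have z2: "2 * z = w - of_real a" by (simp add: z_def)
    have nz: "z \<notin> \<int>\<^sub>\<le>\<^sub>0" "z + 1 / 2 \<notin> \<int>\<^sub>\<le>\<^sub>0"
      using w a by (auto simp: complex_eq_iff z elim!: nonpos_Ints_cases)
    have "Gamma z * Gamma (z + 1 / 2) = exp ((1 - 2 * z) * of_real (ln 2)) * of_real (sqrt pi) * Gamma (w - of_real a)"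
      using Gamma_legendre_duplication[OF nz] by (simp only: z2)
    then have "norm (Gamma z) * norm (Gamma (z + 1 / 2)) = exp ((1 - 2 * Re z) * ln 2) * sqrt pi * norm (Gamma (w - of_real a))"
      by (simp flip: norm_mult) (simp add: norm_mult)
    \<comment> \<open>Re z is at most 3/2, so the power of 2 in the duplication formula is at least
      2^(-2).\<close>
    moreover have "1 / 4 \<le> exp ((1 - 2 * Re z) * ln 2)"
    proof -
      have "ln (1 / 4 :: real) = - 2 * ln 2" using ln_realpow[of 2 2] by (simp add: ln_div)
      also have "\<dots> \<le> (1 - 2 * Re z) * ln 2" using w a z by (intro mult_right_mono) auto
      finally have "exp (ln (1 / 4)) \<le> exp ((1 - 2 * Re z) * ln 2)" by (simp only: exp_le_cancel_iff)
      then show ?thesis by simp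
    qed
    moreover have "1 \<le> sqrt pi" using pi_gt3 by simp
    ultimately have "1 / 4 * 1 * norm (Gamma (w - of_real a)) \<le> norm (Gamma z) * norm (Gamma (z + 1 / 2))"
      by (simp only:) (intro mult_right_mono mult_mono; simp)
    then have 1: "norm (Gamma (w - of_real a)) \<le> 4 * (norm (Gamma z) * norm (Gamma (z + 1 / 2)))" by simp
    have 2: "norm (Gamma (z + 1 / 2)) \<le> C * exp (- \<bar>Im w\<bar> / 2)"
    proof -
      have "1 / 2 \<le> Re (z + 1 / 2)" "Re (z + 1 / 2) \<le> 2" "\<bar>Im (z + 1 / 2)\<bar> \<ge> 1 / 2"
        using w a z by auto
      from C(2)[OF this] show ?thesis using z by simp
    qed
    have 3: "norm (Gamma z) * norm (rGamma (w / 2)) \<le> M"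
    proof -
      have w2: "w / 2 = Complex (Re w / 2) (Im w / 2)" by (simp add: complex_eq_iff)
      have zz: "z = Complex (Re z) (Im w / 2)" by (simp add: z complex_eq_iff)
      have "norm (Gamma z) * Gamma (Re w / 2) \<le> norm (Gamma (w / 2)) * Gamma (Re z)"
        unfolding w2 by (subst zz, rule norm_Gamma_ratio_mono) (use w a z in auto)
      moreover have "Gamma (w / 2) \<noteq> 0"
        using w by (intro Gamma_nonzero) (auto simp: complex_eq_iff elim!: nonpos_Ints_cases)
      moreover have rinv: "norm (rGamma (w / 2)) = 1 / norm (Gamma (w / 2))"
        by (simp only: rGamma_inverse_Gamma norm_inverse divide_inverse mult_1)
      moreover have "Gamma (Re w / 2) > 0" "Gamma (Re z) > 0" using w a z by auto
      ultimately have "norm (Gamma z) * norm (rGamma (w / 2)) \<le> Gamma (Re z) / Gamma (Re w / 2)"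
        by (simp add: rinv divide_simps mult_ac)
      then show ?thesis using abs_le_D1[OF M[of "Re w"]] w unfolding z by linarith
    qed
    have "norm (hker a w) \<le> 4 * (norm (Gamma z) * norm (Gamma (z + 1 / 2))) * norm (rGamma (w / 2))"
      unfolding hker_def norm_mult using 1 by (intro mult_right_mono) auto
    also have "\<dots> = 4 * (norm (Gamma (z + 1 / 2)) * (norm (Gamma z) * norm (rGamma (w / 2))))" by simp
    also have "\<dots> \<le> 4 * ((C * exp (- \<bar>Im w\<bar> / 2)) * M)"
      by (intro mult_left_mono mult_mono 2 3) (use C in auto)
    finally show "norm (hker a w) \<le> 4 * C * M * exp (- \<bar>Im w\<bar> / 2)" by (simp add: mult_ac)
  qed (use C M0 in auto)
qed

text \<open>Shifting by 2 to the left costs nothing: for |Im w| >= 1 the rational factor in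
  \<open>hker_shift\<close> has norm at most 1. Finitely many shifts reach \<open>l\<close>.\<close>

lemma hker_decay:
  assumes a: "0 \<le> a" "a \<le> 1 / 2"
  shows "\<exists>C\<ge>0. \<forall>w. l \<le> Re w \<and> Re w \<le> 3 \<and> \<bar>Im w\<bar> \<ge> 1 \<longrightarrow> norm (hker a w) \<le> C * exp (- \<bar>Im w\<bar> / 2)"
proof -
  obtain C where C: "C \<ge> 0"
    "\<And>w. 1 \<le> Re w \<Longrightarrow> Re w \<le> 3 \<Longrightarrow> \<bar>Im w\<bar> \<ge> 1 \<Longrightarrow> norm (hker a w) \<le> C * exp (- \<bar>Im w\<bar> / 2)"
    using hker_decay_right[OF a] by blast
  have "norm (hker a w) \<le> C * exp (- \<bar>Im w\<bar> / 2)"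
    if "1 - 2 * real n \<le> Re w" "Re w \<le> 3" "\<bar>Im w\<bar> \<ge> 1" for n w
    using that
  proof (induction n arbitrary: w)
    case (Suc n)
    show ?case
    proof (cases "Re w \<ge> 1")
      case False
      define v where "v = w - of_real a"
      have v: "norm v \<ge> 1" "norm (v + 1) \<ge> 1"
        using abs_Im_le_cmod[of v] abs_Im_le_cmod[of "v + 1"] Suc.prems by (auto simp: v_def)
      then have nz: "v \<noteq> 0" "v + 1 \<noteq> 0" by auto
      have "w = v + of_real a" by (simp add: v_def)
      then have "norm w \<le> norm v + 1 / 2"
        using norm_triangle_ineq[of v "of_real a"] a by simp
      then have w: "norm (w / 2) \<le> norm v * norm (v + 1)"
        using v mult_left_mono[OF v(2), of "norm v"] by simp
      have "norm (hker a w) = norm (hker a (w + 2)) * (norm (w / 2) / (norm v * norm (v + 1)))"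
        using hker_shift[of w a] nz by (simp add: v_def norm_mult norm_divide)
      also have "\<dots> \<le> norm (hker a (w + 2)) * 1"
        using w nz by (intro mult_left_mono) (auto simp: divide_le_eq_1)
      also have "\<dots> \<le> C * exp (- \<bar>Im w\<bar> / 2)"
        using Suc.IH[of "w + 2"] Suc.prems False by simp
      finally show ?thesis .
    qed (use C Suc.prems in auto)
  qed (use C in auto)
  moreover obtain n where "1 - l \<le> 2 * real n" 
    using real_arch_simple[of "(1 - l) / 2"] by (auto simp: field_simps)
  ultimately show ?thesis using C(1)
    by (intro exI[of _ C]) (auto dest: order_trans[of "1 - 2 * real n" l, rotated])
qed

text \<open>Step i to the left gains a factor 1/i, uniformly in the imaginary part. The resulting
  1/M! beats the growth y^(2 M) of the power factor and allows the line to move to minus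
  infinity.\<close>

lemma hker_deep_bound:
  assumes a: "0 \<le> a" and e: "e \<le> 1 / 2" and u: "Re u = a + e"
    and ae: "a + e \<le> 2"
  shows "norm (hker a (u - 2 * of_nat M)) \<le> norm (hker a u) / fact M"
proof (induction M)
  case (Suc M)
  define i where "i = Suc M"
  define w where "w = u - 2 * of_nat i"
  have i: "real i \<ge> 1" by (simp add: i_def)
  have re: "Re (w - of_real a) = e - 2 * real i" "Re (w - of_real a + 1) = e - 2 * real i + 1"
      "Re w = a + e - 2 * real i" using u by (simp_all add: w_def)
  have nz: "w - of_real a \<noteq> 0" "w - of_real a + 1 \<noteq> 0"
    using re e i by (auto dest!: arg_cong[of _ _ Re])
  have n1: "norm w \<le> norm (w - of_real a)"
  proof (rule power2_le_imp_le)
    have "(a + e - 2 * real i)\<^sup>2 \<le> (e - 2 * real i)\<^sup>2"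
      using a e ae i by (intro abs_le_square_iff[THEN iffD1]) auto
    then show "(norm w)\<^sup>2 \<le> (norm (w - of_real a))\<^sup>2"
      unfolding cmod_power2 re by (simp add: re)
  qed auto
  have n2: "real i / 2 \<le> norm (w - of_real a + 1)"
    using abs_Re_le_cmod[of "w - of_real a + 1"] i e unfolding re by linarith
  have s: "norm (w / 2) * real i \<le> norm (w - of_real a) * norm (w - of_real a + 1)"
    using mult_mono[OF n1 n2] by simp
  have "w + 2 = u - 2 * of_nat M" by (simp add: w_def i_def)
  then have "norm (hker a w) = norm (hker a (u - 2 * of_nat M)) * (norm (w / 2) / (norm (w - of_real a) * norm (w - of_real a + 1)))"
    using hker_shift[OF nz] by (simp add: norm_mult norm_divide)
  also have "\<dots> \<le> norm (hker a (u - 2 * of_nat M)) * (1 / i)"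
    using s nz i by (intro mult_left_mono) (auto simp: field_simps)
  also have "\<dots> \<le> (norm (hker a u) / fact M) * (1 / i)"
    using Suc.IH by (intro mult_right_mono) auto
  also have "\<dots> = norm (hker a u) / fact (Suc M)" by (simp add: i_def)
  finally show ?case unfolding w_def i_def .
qed simp

lemma hker_holomorphic: "hker a holomorphic_on - {of_real a - of_nat k |k. True}"
proof -
  have "(\<lambda>w. Gamma (w - of_real a)) holomorphic_on - {of_real a - of_nat k |k. True}"
  proof (intro holomorphic_intros)
    fix z :: complex assume z: "z \<in> - {of_real a - of_nat k |k. True}"
    show "z - of_real a \<notin> \<int>\<^sub>\<le>\<^sub>0"
    proof
      assume "z - of_real a \<in> \<int>\<^sub>\<le>\<^sub>0"
      then obtain n where "z - of_real a = - of_nat n" by (auto elim: nonpos_Ints_cases')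
      then have "z = of_real a - of_nat n" by (simp add: algebra_simps)
      then show False using z by blast
    qed
  qed
  then show ?thesis
    unfolding hker_def by (rule holomorphic_on_mult) (auto intro!: holomorphic_intros)
qed

text \<open>The pole comes from \<open>Gamma\<close>, and the other factors are continuous there.
  Where \<open>rGamma\<close> vanishes the singularity is removable, and the formula correctly
  yields 0.\<close>

lemma residue_hker_powr:
  assumes y: "y > 0"
  shows "residue (\<lambda>w. hker a w * of_real y powr (-w)) (of_real a - of_nat k)
           = (-1) ^ k / fact k * rGamma ((complex_of_real a - of_nat k) / 2) * complex_of_real y powr (of_nat k - of_real a)"
    (is "residue ?f ?p = _")
proof (rule residue_simple')
  let ?s = "- {of_real a - of_nat j :: complex |j. j \<noteq> k}"
  have "closed {of_real a - of_nat j :: complex |j. j \<noteq> k}"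
  proof -
    have "{of_real a - of_nat j :: complex |j. j \<noteq> k} = (\<lambda>z. of_real a + z) ` ((\<lambda>j. - of_nat j) ` {j. j \<noteq> k})"
      by (auto simp: image_iff)
    moreover have "closed ((\<lambda>j. - of_nat j :: complex) ` {j. j \<noteq> k})"
      by (rule closed_subset_Ints) auto
    ultimately show ?thesis using closed_translation by metis
  qed
  then show "open ?s" by (intro open_Compl)
  show "?p \<in> ?s" by auto
  show "?f holomorphic_on ?s - {?p}"
    using y by (intro holomorphic_intros holomorphic_on_subset[OF hker_holomorphic]) auto
  have "((\<lambda>z. Gamma z * (z + of_nat k)) \<longlongrightarrow> (-1) ^ k / fact k) (at (- of_nat k :: complex))"
    by (rule Gamma_residues)
  then have "((\<lambda>w. Gamma (w - of_real a) * (w - of_real a + of_nat k)) \<longlongrightarrow> (-1) ^ k / fact k) (at ?p)"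
    by (subst (asm) LIM_offset_zero_iff, simp, subst LIM_offset_zero_iff) (simp_all add: algebra_simps)
  then have "((\<lambda>w. Gamma (w - of_real a) * (w - of_real a + of_nat k) * (rGamma (w / 2) * of_real y powr (-w))) \<longlongrightarrow>
       (-1) ^ k / fact k * (rGamma (?p / 2) * of_real y powr (-?p))) (at ?p)"
  proof (intro tendsto_mult)
    show "((\<lambda>w. rGamma (w / 2)) \<longlongrightarrow> rGamma (?p / 2)) (at ?p)"
      by (intro isContD continuous_intros) auto
    show "((\<lambda>w. of_real y powr (-w)) \<longlongrightarrow> of_real y powr (-?p)) (at ?p)"
      using y by (intro isContD continuous_intros) auto
  qed
  then show "((\<lambda>w. hker a w * of_real y powr (-w) * (w - ?p)) \<longlongrightarrow>
      (-1) ^ k / fact k * rGamma (?p / 2) * of_real y powr (of_nat k - of_real a)) (at ?p)"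
    by (simp add: hker_def mult_ac algebra_simps)
qed

text \<open>The maximum over the exponents is attained at an end point, which one depending on
  whether y >= 1; the sum covers both cases.\<close>

lemma powr_le_add_powr:
  fixes y l \<sigma> u :: real
  assumes "y > 0" "l \<le> \<sigma>" "\<sigma> \<le> u"
  shows "y powr (-\<sigma>) \<le> y powr (-l) + y powr (-u)"
proof (cases "y \<ge> 1")
  case True
  then have "y powr (-\<sigma>) \<le> y powr (-l)" using assms by (intro powr_mono) auto
  then show ?thesis by (simp add: add_increasing2)
next
  case False
  then have "y powr (-\<sigma>) \<le> y powr (-u)" using assms by (intro powr_mono') auto
  then show ?thesis by (simp add: add_increasing)
qed

lemma hker_powr_decay:
  assumes a: "0 \<le> a" "a \<le> 1 / 2" and y: "y > 0"
  obtains C where "C \<ge> 0" "\<And>w. l \<le> Re w \<Longrightarrow> Re w \<le> 3 \<Longrightarrow> \<bar>Im w\<bar> \<ge> 1 \<Longrightarrow>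
     norm (hker a w * of_real y powr (-w)) \<le> C * exp (- \<bar>Im w\<bar> / 2)"
proof -
  obtain C where C: "C \<ge> 0" "\<And>w. l \<le> Re w \<Longrightarrow> Re w \<le> 3 \<Longrightarrow> \<bar>Im w\<bar> \<ge> 1 \<Longrightarrow> norm (hker a w) \<le> C * exp (- \<bar>Im w\<bar> / 2)"
    using hker_decay[OF a] by metis
  show thesis
  proof (rule that[of "C * (y powr (-l) + y powr (-3))"])
    fix w assume w: "l \<le> Re w" "Re w \<le> 3" "\<bar>Im w\<bar> \<ge> 1"
    have "norm (hker a w * of_real y powr (-w)) \<le> (C * exp (- \<bar>Im w\<bar> / 2)) * (y powr (-l) + y powr (-3))"
      unfolding norm_mult using C w y powr_le_add_powr[of y l "Re w" 3]
      by (intro mult_mono) (auto simp: norm_powr_real_powr)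
    then show "norm (hker a w * of_real y powr (-w)) \<le> C * (y powr (-l) + y powr (-3)) * exp (- \<bar>Im w\<bar> / 2)"
      by (simp add: mult_ac)
  qed (use C in auto)
qed

lemma hker_line_integrable:
  assumes a: "0 \<le> a" "a \<le> 1 / 2" and y: "y > 0" and c: "c \<le> 3" "\<And>k. c \<noteq> a - real k"
  shows "integrable lborel (\<lambda>t. hker a (Complex c t) * of_real y powr (- Complex c t))"
proof -
  obtain C where C: "\<And>w. c \<le> Re w \<Longrightarrow> Re w \<le> 3 \<Longrightarrow> \<bar>Im w\<bar> \<ge> 1 \<Longrightarrow>
     norm (hker a w * of_real y powr (-w)) \<le> C * exp (- \<bar>Im w\<bar> / 2)"
    using hker_powr_decay[OF a y] by metis
  show ?thesis
  proof (rule integrable_vertical_line[where \<delta> = "1 / 2" and C = C])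
    have "continuous_on UNIV (hker a \<circ> (\<lambda>t. of_real c + \<i> * of_real t))"
      by (intro continuous_on_compose continuous_intros
            continuous_on_subset[OF holomorphic_on_imp_continuous_on[OF hker_holomorphic]])
         (use c in \<open>auto simp: complex_eq_iff\<close>)
    then show "continuous_on UNIV (\<lambda>t. hker a (Complex c t) * of_real y powr (- Complex c t))"
      using y by (auto simp: Complex_eq o_def intro!: continuous_intros)
  qed (use C[of "Complex c _"] c in auto)
qed

text \<open>\<open>K\<close> indexes the poles between the lines; the first condition
  \<open>P\<close> says that the wider open strip from \<open>l\<close> to \<open>u\<close> contains
  no others, as \<open>strip_residue_limit\<close> demands.\<close>

lemma hker_shift_line:
  assumes a: "0 \<le> a" "a \<le> 1 / 2" and y: "y > 0"
    and c: "l < c" "c < d" "d < u" "d \<le> 3"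
    and P: "\<And>k. l < a - real k \<and> a - real k < u \<longleftrightarrow> k \<in> K" "\<And>k. k \<in> K \<Longrightarrow> c < a - real k \<and> a - real k < d" "finite K"
  shows "(LINT t|lborel. hker a (Complex d t) * of_real y powr (- Complex d t)) -
     (LINT t|lborel. hker a (Complex c t) * of_real y powr (- Complex c t)) =
     2 * pi * (\<Sum>k\<in>K. (-1) ^ k / fact k * rGamma ((complex_of_real a - of_nat k) / 2) * complex_of_real y powr (of_nat k - of_real a))"
proof -
  define f where "f = (\<lambda>w. hker a w * of_real y powr (-w))"
  obtain C where C: "C \<ge> 0" "\<And>w. c \<le> Re w \<Longrightarrow> Re w \<le> 3 \<Longrightarrow> \<bar>Im w\<bar> \<ge> 1 \<Longrightarrow>
     norm (f w) \<le> C * exp (- \<bar>Im w\<bar> / 2)"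
    unfolding f_def using hker_powr_decay[OF a y] by metis
  define p where "p = (\<lambda>k. of_real a - of_nat k :: complex)"
  have Re_p: "Re (p k) = a - k" "Im (p k) = 0" for k by (simp_all add: p_def)
  have inj: "inj_on p K" by (auto simp: p_def inj_on_def)
  define L where "L = (LINT t|lborel. f (Complex d t)) - (LINT t|lborel. f (Complex c t))"
  have "(\<lambda>j. 2 * pi * (\<Sum>q | q \<in> p ` K \<and> \<bar>Im q\<bar> < real (Suc j). residue f q)) \<longlonglongrightarrow> L"
    unfolding L_def
  proof (rule strip_residue_limit[where a' = l and b' = u and \<epsilon> = "\<lambda>j. C * exp (- real (Suc j) / 2)"])
    show "f holomorphic_on {z. l < Re z \<and> Re z < u} - p ` K"
      unfolding f_def
    proof (intro holomorphic_intros holomorphic_on_subset[OF hker_holomorphic] subsetI)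
      fix z assume z: "z \<in> {z. l < Re z \<and> Re z < u} - p ` K"
      then have "z \<noteq> p k" for k using P(1)[of k] Re_p[of k] by auto
      then show "z \<in> - {of_real a - of_nat k |k. True}" by (auto simp: p_def)
    qed
    show "filterlim (\<lambda>j. real (Suc j)) at_top sequentially"
      by (rule filterlim_compose[OF filterlim_real_sequentially filterlim_Suc])
    show "(\<lambda>j. C * exp (- real (Suc j) / 2)) \<longlonglongrightarrow> 0"
      by real_asymp
    show "integrable lborel (\<lambda>t. f (Complex c t))" "integrable lborel (\<lambda>t. f (Complex d t))"
      unfolding f_def using c P(1,2) by (intro hker_line_integrable[OF a y]; force)+
    show "norm (f z) \<le> C * exp (- real (Suc j) / 2)" if "c \<le> Re z" "Re z \<le> d" "\<bar>Im z\<bar> = real (Suc j)" for j z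
      using C(2)[of z] that c by simp
  qed (use c P in \<open>auto simp: Re_p\<close>)
  \<comment> \<open>All poles are real, so each truncated residue sum is already the full one and
    the convergent sequence is constant.\<close>
  moreover have "{q. q \<in> p ` K \<and> \<bar>Im q\<bar> < real (Suc j)} = p ` K" for j
    by (auto simp: Re_p)
  ultimately have "(\<lambda>j::nat. 2 * pi * (\<Sum>q\<in>p ` K. residue f q)) \<longlonglongrightarrow> L" by simp
  then have "L = 2 * pi * (\<Sum>q\<in>p ` K. residue f q)"
    using LIMSEQ_unique tendsto_const by blast
  then have "L = 2 * pi * (\<Sum>k\<in>K. residue f (p k))"
    by (simp add: sum.reindex[OF inj])
  then show ?thesis
    unfolding L_def p_def f_def residue_hker_powr[OF y] .
qed

text \<open>The lines Re = a + 1/2 - N run midway between consecutive poles. Each unit step collects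
  exactly one residue, so a partial sum is a difference of two line integrals, the second of which
  tends to 0.\<close>

lemma hker_Mellin_inversion:
  assumes a: "0 \<le> a" "a \<le> 1 / 2" and y: "y > 0" and c: "1 < c" "c \<le> 3"
  shows "(\<lambda>k. (-1) ^ k / fact k * rGamma ((complex_of_real a - of_nat k) / 2) * complex_of_real y powr (of_nat k - of_real a)) sums
     ((LINT t|lborel. hker a (Complex c t) * of_real y powr (- Complex c t)) / (2 * pi))"
    (is "?r sums _")
proof -
  define f where "f = (\<lambda>w. hker a w * of_real y powr (-w))"
  define J where "J = (\<lambda>d. LINT t|lborel. f (Complex d t))"
  have base: "J c = J (a + 1 / 2)"
  proof -
    have "J c - J (a + 1 / 2) = 0"
      unfolding J_def f_def
      by (subst hker_shift_line[OF a y, where l = "a + 1 / 4" and u = 4 and K = "{}"]) (use a c in auto)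
    then show ?thesis by simp
  qed
  have step: "J (a + 1 / 2 - N) - J (a - 1 / 2 - N) = 2 * pi * ?r N" for N :: nat
  proof -
    have "J (a + 1 / 2 - N) - J (a - 1 / 2 - N) = 2 * pi * (\<Sum>k\<in>{N}. ?r k)"
      unfolding J_def f_def
    proof (subst hker_shift_line[OF a y, where K = "{N}" and l = "a - 3 / 4 - N" and u = "a + 3 / 4 - N"])
      fix k
      have "\<bar>real k - real N\<bar> < 1 \<longleftrightarrow> k = N" by linarith
      then show "a - 3 / 4 - N < a - real k \<and> a - real k < a + 3 / 4 - N \<longleftrightarrow> k \<in> {N}"
        by auto
    qed (use a in auto)
    then show ?thesis by simp
  qed
  have part: "2 * pi * (\<Sum>k<N. ?r k) = J c - J (a + 1 / 2 - N)" for N :: nat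
  proof (induction N)
    case (Suc N)
    then show ?case using step[of N] by (simp add: algebra_simps add_divide_distrib)
  qed (simp add: base)
  define D where "D = (\<lambda>e. LINT t|lborel. norm (f (Complex (a + e) t)))"
  \<comment> \<open>\<open>hker_deep_bound\<close> moves by 2, hence two starting lines: a + 1/2
    serves even N and a - 1/2 serves odd N.\<close>
  have Jb: "norm (J (a + e - 2 * real M)) \<le> D e * (y\<^sup>2) ^ M / fact M" if e: "e = 1 / 2 \<or> e = - 1 / 2" for e M
  proof -
    \<comment> \<open>Hitting a pole would make the odd number 2 e = 1 or -1 equal to an even
      integer.\<close>
    have ne: "a + e - 2 * real M \<noteq> a - real k" for k
    proof
      assume "a + e - 2 * real M = a - real k"
      then have "2 * e = real_of_int (4 * int M - 2 * int k)" by simp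
      moreover have "2 * e = of_int 1 \<or> 2 * e = of_int (-1)" using e by auto
      ultimately have "1 = 4 * int M - 2 * int k \<or> -1 = 4 * int M - 2 * int k" by linarith
      then show False by presburger
    qed
    have int: "integrable lborel (\<lambda>t. f (Complex (a + e - 2 * real M) t))"
      unfolding f_def using a e ne by (intro hker_line_integrable[OF a y]) auto
    have "integrable lborel (\<lambda>t. f (Complex (a + e) t))"
    proof -
      have "a + e \<noteq> a - real k" for k
      proof
        assume "a + e = a - real k"
        then have "2 * e = real_of_int (- 2 * int k)" by simp
        moreover have "2 * e = of_int 1 \<or> 2 * e = of_int (-1)" using e by auto
        ultimately have "1 = - 2 * int k \<or> -1 = - 2 * int k" by linarith
        then show False by presburger
      qed
      then show ?thesis unfolding f_def using a e by (intro hker_line_integrable[OF a y]) auto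
    qed
    then have int0: "integrable lborel (\<lambda>t. norm (f (Complex (a + e) t)))" by (rule integrable_norm)
    have "norm (f (Complex (a + e - 2 * real M) t)) \<le> norm (f (Complex (a + e) t)) * ((y\<^sup>2) ^ M / fact M)" for t
    proof -
      have "Complex (a + e - 2 * real M) t = Complex (a + e) t - 2 * of_nat M" by (simp add: complex_eq_iff)
      then have "norm (hker a (Complex (a + e - 2 * real M) t)) \<le> norm (hker a (Complex (a + e) t)) / fact M"
        using hker_deep_bound[of a e "Complex (a + e) t" M] a e by auto
      moreover have "y powr (2 * real M - a - e) = y powr (- a - e) * (y\<^sup>2) ^ M"
      proof -
        have "y powr (2 * real M - a - e) = y powr (real (2 * M) + (- a - e))" by (simp add: algebra_simps)
        also have "\<dots> = y powr (real (2 * M)) * y powr (- a - e)" by (rule powr_add)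
        also have "y powr (real (2 * M)) = (y\<^sup>2) ^ M"
          using y by (simp only: powr_realpow power_mult)
        finally show ?thesis by simp
      qed
      ultimately have "norm (hker a (Complex (a + e - 2 * real M) t)) * y powr (2 * real M - a - e)
          \<le> norm (hker a (Complex (a + e) t)) / fact M * (y powr (- a - e) * (y\<^sup>2) ^ M)"
        using y by (intro mult_mono) auto
      moreover have "norm (f (Complex (a + e - 2 * real M) t)) =
          norm (hker a (Complex (a + e - 2 * real M) t)) * y powr (2 * real M - a - e)"
        "norm (f (Complex (a + e) t)) = norm (hker a (Complex (a + e) t)) * y powr (- a - e)"
        using y by (simp_all add: f_def norm_mult norm_powr_real_powr diff_diff_eq)
      ultimately show ?thesis by (simp add: mult_ac)
    qed
    then have "norm (J (a + e - 2 * real M)) \<le> (LINT t|lborel. norm (f (Complex (a + e) t)) * ((y\<^sup>2) ^ M / fact M))"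
      unfolding J_def by (intro Bochner_Integration.integral_norm_bound_integral int integrable_mult_left int0)
    also have "\<dots> = D e * ((y\<^sup>2) ^ M / fact M)" unfolding D_def by (rule integral_mult_left_zero)
    finally show ?thesis by simp
  qed
  have J0: "(\<lambda>N. J (a + 1 / 2 - real N)) \<longlonglongrightarrow> 0"
  proof (rule Lim_null_comparison)
    have "(\<lambda>M. (y\<^sup>2) ^ M / fact M) \<longlonglongrightarrow> 0"
      using summable_LIMSEQ_zero[OF summable_exp[of "y\<^sup>2"]] by (simp add: field_simps)
    moreover have "filterlim (\<lambda>N. N div 2) sequentially (sequentially :: nat filter)"
    proof (subst filterlim_at_top, intro allI)
      fix Z :: nat
      show "\<forall>\<^sub>F N in sequentially. Z \<le> N div 2"
        using eventually_ge_at_top[of "2 * Z"] by eventually_elim simp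
    qed
    ultimately have "(\<lambda>N. (y\<^sup>2) ^ (N div 2) / fact (N div 2)) \<longlonglongrightarrow> 0"
      by (rule filterlim_compose)
    then show "(\<lambda>N. (D (1 / 2) + D (- 1 / 2)) * ((y\<^sup>2) ^ (N div 2) / fact (N div 2))) \<longlonglongrightarrow> 0"
      by (intro tendsto_mult_right_zero)
    have D0: "D e \<ge> 0" for e unfolding D_def by (intro Bochner_Integration.integral_nonneg) auto
    have nn: "0 \<le> D e * ((y\<^sup>2) ^ (N div 2) / fact (N div 2))" for e and N :: nat
      using D0 by simp
    have "norm (J (a + 1 / 2 - real N)) \<le> (D (1 / 2) + D (- 1 / 2)) * ((y\<^sup>2) ^ (N div 2) / fact (N div 2))" for N :: nat
    proof (cases "even N")
      case True
      then have "real N = 2 * real (N div 2)" by (metis even_two_times_div_two of_nat_mult of_nat_numeral)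
      then show ?thesis using Jb[of "1 / 2" "N div 2"] nn[of "- 1 / 2" N] by (simp add: algebra_simps add_divide_distrib)
    next
      case False
      then have "real N = 2 * real (N div 2) + 1" by (metis odd_two_times_div_two_succ of_nat_mult of_nat_numeral of_nat_1 of_nat_add)
      then show ?thesis using Jb[of "- 1 / 2" "N div 2"] nn[of "1 / 2" N] by (simp add: algebra_simps add_divide_distrib)
    qed
    then show "\<forall>\<^sub>F N in sequentially. norm (J (a + 1 / 2 - real N)) \<le> (D (1 / 2) + D (- 1 / 2)) * ((y\<^sup>2) ^ (N div 2) / fact (N div 2))"
      by simp
  qed
  have "(\<lambda>N. (J c - J (a + 1 / 2 - real N)) / (2 * pi)) \<longlonglongrightarrow> (J c - 0) / (2 * pi)"
    by (intro tendsto_intros J0) auto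
  moreover have "(\<lambda>N. (J c - J (a + 1 / 2 - real N)) / (2 * pi)) = (\<lambda>N. \<Sum>k<N. ?r k)"
    by (subst part[symmetric]) simp
  ultimately show ?thesis unfolding sums_def J_def f_def by simp
qed

lemma sums_even_odd:
  fixes g :: "nat \<Rightarrow> 'a :: real_normed_vector"
  assumes "(\<lambda>m. g (2 * m)) sums S" "(\<lambda>m. g (2 * m + 1)) sums S'"
  shows "g sums (S + S')"
proof -
  have "(\<lambda>n. if even n then g n else 0) sums S"
    by (rule sums_mono_reindex[THEN iffD1, of "\<lambda>m. 2 * m"])
      (use assms(1) in \<open>auto simp: strict_mono_def elim!: evenE\<close>)
  moreover have "(\<lambda>n. if odd n then g n else 0) sums S'"
    by (rule sums_mono_reindex[THEN iffD1, of "\<lambda>m. 2 * m + 1"])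
      (use assms(2) in \<open>auto simp: strict_mono_def elim!: oddE\<close>)
  ultimately have "(\<lambda>n. (if even n then g n else 0) + (if odd n then g n else 0)) sums (S + S')"
    by (rule sums_add)
  moreover have "(\<lambda>n. (if even n then g n else 0) + (if odd n then g n else 0)) = g" by auto
  ultimately show ?thesis by simp
qed

text \<open>For even k the value of \<open>rGamma\<close> at a nonpositive integer is 0. For odd k
  its values at negative half-integers turn the coefficients into those of exp(- y^2 / 4).\<close>

lemma hker_series_0:
  assumes y: "y > 0"
  shows "(\<lambda>k. (-1) ^ k / fact k * rGamma ((complex_of_real 0 - of_nat k) / 2) * complex_of_real y powr (of_nat k - of_real 0))
           sums of_real (y / (2 * sqrt pi) * exp (- y\<^sup>2 / 4))" (is "?r sums _")
proof -
  have ev: "?r (2 * m) = 0" for m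
    by (simp add: rGamma_eq_zero_iff)
  have pw: "complex_of_real y powr (of_nat k - of_real 0) = of_real y ^ k" for k
    using y by (simp add: powr_nat)
  have rG: "(-1) ^ (2 * m + 1) / fact (2 * m + 1) * rGamma ((complex_of_real 0 - of_nat (2 * m + 1)) / 2) =
      of_real (1 / (2 * sqrt pi)) * ((- 1 / 4) ^ m / fact m)" for m
  proof (induction m)
    case 0
    have "rGamma (-1 / 2 :: complex) = (-1 / 2) * rGamma (1 / 2)"
      using rGamma_plus1[of "-1/2 :: complex"] by simp
    then show ?case by (simp add: rGamma_inverse_Gamma Gamma_one_half_complex field_simps)
  next
    case (Suc m)
    define z :: complex where "z = (complex_of_real 0 - of_nat (2 * Suc m + 1)) / 2"
    have z1: "z + 1 = (complex_of_real 0 - of_nat (2 * m + 1)) / 2" by (simp add: z_def field_simps)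
    have rz: "rGamma z = z * rGamma ((complex_of_real 0 - of_nat (2 * m + 1)) / 2)"
      by (simp only: rGamma_plus1 flip: z1)
    have f: "fact (2 * Suc m + 1) = (of_nat (2 * m + 3) * of_nat (2 * m + 2) * fact (2 * m + 1) :: complex)"
      by (simp add: algebra_simps)
    have "(-1) ^ (2 * Suc m + 1) / fact (2 * Suc m + 1) * rGamma z =
       z / (of_nat (2 * m + 3) * of_nat (2 * m + 2)) *
         ((-1) ^ (2 * m + 1) / fact (2 * m + 1) * rGamma ((complex_of_real 0 - of_nat (2 * m + 1)) / 2))"
      unfolding rz f by simp
    also have "\<dots> = z / (of_nat (2 * m + 3) * of_nat (2 * m + 2)) * (of_real (1 / (2 * sqrt pi)) * ((- 1 / 4) ^ m / fact m))"
      unfolding Suc.IH ..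
    also have "z = - of_nat (2 * m + 3) / 2" by (simp add: z_def)
    also have "- of_nat (2 * m + 3) / 2 / (of_nat (2 * m + 3) * of_nat (2 * m + 2)) = (- 1 / 4 :: complex) / of_nat (Suc m)"
    proof -
      have "- p / 2 / (p * (2 * q)) = (- 1 / 4) / q" if "p \<noteq> 0" "q \<noteq> 0" for p q :: complex
        using that by (simp add: field_simps)
      moreover have "of_nat (2 * m + 2) = (2 * of_nat (Suc m) :: complex)" by simp
      moreover have "of_nat (2 * m + 3) \<noteq> (0 :: complex)" "of_nat (Suc m) \<noteq> (0 :: complex)"
        by (simp_all only: of_nat_eq_0_iff)
      ultimately show ?thesis by metis
    qed
    finally show ?case unfolding z_def by (simp add: field_simps)
  qed
  have "(\<lambda>m. ?r (2 * m + 1)) sums of_real (y / (2 * sqrt pi) * exp (- y\<^sup>2 / 4))"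
  proof -
    have "(\<lambda>m. complex_of_real (- y\<^sup>2 / 4) ^ m / fact m) sums exp (complex_of_real (- y\<^sup>2 / 4))"
      using exp_converges[of "complex_of_real (- y\<^sup>2 / 4)"] by (simp add: scaleR_conv_of_real field_simps)
    then have "(\<lambda>m. of_real (y / (2 * sqrt pi)) * (complex_of_real (- y\<^sup>2 / 4) ^ m / fact m)) sums
        (of_real (y / (2 * sqrt pi)) * exp (complex_of_real (- y\<^sup>2 / 4)))"
      by (rule sums_mult)
    also have "(\<lambda>m. of_real (y / (2 * sqrt pi)) * (complex_of_real (- y\<^sup>2 / 4) ^ m / fact m)) = (\<lambda>m. ?r (2 * m + 1))"
    proof
      fix m
      have "complex_of_real (- y\<^sup>2 / 4) ^ m = (-1/4) ^ m * of_real y ^ (2 * m)"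
        by (simp add: power_mult power_mult_distrib[symmetric] del: power_mult_distrib)
      then show "of_real (y / (2 * sqrt pi)) * (complex_of_real (- y\<^sup>2 / 4) ^ m / fact m) = ?r (2 * m + 1)"
        unfolding rG pw by (simp add: field_simps)
    qed
    finally show ?thesis by (simp only: exp_of_real of_real_mult)
  qed
  moreover have "(\<lambda>m. ?r (2 * m)) sums 0" unfolding ev by (rule sums_zero)
  ultimately show ?thesis using sums_even_odd[of ?r 0] by simp
qed

section \<open>The Bessel combination as a power series\<close>

text \<open>The series of \<open>I\<^bsub>\<nu>-1\<^esub>(2X)\<close> and \<open>I\<^bsub>\<nu>\<^esub>(2X)\<close> without the factor \<open>X\<^bsup>\<nu>-1\<^esup>\<close>. The coefficients of
  \<open>bessD\<close> satisfy a two-term recurrence, which identifies them with the residues of \<open>hker (1/2)\<close>.\<close>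
definition bessA :: "real \<Rightarrow> complex fps" where
  "bessA \<nu> = Abs_fps (\<lambda>n. if even n then rGamma (of_real \<nu> + of_nat (n div 2)) / fact (n div 2) else 0)"

definition bessC :: "real \<Rightarrow> complex fps" where
  "bessC \<nu> = Abs_fps (\<lambda>n. if odd n then rGamma (of_real \<nu> + of_nat (n div 2) + 1) / fact (n div 2) else 0)"

text \<open>Formal version of the derivative rule for z^(-\<mu>) I_\<mu>(z) with \<mu> = \<nu> - 1
  and z = 2 X.\<close>

lemma fps_deriv_bessA: "fps_deriv (bessA \<nu>) = 2 * bessC \<nu>"
proof (rule fps_ext)
  fix n
  show "fps_nth (fps_deriv (bessA \<nu>)) n = fps_nth (2 * bessC \<nu>) n"
  proof (cases "odd n")
    case True
    then obtain k where n: "n = 2 * k + 1" by (auto elim: oddE)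
    have "rGamma (of_real \<nu> + (1 + of_nat k)) * (2 + of_nat k * 2) / (fact k + fact k * of_nat k) =
          2 * rGamma (of_real \<nu> + of_nat k + 1) / (fact k :: complex)"
    proof -
      have "(fact k + fact k * of_nat k :: complex) = fact k * of_nat (Suc k)" by (simp add: algebra_simps)
      moreover have "(2 + of_nat k * 2 :: complex) = 2 * of_nat (Suc k)" by simp
      ultimately show ?thesis by (simp add: add_ac del: of_nat_Suc)
    qed
    then show ?thesis using n
      by (simp add: bessA_def bessC_def numeral_fps_const algebra_simps)
  qed (simp add: bessA_def bessC_def numeral_fps_const)
qed

text \<open>Formal version of the derivative rule for z^\<nu> I_\<nu>(z) with z = 2 X.\<close>

lemma fps_X_deriv_bessC:
  "fps_X * fps_deriv (bessC \<nu>) = 2 * fps_X * bessA \<nu> - fps_const (2 * of_real \<nu> - 1) * bessC \<nu>"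
proof (rule fps_ext)
  fix n
  show "fps_nth (fps_X * fps_deriv (bessC \<nu>)) n = fps_nth (2 * fps_X * bessA \<nu> - fps_const (2 * of_real \<nu> - 1) * bessC \<nu>) n"
  proof (cases n)
    case (Suc m)
    have r: "rGamma (of_real \<nu> + of_nat (m div 2) :: complex) = (of_real \<nu> + of_nat (m div 2)) * rGamma (of_real \<nu> + of_nat (m div 2) + 1)"
      by (simp only: rGamma_plus1)
    show ?thesis
    proof (cases "even m")
      case True
      then obtain k where m: "m = 2 * k" by (auto elim: evenE)
      show ?thesis using r unfolding Suc m mult.assoc
        by (simp add: bessA_def bessC_def numeral_fps_const field_simps)
    qed (use Suc in \<open>simp add: bessA_def bessC_def numeral_fps_const mult.assoc\<close>)
  qed (simp add: bessA_def bessC_def numeral_fps_const mult.assoc)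
qed

definition bessD :: "real \<Rightarrow> complex fps" where
  "bessD \<nu> = fps_exp (-2) * (bessA \<nu> - bessC \<nu>)"

lemma bessD_0: "fps_nth (bessD \<nu>) 0 = rGamma (of_real \<nu>)"
  by (simp add: bessD_def bessA_def bessC_def)

text \<open>Put E = exp(-2 X), d = E (A - C), s = E (A + C) and \<mu> = \<nu> - 1/2. The two Bessel
  relations become X d' = -4 X d + \<mu> (s - d) and X s' = - \<mu> (s - d). The second expresses
  each coefficient of s by that of d, and eliminating s leaves two terms.\<close>

lemma bessD_Suc:
  fixes \<nu> :: real and n :: nat
  assumes "\<nu> > 0" 
  defines "m \<equiv> complex_of_real (real (Suc n) + \<nu> - 1 / 2)"
  shows "of_nat (Suc n) * (m + of_real \<nu> - 1 / 2) * fps_nth (bessD \<nu>) (Suc n) = - 4 * m * fps_nth (bessD \<nu>) n"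
proof -
  define \<mu> :: complex where "\<mu> = of_real \<nu> - 1 / 2"
  define E where "E = fps_exp (-2 :: complex)"
  define d s where "d = bessD \<nu>" and "s = E * (bessA \<nu> + bessC \<nu>)"
  have E': "fps_deriv E = - 2 * E" by (simp add: E_def numeral_fps_const fps_const_neg[symmetric] del: fps_const_neg)
  have mu: "fps_const (2 * of_real \<nu> - 1) = 2 * fps_const \<mu>"
    by (simp add: \<mu>_def numeral_fps_const)
  have X: "fps_X * fps_deriv (bessC \<nu>) = 2 * fps_X * bessA \<nu> - 2 * fps_const \<mu> * bessC \<nu>"
    unfolding fps_X_deriv_bessC mu ..
  have d': "fps_X * fps_deriv d = - 4 * fps_X * d + fps_const \<mu> * (s - d)"
  proof -
    have "fps_X * fps_deriv d = fps_X * fps_deriv E * (bessA \<nu> - bessC \<nu>) +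
        E * (fps_X * fps_deriv (bessA \<nu>) - fps_X * fps_deriv (bessC \<nu>))"
      by (simp add: d_def bessD_def E_def algebra_simps)
    also have "\<dots> = - 4 * fps_X * d + fps_const \<mu> * (s - d)"
      unfolding X E' fps_deriv_bessA by (simp add: d_def s_def bessD_def E_def[symmetric] algebra_simps)
    finally show ?thesis .
  qed
  have s': "fps_X * fps_deriv s = - (fps_const \<mu> * (s - d))"
  proof -
    have "fps_X * fps_deriv s = fps_X * fps_deriv E * (bessA \<nu> + bessC \<nu>) +
        E * (fps_X * fps_deriv (bessA \<nu>) + fps_X * fps_deriv (bessC \<nu>))"
      by (simp add: s_def algebra_simps)
    also have "\<dots> = - (fps_const \<mu> * (s - d))"
      unfolding X E' fps_deriv_bessA by (simp add: d_def s_def bessD_def E_def[symmetric] algebra_simps)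
    finally show ?thesis .
  qed
  define D0 D1 S1 N where "D0 = fps_nth d n" and "D1 = fps_nth d (Suc n)" and "S1 = fps_nth s (Suc n)"
    and "N = (of_nat (Suc n) :: complex)"
  have 1: "N * D1 = - 4 * D0 + \<mu> * (S1 - D1)"
    using arg_cong[OF d', of "\<lambda>f. fps_nth f (Suc n)"]
    by (simp add: D0_def D1_def S1_def N_def mult.assoc numeral_fps_const)
  have 2: "N * S1 = - (\<mu> * (S1 - D1))"
    using arg_cong[OF s', of "\<lambda>f. fps_nth f (Suc n)"]
    by (simp add: D0_def D1_def S1_def N_def mult.assoc)
  have m: "m = N + \<mu>" by (simp add: m_def N_def \<mu>_def)
  have "(N + \<mu>) * (N * D1) = (N + \<mu>) * (- 4 * D0) + \<mu> * ((N + \<mu>) * S1 - (N + \<mu>) * D1)"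
    unfolding 1 by (simp add: algebra_simps)
  also have "(N + \<mu>) * S1 = \<mu> * D1" using 2 by (simp add: algebra_simps)
  finally have "N * (N + \<mu> + \<mu>) * D1 = - 4 * (N + \<mu>) * D0"
    by algebra
  then show ?thesis unfolding m D1_def D0_def d_def N_def \<mu>_def by (simp add: algebra_simps)
qed

lemma rGamma_shift_bounded:
  assumes "\<nu> > 0"
  obtains B where "\<And>k. norm (rGamma (complex_of_real \<nu> + of_nat k)) \<le> B"
proof -
  \<comment> \<open>From k = 1 on the norms do not increase, since |\<nu> + k| >= 1; only the step
    from 0 to 1 may increase them, so both initial values enter.\<close>
  define B where "B = norm (rGamma (complex_of_real \<nu>)) + norm (rGamma (complex_of_real \<nu> + 1))"
  have S: "norm (rGamma (complex_of_real \<nu> + of_nat (Suc k))) \<le> norm (rGamma (complex_of_real \<nu> + 1))" for k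
  proof (induction k)
    case (Suc k)
    define z where "z = complex_of_real \<nu> + of_nat (Suc k)"
    have "norm z \<ge> 1" using abs_Re_le_cmod[of z] assms by (simp add: z_def)
    then have "norm (rGamma (z + 1)) \<le> norm z * norm (rGamma (z + 1))"
      by (simp add: mult_le_cancel_right1)
    also have "\<dots> = norm (rGamma z)"
      by (simp add: rGamma_plus1 flip: norm_mult)
    finally show ?case using Suc.IH by (simp add: z_def add_ac)
  qed simp
  have "norm (rGamma (complex_of_real \<nu> + of_nat k)) \<le> B" for k
    using S[of "k - 1"] by (cases k) (auto simp: B_def add_increasing)
  then show thesis by (rule that)
qed

lemma summable_Bessel:
  assumes "\<nu> > 0"
  shows "summable (\<lambda>k. rGamma (complex_of_real \<nu> + of_nat k) / fact k * X ^ (2 * k))"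
proof -
  obtain B where B: "\<And>k. norm (rGamma (complex_of_real \<nu> + of_nat k)) \<le> B"
    using rGamma_shift_bounded[OF assms] by blast
  show ?thesis
  proof (rule summable_comparison_test')
    show "summable (\<lambda>k. B * (inverse (fact k) * (norm X ^ 2) ^ k))"
      by (intro summable_mult summable_exp)
    show "norm (rGamma (complex_of_real \<nu> + of_nat k) / fact k * X ^ (2 * k)) \<le> B * (inverse (fact k) * (norm X ^ 2) ^ k)" for k
    proof -
      have "norm (rGamma (complex_of_real \<nu> + of_nat k) / fact k * X ^ (2 * k)) =
          norm (rGamma (complex_of_real \<nu> + of_nat k)) * (inverse (fact k) * (norm X ^ 2) ^ k)"
        by (simp add: norm_mult norm_divide norm_power divide_inverse norm_inverse flip: power_mult)
      then show ?thesis using mult_right_mono[OF B[of k], of "inverse (fact k) * (norm X ^ 2) ^ k"] by simp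
    qed
  qed
qed

lemma Bessel_I_eq:
  assumes "X \<noteq> 0"
  shows "Bessel_I \<nu> (2 * X) = (\<Sum>k. X powr \<nu> * (rGamma (\<nu> + 1 + of_nat k) / fact k * X ^ (2 * k)))"
proof -
  have "X powr (\<nu> + 2 * of_nat k) = X powr \<nu> * X ^ (2 * k)" for k
    using assms powr_nat[of X "2 * k"] by (simp add: powr_add)
  then show ?thesis unfolding Bessel_I_def by (simp add: mult_ac add_ac)
qed

lemma bessD_sums:
  assumes \<nu>: "\<nu> > 0" and X: "X \<noteq> 0"
  shows "(\<lambda>n. X powr (of_real \<nu> - 1) * (fps_nth (bessD \<nu>) n * X ^ n)) sums
     (exp (- 2 * X) * (Bessel_I (of_real \<nu> - 1) (2 * X) - Bessel_I (of_real \<nu>) (2 * X)))"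
proof -
  have A: "(\<lambda>n. fps_nth (bessA \<nu>) n * Y ^ n) sums (\<Sum>k. rGamma (of_real \<nu> + of_nat k) / fact k * Y ^ (2 * k))" for Y
    using sums_even_odd[of "\<lambda>n. fps_nth (bessA \<nu>) n * Y ^ n" _ 0] summable_sums[OF summable_Bessel[OF \<nu>, of Y]]
    by (simp add: bessA_def)
  have C: "(\<lambda>n. fps_nth (bessC \<nu>) n * Y ^ n) sums (Y * (\<Sum>k. rGamma (of_real \<nu> + 1 + of_nat k) / fact k * Y ^ (2 * k)))" for Y
    using sums_even_odd[of "\<lambda>n. fps_nth (bessC \<nu>) n * Y ^ n" 0] 
      sums_mult[OF summable_sums[OF summable_Bessel[of "\<nu> + 1" Y]], of Y] \<nu>
    by (simp add: bessC_def mult_ac add_ac)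
  let ?D = "\<lambda>Y n. fps_nth (bessA \<nu> - bessC \<nu>) n * Y ^ n"
  have D: "?D Y sums ((\<Sum>k. rGamma (of_real \<nu> + of_nat k) / fact k * Y ^ (2 * k)) -
      Y * (\<Sum>k. rGamma (of_real \<nu> + 1 + of_nat k) / fact k * Y ^ (2 * k)))" for Y
    using sums_diff[OF A[of Y] C[of Y]] by (simp add: algebra_simps)
  \<comment> \<open>Convergence at the larger radius |X| + 1 gives the absolute convergence at X
    that the Cauchy product uses.\<close>
  have absD: "summable (\<lambda>n. norm (?D X n))"
    by (rule powser_insidea[OF sums_summable[OF D[of "of_real (norm X + 1)"]]]) simp
  have E: "(\<lambda>n. (- 2 * X) ^ n /\<^sub>R fact n) sums exp (- 2 * X)"
    by (rule exp_converges)
  have absE: "summable (\<lambda>n. norm ((- 2 * X) ^ n /\<^sub>R fact n))"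
    by (rule summable_norm_exp)
  have "(\<lambda>n. \<Sum>i\<le>n. ((- 2 * X) ^ i /\<^sub>R fact i) * ?D X (n - i)) sums
     ((\<Sum>n. (- 2 * X) ^ n /\<^sub>R fact n) * (\<Sum>n. ?D X n))"
    by (rule Cauchy_product_sums[OF absE absD])
  also have "(\<lambda>n. \<Sum>i\<le>n. ((- 2 * X) ^ i /\<^sub>R fact i) * ?D X (n - i)) = (\<lambda>n. fps_nth (bessD \<nu>) n * X ^ n)"
  proof
    fix n
    have "fps_nth (bessD \<nu>) n * X ^ n = (\<Sum>i=0..n. (-2) ^ i / fact i * fps_nth (bessA \<nu> - bessC \<nu>) (n - i) * X ^ n)"
      unfolding bessD_def fps_mult_nth sum_distrib_right by simp
    also have "\<dots> = (\<Sum>i\<le>n. ((- 2 * X) ^ i /\<^sub>R fact i) * ?D X (n - i))"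
      unfolding atLeast0AtMost
    proof (intro sum.cong refl)
      fix i assume "i \<in> {..n}"
      then have "X ^ n = X ^ i * X ^ (n - i)" by (simp flip: power_add)
      moreover have "(- 2 * X) ^ i = (-2) ^ i * X ^ i" by (rule power_mult_distrib)
      ultimately show "(-2) ^ i / fact i * fps_nth (bessA \<nu> - bessC \<nu>) (n - i) * X ^ n =
          ((- 2 * X) ^ i /\<^sub>R fact i) * ?D X (n - i)"
        by (simp only: scaleR_conv_of_real divide_inverse of_real_inverse of_real_fact mult_ac)
    qed
    finally show "(\<Sum>i\<le>n. ((- 2 * X) ^ i /\<^sub>R fact i) * ?D X (n - i)) = fps_nth (bessD \<nu>) n * X ^ n" ..
  qed
  finally have "(\<lambda>n. X powr (of_real \<nu> - 1) * (fps_nth (bessD \<nu>) n * X ^ n)) sums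
      (X powr (of_real \<nu> - 1) * (exp (- 2 * X) * (\<Sum>n. ?D X n)))"
    unfolding sums_unique[OF E, symmetric] by (rule sums_mult)
  also have "X powr (of_real \<nu> - 1) * (exp (- 2 * X) * (\<Sum>n. ?D X n)) =
      exp (- 2 * X) * (Bessel_I (of_real \<nu> - 1) (2 * X) - Bessel_I (of_real \<nu>) (2 * X))"
  proof -
    have p: "X powr of_real \<nu> = X powr (of_real \<nu> - 1) * X"
      using X by (simp add: powr_diff)
    have "Bessel_I (of_real \<nu> - 1) (2 * X) = X powr (of_real \<nu> - 1) * (\<Sum>k. rGamma (of_real \<nu> + of_nat k) / fact k * X ^ (2 * k))"
      unfolding Bessel_I_eq[OF X] using suminf_mult[OF summable_Bessel[OF \<nu>, of X], of "X powr (of_real \<nu> - 1)"] by simp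
    moreover have "Bessel_I (of_real \<nu>) (2 * X) = X powr of_real \<nu> * (\<Sum>k. rGamma (of_real \<nu> + 1 + of_nat k) / fact k * X ^ (2 * k))"
      unfolding Bessel_I_eq[OF X] using suminf_mult[OF summable_Bessel[of "\<nu> + 1" X], of "X powr of_real \<nu>"] \<nu> by simp
    ultimately show ?thesis
      unfolding sums_unique[OF D[of X], symmetric] p by (simp add: algebra_simps)
  qed
  finally show ?thesis .
qed

text \<open>The residues of \<open>hker (1 / 2)\<close> times y^(-w) at the points 1/2 - k, without
  their power of y.\<close>

definition hcoeff :: "nat \<Rightarrow> complex" where
  "hcoeff k = (-1) ^ k / fact k * rGamma ((complex_of_real (1 / 2) - of_nat k) / 2)"

text \<open>Raising k by 2 shifts the argument of \<open>rGamma\<close> by 1, so even and odd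
  indices obey separate recurrences. Up to powers of 16 these are the recurrences of
  \<open>bessD\<close> at 1/4 and at 3/4.\<close>

lemma hcoeff_Suc_Suc:
  "of_nat (k + 1) * of_nat (k + 2) * hcoeff (k + 2) = - (of_nat k / 2 + 3 / 4) * hcoeff k"
proof -
  define z :: complex where "z = (complex_of_real (1 / 2) - of_nat (k + 2)) / 2"
  have z1: "z + 1 = (complex_of_real (1 / 2) - of_nat k) / 2" by (simp add: z_def field_simps)
  have "rGamma z = z * rGamma ((complex_of_real (1 / 2) - of_nat k) / 2)"
    by (simp only: rGamma_plus1 flip: z1)
  moreover have "z = - (of_nat k / 2 + 3 / 4)" by (simp add: z_def field_simps)
  moreover have "of_nat (k + 1) * of_nat (k + 2) * (c / fact (k + 2)) = c / (fact k :: complex)" for c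
  proof -
    have "fact (k + 2) = (of_nat (k + 1) * of_nat (k + 2) * fact k :: complex)"
      by (simp add: algebra_simps)
    moreover have "of_nat (k + 1) * of_nat (k + 2) \<noteq> (0 :: complex)"
      by (simp only: mult_eq_0_iff of_nat_eq_0_iff) simp
    moreover have "P * (c / (P * f)) = c / f" if "P \<noteq> 0" for P f :: complex
      using that by simp
    ultimately show ?thesis by metis
  qed
  from this[of "(-1) ^ (k + 2) * rGamma z"]
  have "of_nat (k + 1) * of_nat (k + 2) * hcoeff (k + 2) = (-1) ^ k * rGamma z / fact k"
    unfolding hcoeff_def z_def[symmetric] by simp
  ultimately show ?thesis by (simp add: hcoeff_def mult_ac)
qed

lemma bessD_quarter: "fps_nth (bessD (1 / 4)) m = 16 ^ m * hcoeff (2 * m)"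
proof (induction m)
  case (Suc m)
  define N :: complex where "N = of_nat m"
  have 1: "(N + 1) * (N + 1 / 2) * fps_nth (bessD (1 / 4)) (Suc m) = - 4 * (N + 3 / 4) * fps_nth (bessD (1 / 4)) m"
    using bessD_Suc[of "1/4" m] by (simp add: N_def add_ac)
  have 2: "(2 * N + 1) * (2 * N + 2) * hcoeff (2 * Suc m) = - (N + 3 / 4) * hcoeff (2 * m)"
    using hcoeff_Suc_Suc[of "2 * m"] by (simp add: N_def add_ac)
  have nz: "(N + 1) * (N + 1 / 2) \<noteq> 0"
    by (auto simp: N_def complex_eq_iff)
  have "(N + 1) * (N + 1 / 2) * (16 ^ Suc m * hcoeff (2 * Suc m)) = 4 * 16 ^ m * ((2 * N + 1) * (2 * N + 2) * hcoeff (2 * Suc m))"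
    by (simp add: algebra_simps)
  also have "\<dots> = (N + 1) * (N + 1 / 2) * fps_nth (bessD (1 / 4)) (Suc m)"
    unfolding 1 2 Suc.IH by (simp add: algebra_simps)
  finally show ?case using nz by simp
qed (simp add: bessD_0 hcoeff_def)

lemma bessD_three_quarter: "fps_nth (bessD (3 / 4)) m = 4 * 16 ^ m * hcoeff (2 * m + 1)"
proof (induction m)
  case 0
  \<comment> \<open>The factor 4 of the statement is fixed here: \<open>hcoeff 1\<close> is
    -rGamma(-1/4), which equals rGamma(3/4) / 4.\<close>
  have "rGamma (- (1 / 4) :: complex) = - (1 / 4) * rGamma (3 / 4)"
    using rGamma_plus1[of "- (1 / 4) :: complex"] by simp
  then show ?case by (simp add: bessD_0 hcoeff_def)
next
  case (Suc m)
  define N :: complex where "N = of_nat m"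
  have 1: "(N + 1) * (N + 3 / 2) * fps_nth (bessD (3 / 4)) (Suc m) = - 4 * (N + 5 / 4) * fps_nth (bessD (3 / 4)) m"
    using bessD_Suc[of "3/4" m] by (simp add: N_def add_ac)
  have 2: "(2 * N + 2) * (2 * N + 3) * hcoeff (2 * Suc m + 1) = - (N + 5 / 4) * hcoeff (2 * m + 1)"
    using hcoeff_Suc_Suc[of "2 * m + 1"] by (simp add: N_def add_ac add_divide_distrib)
  have nz: "(N + 1) * (N + 3 / 2) \<noteq> 0"
    by (auto simp: N_def complex_eq_iff)
  have "(N + 1) * (N + 3 / 2) * (4 * 16 ^ Suc m * hcoeff (2 * Suc m + 1)) = 4 * 4 * 16 ^ m * ((2 * N + 2) * (2 * N + 3) * hcoeff (2 * Suc m + 1))"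
    by (simp add: algebra_simps)
  also have "\<dots> = (N + 1) * (N + 3 / 2) * fps_nth (bessD (3 / 4)) (Suc m)"
    unfolding 1 2 Suc.IH by (simp add: algebra_simps)
  finally show ?case using nz by simp
qed

text \<open>The even residues give I_(-3/4) - I_(1/4), the odd ones I_(-1/4) - I_(3/4), both with
  the same factor. Neither difference is a K function, but regrouped they form K_(1/4) + K_(3/4),
  because sin(pi/4) = sin(3 pi/4).\<close>

lemma hker_series_half:
  assumes y: "y > 0"
  defines "t \<equiv> complex_of_real (y\<^sup>2 / 8)"
  shows "(\<lambda>k. (-1) ^ k / fact k * rGamma ((complex_of_real (1 / 2) - of_nat k) / 2) * complex_of_real y powr (of_nat k - of_real (1 / 2)))
           sums (of_real (y / (4 * sqrt 2 * pi)) * (exp (- t) * (Bessel_K (1 / 4) t + Bessel_K (3 / 4) t)))"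
proof -
  define X where "X = complex_of_real (y\<^sup>2 / 16)"
  have X0: "X \<noteq> 0" and tX: "t = 2 * X" using y by (auto simp: X_def t_def)
  have Xp: "X powr of_real e = of_real (16 powr (-e) * y powr (2 * e))" for e
  proof -
    have "(y\<^sup>2 / 16) powr e = 16 powr (-e) * y powr (2 * e)"
    proof -
      have y2: "y\<^sup>2 = y powr 2" using y by simp
      show ?thesis
        unfolding y2 powr_divide unfolding powr_powr powr_minus unfolding divide_inverse by (rule mult.commute)
    qed
    then show ?thesis unfolding X_def by (subst powr_of_real) auto
  qed
  have Xm: "X ^ m = of_real (y ^ (2 * m)) / 16 ^ m" for m
    by (simp add: X_def power_divide power_mult)
  have yp: "complex_of_real y powr (of_nat k - of_real (1 / 2)) = of_real (y powr (real k - 1 / 2))" for k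
    using y by (simp add: powr_of_real[symmetric])
  have y2m: "y powr (real (2 * m) + e) = y ^ (2 * m) * y powr e" for m e
    using y by (simp only: powr_add powr_realpow)
  let ?r = "\<lambda>k. hcoeff k * complex_of_real y powr (of_nat k - of_real (1 / 2))"
  have s16: "16 powr (3 / 4) = (8 :: real)" "16 powr (1 / 4) = (2 :: real)"
  proof -
    have "(16 :: real) = 2 powr 4" by simp
    then have "(16 :: real) powr e = 2 powr (4 * e)" for e by (simp only: powr_powr)
    from this[of "3/4"] this[of "1/4"] show "16 powr (3 / 4) = (8 :: real)" "16 powr (1 / 4) = (2 :: real)" by simp_all
  qed
  have "(\<lambda>m. of_real (y / 8) * (X powr (of_real (1 / 4) - 1) * (fps_nth (bessD (1 / 4)) m * X ^ m))) sums
     (of_real (y / 8) * (exp (- t) * (Bessel_I (of_real (1 / 4) - 1) t - Bessel_I (of_real (1 / 4)) t)))"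
    using sums_mult[OF bessD_sums[of "1/4", OF _ X0], of "of_real (y / 8)"] by (simp add: tX)
  also have "(\<lambda>m. of_real (y / 8) * (X powr (of_real (1 / 4) - 1) * (fps_nth (bessD (1 / 4)) m * X ^ m))) = (\<lambda>m. ?r (2 * m))"
  proof
    fix m
    have "X powr (of_real (1 / 4) - 1) = of_real (8 * y powr (- 3 / 2))"
      using Xp[of "- 3 / 4"] s16 by simp
    moreover have "y powr (real (2 * m) - 1 / 2) = y ^ (2 * m) * (y * y powr (- 3 / 2))"
      using y2m[of m "- 1 / 2"] powr_add[of y 1 "- 3 / 2"] y by simp
    ultimately show "of_real (y / 8) * (X powr (of_real (1 / 4) - 1) * (fps_nth (bessD (1 / 4)) m * X ^ m)) = ?r (2 * m)"
      unfolding bessD_quarter Xm yp by simp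
  qed
  finally have s1: "(\<lambda>m. ?r (2 * m)) sums
     (of_real (y / 8) * (exp (- t) * (Bessel_I (of_real (1 / 4) - 1) t - Bessel_I (of_real (1 / 4)) t)))" .
  have "(\<lambda>m. of_real (y / 8) * (X powr (of_real (3 / 4) - 1) * (fps_nth (bessD (3 / 4)) m * X ^ m))) sums
     (of_real (y / 8) * (exp (- t) * (Bessel_I (of_real (3 / 4) - 1) t - Bessel_I (of_real (3 / 4)) t)))"
    using sums_mult[OF bessD_sums[of "3/4", OF _ X0], of "of_real (y / 8)"] by (simp add: tX)
  also have "(\<lambda>m. of_real (y / 8) * (X powr (of_real (3 / 4) - 1) * (fps_nth (bessD (3 / 4)) m * X ^ m))) = (\<lambda>m. ?r (2 * m + 1))"
  proof
    fix m
    have "X powr (of_real (3 / 4) - 1) = of_real (2 * y powr (- 1 / 2))"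
      using Xp[of "- 1 / 4"] s16 by simp
    moreover have "y powr (real (2 * m + 1) - 1 / 2) = y ^ (2 * m) * (y * y powr (- 1 / 2))"
      using y2m[of m "1 / 2"] powr_add[of y 1 "- 1 / 2"] y by (simp add: add_ac)
    ultimately show "of_real (y / 8) * (X powr (of_real (3 / 4) - 1) * (fps_nth (bessD (3 / 4)) m * X ^ m)) = ?r (2 * m + 1)"
      unfolding bessD_three_quarter Xm yp by simp
  qed
  finally have s2: "(\<lambda>m. ?r (2 * m + 1)) sums
     (of_real (y / 8) * (exp (- t) * (Bessel_I (of_real (3 / 4) - 1) t - Bessel_I (of_real (3 / 4)) t)))" .
  \<comment> \<open>Non-integral orders select the explicit branch of \<open>Bessel_K\<close> rather
    than the limit.\<close>
  have nI: "(1 / 4 :: complex) \<notin> \<int>" "(3 / 4 :: complex) \<notin> \<int>"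
  proof -
    have "(of_int p / 4 :: complex) \<notin> \<int>" if "odd p" for p
    proof
      assume "(of_int p / 4 :: complex) \<in> \<int>"
      then obtain n where "of_int p / 4 = (of_int n :: complex)" by (auto elim: Ints_cases)
      then have "(of_int p :: complex) = of_int (4 * n)" by (simp add: field_simps)
      then show False using that by (simp only: of_int_eq_iff) simp
    qed
    from this[of 1] this[of 3] show "(1 / 4 :: complex) \<notin> \<int>" "(3 / 4 :: complex) \<notin> \<int>"
      by simp_all
  qed
  have sin1: "sin (1 / 4 * complex_of_real pi) = of_real (sqrt 2 / 2)"
    using sin_of_real[of "pi / 4", where 'a = complex] by (simp add: sin_45)
  have sin3: "sin (3 / 4 * complex_of_real pi) = of_real (sqrt 2 / 2)"
  proof -
    have "sin (3 / 4 * pi) = sin (pi - pi / 4)" by (rule arg_cong) simp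
    also have "\<dots> = sqrt 2 / 2" by (simp only: sin_diff) (simp add: sin_45)
    finally have s3: "sin (3 / 4 * pi) = sqrt 2 / 2" .
    have "sin (3 / 4 * complex_of_real pi) = sin (complex_of_real (3 / 4 * pi))" by simp
    also have "\<dots> = of_real (sqrt 2 / 2)" by (simp only: sin_of_real s3)
    finally show ?thesis .
  qed
  have K: "Bessel_K (1 / 4) t + Bessel_K (3 / 4) t = of_real (pi / sqrt 2) *
     ((Bessel_I (of_real (1 / 4) - 1) t - Bessel_I (of_real (1 / 4)) t) + (Bessel_I (of_real (3 / 4) - 1) t - Bessel_I (of_real (3 / 4)) t))"
  proof -
    have 1: "Bessel_K (1 / 4) t = of_real (pi / sqrt 2) * (Bessel_I (- (1 / 4)) t - Bessel_I (1 / 4) t)"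
      using nI(1) sin1 by (simp add: Bessel_K_def Let_def field_simps flip: of_real_mult)
    have 3: "Bessel_K (3 / 4) t = of_real (pi / sqrt 2) * (Bessel_I (- (3 / 4)) t - Bessel_I (3 / 4) t)"
      using nI(2) sin3 by (simp add: Bessel_K_def Let_def field_simps flip: of_real_mult)
    show ?thesis unfolding 1 3 by (simp add: algebra_simps)
  qed
  have "of_real (y / 8) * (exp (- t) * (Bessel_I (of_real (1 / 4) - 1) t - Bessel_I (of_real (1 / 4)) t)) +
     of_real (y / 8) * (exp (- t) * (Bessel_I (of_real (3 / 4) - 1) t - Bessel_I (of_real (3 / 4)) t)) =
     of_real (y / (4 * sqrt 2 * pi)) * (exp (- t) * (Bessel_K (1 / 4) t + Bessel_K (3 / 4) t))"
  proof -
    have "y / (4 * sqrt 2 * pi) * (pi / sqrt 2) = y / 8" by (simp add: field_simps)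
    then have c: "complex_of_real (y / (4 * sqrt 2 * pi)) * of_real (pi / sqrt 2) = of_real (y / 8)"
      by (metis of_real_mult)
    show ?thesis unfolding K c[symmetric] by (simp only: algebra_simps)
  qed
  then show ?thesis using sums_even_odd[of ?r, OF s1 s2] unfolding hcoeff_def by simp
qed

section \<open>Continuation of zeta beyond the line Re s = 0\<close>

text \<open>Up to the factor \<open>s (s + 1)\<close>, the error of the trapezoidal rule for \<open>u\<^bsup>-s\<^esup>\<close> on \<open>[n, n + 1]\<close>. It is summable for
  \<open>Re s > -1\<close>, one unit further to the left than the error of the rectangle rule.\<close>
definition trap :: "nat \<Rightarrow> complex \<Rightarrow> complex" where
  "trap n s = integral {0..1} (\<lambda>u. of_real (u * (1 - u) / 2) * of_real (real n + u) powr (- s - 2))"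

lemma trap_integrand_continuous:
  assumes "n \<ge> 1"
  shows "continuous_on {0..1} (\<lambda>u. complex_of_real (u * (1 - u) / 2) * of_real (real n + u) powr (- s - 2))"
  using assms by (intro continuous_intros) (auto simp: complex_nonpos_Reals_iff complex_eq_iff)

lemma trap_holomorphic:
  assumes n: "n \<ge> 1"
  shows "trap n holomorphic_on A"
proof -
  have "(\<lambda>s. integral (cbox 0 1) (\<lambda>u::real. complex_of_real (u * (1 - u) / 2) * of_real (real n + u) powr (- s - 2))) holomorphic_on UNIV"
  proof (rule leibniz_rule_holomorphic[where fx = "\<lambda>s u. complex_of_real (u * (1 - u) / 2) * (of_real (real n + u) powr (- s - 2) * (- Ln (of_real (real n + u))))"])
    fix s :: complex and u :: real assume u: "u \<in> cbox 0 1"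
    have "complex_of_real (real n + u) \<noteq> 0" using n u by (simp add: of_real_eq_0_iff del: of_real_add)
    then show "((\<lambda>s. complex_of_real (u * (1 - u) / 2) * of_real (real n + u) powr (- s - 2)) has_field_derivative
        complex_of_real (u * (1 - u) / 2) * (of_real (real n + u) powr (- s - 2) * (- Ln (of_real (real n + u))))) (at s within UNIV)"
      by (auto intro!: derivative_eq_intros simp: powr_def)
  next
    fix s :: complex
    show "(\<lambda>u::real. complex_of_real (u * (1 - u) / 2) * of_real (real n + u) powr (- s - 2)) integrable_on cbox 0 1"
      using integrable_continuous_real[OF trap_integrand_continuous[OF n]] by simp
  next
    show "continuous_on (UNIV \<times> cbox (0::real) 1) (\<lambda>(s, u). complex_of_real (u * (1 - u) / 2) * (of_real (real n + u) powr (- s - 2) * (- Ln (of_real (real n + u)))))"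
      using n by (auto simp: case_prod_beta complex_nonpos_Reals_iff complex_eq_iff intro!: continuous_intros)
  qed auto
  then show ?thesis by (auto simp: trap_def[abs_def] intro: holomorphic_on_subset)
qed

text \<open>1/8 is the maximum of u (1 - u) / 2. The constant matters only for
  \<open>zeta_half_nonzero\<close>; elsewhere the weaker \<open>norm_trap_le\<close> is
  used.\<close>

lemma norm_trap_le_eighth:
  assumes n: "n \<ge> 1" and s: "\<sigma> \<le> Re s" "\<sigma> \<ge> - 2"
  shows "norm (trap n s) \<le> 1 / 8 * real n powr (- \<sigma> - 2)"
proof -
  have "norm (trap n s) \<le> 1 / 8 * real n powr (- \<sigma> - 2) * measure lborel (cbox 0 (1::real))"
    unfolding trap_def
  proof (rule has_integral_bound[rotated])
    show "((\<lambda>u. complex_of_real (u * (1 - u) / 2) * of_real (real n + u) powr (- s - 2)) has_integral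
         integral {0..1} (\<lambda>u. complex_of_real (u * (1 - u) / 2) * of_real (real n + u) powr (- s - 2))) (cbox 0 1)"
      using integrable_integral[OF integrable_continuous_real[OF trap_integrand_continuous[OF n]]] by simp
    fix u :: real assume u: "u \<in> cbox 0 1"
    have "norm (complex_of_real (u * (1 - u) / 2) * of_real (real n + u) powr (- s - 2)) =
        (u * (1 - u) / 2) * (real n + u) powr (- Re s - 2)"
      using u n by (simp add: norm_mult norm_powr_real_powr del: of_real_add of_real_mult of_real_diff of_real_divide)
    also have "\<dots> \<le> 1 / 8 * real n powr (- \<sigma> - 2)"
    proof (intro mult_mono)
      have "0 \<le> (u - 1 / 2)\<^sup>2" by simp
      then show "u * (1 - u) / 2 \<le> 1 / 8" by (simp add: power2_eq_square algebra_simps)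
      have "(real n + u) powr (- Re s - 2) \<le> (real n + u) powr (- \<sigma> - 2)"
        using u n s by (intro powr_mono) auto
      also have "\<dots> \<le> real n powr (- \<sigma> - 2)"
        using u n s by (intro powr_mono2') auto
      finally show "(real n + u) powr (- Re s - 2) \<le> real n powr (- \<sigma> - 2)" .
    qed (use u in auto)
    finally show "norm (complex_of_real (u * (1 - u) / 2) * of_real (real n + u) powr (- s - 2)) \<le> 1 / 8 * real n powr (- \<sigma> - 2)" .
  qed auto
  then show ?thesis by simp
qed

lemma norm_trap_le:
  assumes "n \<ge> 1" "\<sigma> \<le> Re s" "\<sigma> \<ge> - 2"
  shows "norm (trap n s) \<le> real n powr (- \<sigma> - 2)"
  using norm_trap_le_eighth[OF assms] by (rule order_trans) simp

lemma summable_powr_Suc: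
  assumes "a < - 1"
  shows "summable (\<lambda>n. real (Suc n) powr a)"
  using assms by (subst summable_Suc_iff) (simp add: summable_real_powr_iff)

definition trap_sum :: "complex \<Rightarrow> complex" where
  "trap_sum s = (\<Sum>n. trap (Suc n) s)"

lemma summable_trap: "Re s > - 1 \<Longrightarrow> summable (\<lambda>n. trap (Suc n) s)"
  by (rule summable_comparison_test'[OF summable_powr_Suc[of "- Re s - 2"]])
     (auto intro!: norm_trap_le simp del: of_nat_Suc)

lemma trap_sum_bound:
  assumes "\<sigma> > - 1"
  obtains C where "C \<ge> 0" "\<And>s. \<sigma> \<le> Re s \<Longrightarrow> norm (trap_sum s) \<le> C"
proof (rule that)
  show "(\<Sum>n. real (Suc n) powr (- \<sigma> - 2)) \<ge> 0"
    using assms by (intro suminf_nonneg summable_powr_Suc) auto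
  fix s assume s: "\<sigma> \<le> Re s"
  show "norm (trap_sum s) \<le> (\<Sum>n. real (Suc n) powr (- \<sigma> - 2))"
    unfolding trap_sum_def using assms s
    by (intro norm_suminf_le summable_powr_Suc norm_trap_le) auto
qed

lemma trap_sum_holomorphic: "trap_sum holomorphic_on {s. Re s > - 1}"
proof (rule holomorphic_uniform_sequence[where f = "\<lambda>N s. \<Sum>n<N. trap (Suc n) s"])
  show "open {s. Re s > - 1}" by (rule open_halfspace_Re_gt)
  show "(\<lambda>s. \<Sum>n<N. trap (Suc n) s) holomorphic_on {s. Re s > - 1}" for N
    by (intro holomorphic_on_sum trap_holomorphic) auto
  fix x assume x: "x \<in> {s. Re s > - 1}"
  \<comment> \<open>Half the distance to the line Re = -1: on the closed disc of this radius one
    summable majorant serves all points.\<close>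
  define d where "d = (Re x + 1) / 2"
  have d: "d > 0" using x by (simp add: d_def)
  have re: "d - 1 \<le> Re s" if "s \<in> cball x d" for s
    using that abs_Re_le_cmod[of "x - s"] by (simp add: dist_norm d_def field_simps)
  have "uniform_limit (cball x d) (\<lambda>N s. \<Sum>n<N. trap (Suc n) s) trap_sum sequentially"
    unfolding trap_sum_def[abs_def]
  proof (rule Weierstrass_m_test)
    show "summable (\<lambda>n. real (Suc n) powr (- (d - 1) - 2))"
      using d by (intro summable_powr_Suc) auto
    show "norm (trap (Suc n) s) \<le> real (Suc n) powr (- (d - 1) - 2)" if "s \<in> cball x d" for n s
      using re[OF that] d by (intro norm_trap_le) auto
  qed
  moreover have "cball x d \<subseteq> {s. Re s > - 1}" using re d by force
  ultimately show "\<exists>d>0. cball x d \<subseteq> {s. Re s > - 1} \<and>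
      uniform_limit (cball x d) (\<lambda>N s. \<Sum>n<N. trap (Suc n) s) trap_sum sequentially"
    using d by blast
qed

text \<open>Two integrations by parts, packed into the antiderivative \<open>G\<close>. The first
  boundary terms vanish with u (1 - u), the second ones form the trapezoidal mean.\<close>

lemma trap_eq:
  assumes n: "n \<ge> 1" and s: "s \<noteq> 1"
  shows "s * (s + 1) * trap n s = (of_nat n powr (- s) + of_nat (Suc n) powr (- s)) / 2
            - (of_nat (Suc n) powr (1 - s) - of_nat n powr (1 - s)) / (1 - s)"
proof -
  define G where "G = (\<lambda>u::real. complex_of_real (u * (1 - u) / 2) * (- s * of_real (real n + u) powr (- s - 1))
      - of_real ((1 - 2 * u) / 2) * of_real (real n + u) powr (- s) - of_real (real n + u) powr (1 - s) / (1 - s))"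
  have "((\<lambda>u. s * (s + 1) * (complex_of_real (u * (1 - u) / 2) * of_real (real n + u) powr (- s - 2))) has_integral G 1 - G 0) {0..1}"
  proof (rule fundamental_theorem_of_calculus)
    fix u :: real assume u: "u \<in> {0..1}"
    have nz: "complex_of_real (real n + u) \<noteq> 0" "complex_of_real (real n + u) \<notin> \<real>\<^sub>\<le>\<^sub>0"
      using n u by (auto simp: of_real_eq_0_iff complex_nonpos_Reals_iff simp del: of_real_add)
    define z where "z = complex_of_real (real n + u)"
    have D: "((\<lambda>u. complex_of_real (real n + u) powr a) has_vector_derivative a * z powr (a - 1)) (at u within {0..1})" for a
    proof -
      have "((\<lambda>w. w powr a) has_field_derivative a * z powr (a - 1)) (at z)"
        using nz by (intro has_field_derivative_powr) (simp add: z_def)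
      moreover have "((\<lambda>u. complex_of_real (real n + u)) has_vector_derivative 1) (at u within {0..1})"
        by (auto intro!: derivative_eq_intros has_vector_derivative_real_field simp: has_real_derivative_iff_has_vector_derivative[symmetric])
      ultimately show ?thesis
        using field_vector_diff_chain_within[of "\<lambda>u. complex_of_real (real n + u)" 1 u "{0..1}" "\<lambda>w. w powr a" "a * z powr (a - 1)"]
        by (simp add: o_def z_def has_field_derivative_at_within)
    qed
    have K: "((\<lambda>u. complex_of_real (u * (1 - u) / 2)) has_vector_derivative of_real ((1 - 2 * u) / 2)) (at u within {0..1})"
      by (intro has_vector_derivative_of_real) (auto intro!: derivative_eq_intros simp: field_simps)
    have K': "((\<lambda>u. complex_of_real ((1 - 2 * u) / 2)) has_vector_derivative of_real (- 1)) (at u within {0..1})"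
      by (intro has_vector_derivative_of_real) (auto intro!: derivative_eq_intros)
    have A: "(G has_vector_derivative
        (complex_of_real (u * (1 - u) / 2) * (- s * ((- s - 1) * z powr (- s - 1 - 1))) + of_real ((1 - 2 * u) / 2) * (- s * z powr (- s - 1)))
        - (of_real ((1 - 2 * u) / 2) * (- s * z powr (- s - 1)) + of_real (- 1) * z powr (- s))
        - (1 - s) * z powr (1 - s - 1) / (1 - s)) (at u within {0..1})"
      unfolding G_def z_def
      by (intro has_vector_derivative_diff has_vector_derivative_mult has_vector_derivative_divide
            has_vector_derivative_mult_right K K' D[unfolded z_def])
    have B: "(complex_of_real (u * (1 - u) / 2) * (- s * ((- s - 1) * z powr (- s - 1 - 1))) + of_real ((1 - 2 * u) / 2) * (- s * z powr (- s - 1)))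
        - (of_real ((1 - 2 * u) / 2) * (- s * z powr (- s - 1)) + of_real (- 1) * z powr (- s))
        - (1 - s) * z powr (1 - s - 1) / (1 - s) = s * (s + 1) * (complex_of_real (u * (1 - u) / 2) * of_real (real n + u) powr (- s - 2))"
    proof -
      have "- s - 1 - 1 = - s - 2" "1 - s - 1 = - s" by simp_all
      moreover have "(K * (- s * ((- s - 1) * p)) + L * (- s * q)) - (L * (- s * q) + of_real (- 1) * r) - (1 - s) * r / (1 - s) = s * (s + 1) * (K * p)"
        for K L p q r :: complex
      proof -
        have "(1 - s) * r / (1 - s) = r" using s by simp
        then show ?thesis by (simp only:) (simp add: algebra_simps)
      qed
      ultimately show ?thesis by (simp only: z_def)
    qed
    show "(G has_vector_derivative s * (s + 1) * (complex_of_real (u * (1 - u) / 2) * of_real (real n + u) powr (- s - 2))) (at u within {0..1})"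
      using A unfolding B .
  qed simp
  then have "s * (s + 1) * trap n s = G 1 - G 0"
    unfolding trap_def Henstock_Kurzweil_Integration.integral_mult_right[symmetric] by (rule integral_unique)
  also have "\<dots> = (of_nat n powr (- s) + of_nat (Suc n) powr (- s)) / 2
            - (of_nat (Suc n) powr (1 - s) - of_nat n powr (1 - s)) / (1 - s)"
    by (simp add: G_def diff_divide_distrib add_divide_distrib add_ac)
  finally show ?thesis .
qed

text \<open>The product \<open>(s - 1) \<zeta>(s)\<close>, on \<open>Re s > -1\<close> only.\<close>
definition zeta1 :: "complex \<Rightarrow> complex" where
  "zeta1 s = 1 + (s - 1) * (1 / 2 + s * (s + 1) * trap_sum s)"

lemma zeta1_holomorphic [holomorphic_intros]:
  "f holomorphic_on A \<Longrightarrow> (\<And>s. s \<in> A \<Longrightarrow> Re (f s) > - 1) \<Longrightarrow> (\<lambda>s. zeta1 (f s)) holomorphic_on A"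
  unfolding zeta1_def
  by (intro holomorphic_intros holomorphic_on_compose_gen[OF _ trap_sum_holomorphic, unfolded o_def]) auto

lemma zeta1_1 [simp]: "zeta1 1 = 1"
  by (simp add: zeta1_def)

text \<open>\<open>trap_sum\<close> is bounded to the right of any line inside its domain; the cube
  stems from the factor (s - 1) s (s + 1) in front of it.\<close>

lemma zeta1_growth:
  assumes "\<sigma> > - 1"
  obtains C where "C > 0" "\<And>s. \<sigma> \<le> Re s \<Longrightarrow> norm (zeta1 s) \<le> C * (1 + norm s) ^ 3"
proof -
  obtain C where C: "C \<ge> 0" "\<And>s. \<sigma> \<le> Re s \<Longrightarrow> norm (trap_sum s) \<le> C"
    using trap_sum_bound[OF assms] by blast
  show thesis
  proof (rule that[of "2 + C"])
    fix s assume s: "\<sigma> \<le> Re s"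
    define r where "r = 1 + norm s"
    have r: "1 \<le> r" "norm s \<le> r" "norm (s + 1) \<le> r" "norm (s - 1) \<le> r"
      using norm_triangle_ineq[of s 1] norm_triangle_ineq4[of s 1] by (auto simp: r_def add.commute)
    have "norm (s * (s + 1) * trap_sum s) \<le> r * r * C"
      unfolding norm_mult using r C(2)[OF s] by (intro mult_mono) auto
    then have "norm (1 / 2 + s * (s + 1) * trap_sum s) \<le> 1 / 2 + r * r * C"
      by (intro norm_triangle_le add_mono) auto
    then have "norm ((s - 1) * (1 / 2 + s * (s + 1) * trap_sum s)) \<le> r * (1 / 2 + r * r * C)"
      unfolding norm_mult using r by (intro mult_mono) auto
    then have "norm (zeta1 s) \<le> 1 + r * (1 / 2 + r * r * C)"
      unfolding zeta1_def by (intro norm_triangle_le add_mono) auto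
    also have "\<dots> \<le> r ^ 3 + r ^ 3 + C * r ^ 3"
    proof -
      have "1 \<le> r ^ 3" "r \<le> r ^ 3" using r(1) by (auto simp: self_le_power)
      then show ?thesis by (simp add: algebra_simps power3_eq_cube)
    qed
    finally show "norm (zeta1 s) \<le> (2 + C) * (1 + norm s) ^ 3" by (simp add: r_def algebra_simps)
  qed (use C in auto)
qed

text \<open>Summing \<open>trap_eq\<close> over n, the means add up to the partial sum of the
  Dirichlet series with halved end terms, and the power differences telescope. For Re s > 1 the
  terms at the upper end tend to 0.\<close>

lemma zeta1_Dirichlet:
  assumes s: "Re s > 1"
  shows "(\<lambda>n. of_nat (Suc n) powr (- s)) sums (zeta1 s / (s - 1))"
proof -
  have s1: "s \<noteq> 1" "1 - s \<noteq> 0" using s by auto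
  have part: "(\<Sum>n<N. of_nat (Suc n) powr (- s)) = s * (s + 1) * (\<Sum>n<N. trap (Suc n) s) + 1 / 2
      - of_nat (Suc N) powr (- s) / 2 + (of_nat (Suc N) powr (1 - s) - 1) / (1 - s)" for N
  proof (induction N)
    case (Suc N)
    have "s * (s + 1) * (\<Sum>n<Suc N. trap (Suc n) s) = s * (s + 1) * (\<Sum>n<N. trap (Suc n) s) + s * (s + 1) * trap (Suc N) s"
      by (simp add: algebra_simps)
    then show ?case using Suc.IH trap_eq[of "Suc N" s] s1
      by (simp add: diff_divide_distrib add_divide_distrib del: of_nat_Suc)
  qed simp
  have lim0: "(\<lambda>N. of_nat (Suc N) powr a) \<longlonglongrightarrow> (0::complex)" if "Re a < 0" for a
  proof (rule tendsto_norm_zero_cancel)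
    have "norm (of_nat (Suc N) powr a) = real (Suc N) powr Re a" for N
      using norm_powr_real_powr[of "of_nat (Suc N)" a] by (simp del: of_nat_Suc)
    moreover have "(\<lambda>N. real (Suc N) powr Re a) \<longlonglongrightarrow> 0"
      using that by (intro tendsto_neg_powr filterlim_compose[OF filterlim_real_sequentially filterlim_Suc])
    ultimately show "(\<lambda>N. norm (of_nat (Suc N) powr a :: complex)) \<longlonglongrightarrow> 0" by simp
  qed
  have "(\<lambda>N. \<Sum>n<N. trap (Suc n) s) \<longlonglongrightarrow> trap_sum s"
    unfolding trap_sum_def using summable_LIMSEQ[OF summable_trap[of s]] s by simp
  then have "(\<lambda>N. s * (s + 1) * (\<Sum>n<N. trap (Suc n) s) + 1 / 2
      - of_nat (Suc N) powr (- s) / 2 + (of_nat (Suc N) powr (1 - s) - 1) / (1 - s)) \<longlonglongrightarrow>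
      s * (s + 1) * trap_sum s + 1 / 2 - 0 / 2 + (0 - 1) / (1 - s)"
    using s s1 by (intro tendsto_intros lim0) auto
  then have "(\<lambda>n. of_nat (Suc n) powr (- s)) sums (s * (s + 1) * trap_sum s + 1 / 2 - 0 / 2 + (0 - 1) / (1 - s))"
    unfolding sums_def part .
  also have "s * (s + 1) * trap_sum s + 1 / 2 - 0 / 2 + (0 - 1) / (1 - s) = zeta1 s / (s - 1)"
    using s1 by (simp add: zeta1_def add_divide_distrib) (simp add: field_simps)
  finally show ?thesis .
qed

section \<open>The functional equation\<close>

text \<open>Differentiating rGamma(z) rGamma(1 - z) = sin(pi z) / pi identifies a difference of
  \<open>Digamma\<close> values with pi cot(pi w), and the series of \<open>Digamma\<close> gives
  the partial fractions. At w = i x / (2 pi) the cotangent turns hyperbolic; the limit is coth(x/2)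
  / 2 - 1/x.\<close>

lemma coth_partial_fractions:
  fixes x :: real
  assumes x: "x > 0"
  shows "(\<lambda>m. 2 * x / ((2 * pi * real (Suc m))\<^sup>2 + x\<^sup>2)) sums ((1 + exp (- x)) / (2 * (1 - exp (- x))) - 1 / x)"
proof -
  define y where "y = x / (2 * pi)"
  define w where "w = \<i> * complex_of_real y"
  have y: "y > 0" using x by (simp add: y_def)
  have xy: "x = 2 * pi * y" by (simp add: y_def)
  have nI: "w \<notin> \<int>\<^sub>\<le>\<^sub>0" "1 - w \<notin> \<int>\<^sub>\<le>\<^sub>0" "w \<noteq> 0" "1 + w \<noteq> 0" "1 - w \<noteq> 0"
    using y by (auto simp: w_def complex_eq_iff elim!: nonpos_Ints_cases)
  have "((\<lambda>z. rGamma z * rGamma (1 - z)) has_field_derivative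
      (- rGamma w * Digamma w) * rGamma (1 - w) + rGamma w * ((- rGamma (1 - w) * Digamma (1 - w)) * (0 - 1))) (at w)"
    by (rule derivative_eq_intros DERIV_chain2[OF has_field_derivative_rGamma_no_nonpos_int]
          has_field_derivative_rGamma_no_nonpos_int nI refl)+ simp
  moreover have "((\<lambda>z. rGamma z * rGamma (1 - z)) has_field_derivative cos (of_real pi * w)) (at w)"
    unfolding rGamma_reflection_complex by (auto intro!: derivative_eq_intros)
  ultimately have "(- rGamma w * Digamma w) * rGamma (1 - w) + rGamma w * ((- rGamma (1 - w) * Digamma (1 - w)) * (0 - 1)) = cos (of_real pi * w)"
    by (rule DERIV_unique)
  then have "(rGamma w * rGamma (1 - w)) * (Digamma (1 - w) - Digamma w) = cos (of_real pi * w)"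
    by (simp add: algebra_simps)
  then have cot: "sin (of_real pi * w) * (Digamma (1 - w) - Digamma w) = of_real pi * cos (of_real pi * w)"
    unfolding rGamma_reflection_complex by (simp add: field_simps)
  have Dp: "Digamma w = Digamma (1 + w) - 1 / w"
    using Digamma_plus1[OF nI(3)] by (simp add: add.commute)
  have DG: "(\<lambda>k. inverse (of_nat (Suc k)) - inverse (z + of_nat k)) sums (Digamma z + euler_mascheroni)" if "z \<noteq> 0" for z :: complex
    using summable_sums[OF summable_Digamma[OF that]] by (simp add: Digamma_def)
  have "(\<lambda>k. (inverse (of_nat (Suc k)) - inverse ((1 - w) + of_nat k)) - (inverse (of_nat (Suc k)) - inverse ((1 + w) + of_nat k)))
      sums ((Digamma (1 - w) + euler_mascheroni) - (Digamma (1 + w) + euler_mascheroni))"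
    by (intro sums_diff DG nI)
  also have "(\<lambda>k. (inverse (of_nat (Suc k)) - inverse ((1 - w) + of_nat k)) - (inverse (of_nat (Suc k)) - inverse ((1 + w) + of_nat k))) =
     (\<lambda>k. - \<i> * of_real (2 * y / ((real (Suc k))\<^sup>2 + y\<^sup>2)))"
  proof
    fix k
    define N where "N = real (Suc k)"
    have N: "N > 0" by (simp add: N_def)
    have nz: "complex_of_real N + w \<noteq> 0" "complex_of_real N - w \<noteq> 0"
      using N by (auto simp: w_def complex_eq_iff)
    have e: "(1 - w) + of_nat k = of_real N - w" "(1 + w) + of_nat k = of_real N + w" by (simp_all add: N_def)
    have p: "(of_real N + w) * (of_real N - w) = of_real (N\<^sup>2 + y\<^sup>2)"
      by (simp add: w_def algebra_simps power2_eq_square)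
    have "inverse (of_real N + w) - inverse (of_real N - w) = - 2 * w / ((of_real N + w) * (of_real N - w))"
      using nz by (simp add: divide_simps)
    also have "\<dots> = - \<i> * of_real (2 * y / (N\<^sup>2 + y\<^sup>2))" unfolding p by (simp add: w_def)
    finally show "(inverse (of_nat (Suc k)) - inverse ((1 - w) + of_nat k)) - (inverse (of_nat (Suc k)) - inverse ((1 + w) + of_nat k)) =
        - \<i> * of_real (2 * y / ((real (Suc k))\<^sup>2 + y\<^sup>2))"
      unfolding e N_def[symmetric] by simp
  qed
  finally have "(\<lambda>k. \<i> * (- \<i> * of_real (2 * y / ((real (Suc k))\<^sup>2 + y\<^sup>2)))) sums (\<i> * (Digamma (1 - w) - Digamma (1 + w)))"
    by (intro sums_mult) simp
  then have "(\<lambda>k. complex_of_real (2 * y / ((real (Suc k))\<^sup>2 + y\<^sup>2))) sums (\<i> * (Digamma (1 - w) - Digamma (1 + w)))"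
    by (simp only: mult.assoc[symmetric]) simp
  moreover have "\<i> * (Digamma (1 - w) - Digamma (1 + w)) = of_real (pi * (cosh (pi * y) / sinh (pi * y)) - 1 / y)"
  proof -
    have ex: "exp (- complex_of_real (pi * y)) = of_real (exp (- (pi * y)))"
         "exp (complex_of_real (pi * y)) = of_real (exp (pi * y))"
      by (simp_all only: exp_of_real flip: of_real_minus)
    have s: "sin (of_real pi * w) = \<i> * of_real (sinh (pi * y))"
      using ex by (simp add: sin_exp_eq w_def sinh_def mult_ac field_simps)
    have c: "cos (of_real pi * w) = of_real (cosh (pi * y))"
      using ex by (simp add: cos_exp_eq w_def cosh_def mult_ac field_simps)
    have sh: "sinh (pi * y) \<noteq> 0" using y by simp
    have "\<i> * of_real (sinh (pi * y)) * (Digamma (1 - w) - Digamma (1 + w) + 1 / w) = of_real (pi * cosh (pi * y))"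
      using cot unfolding s c Dp by (simp add: algebra_simps)
    then have "\<i> * (Digamma (1 - w) - Digamma (1 + w) + 1 / w) = of_real (pi * cosh (pi * y)) / of_real (sinh (pi * y))"
      using sh by (simp add: field_simps)
    moreover have "\<i> * (1 / w) = of_real (1 / y)" by (simp add: w_def)
    ultimately show ?thesis by (simp add: algebra_simps)
  qed
  ultimately have "(\<lambda>k. 2 * y / ((real (Suc k))\<^sup>2 + y\<^sup>2)) sums (pi * (cosh (pi * y) / sinh (pi * y)) - 1 / y)"
    by (simp only: sums_of_real_iff)
  then have "(\<lambda>k. 1 / (2 * pi) * (2 * y / ((real (Suc k))\<^sup>2 + y\<^sup>2))) sums (1 / (2 * pi) * (pi * (cosh (pi * y) / sinh (pi * y)) - 1 / y))"
    by (rule sums_mult)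
  moreover have "1 / (2 * pi) * (2 * y / (N\<^sup>2 + y\<^sup>2)) = 2 * x / ((2 * pi * N)\<^sup>2 + x\<^sup>2)" for N
  proof -
    have "(2 * pi * N)\<^sup>2 + x\<^sup>2 = (2 * pi)\<^sup>2 * (N\<^sup>2 + y\<^sup>2)" by (simp add: xy power_mult_distrib algebra_simps)
    moreover have "N\<^sup>2 + y\<^sup>2 > 0" using y by (simp add: add_nonneg_pos)
    ultimately show ?thesis unfolding xy by (simp add: power2_eq_square)
  qed
  moreover have "1 / (2 * pi) * (pi * (cosh (pi * y) / sinh (pi * y)) - 1 / y) = (1 + exp (- x)) / (2 * (1 - exp (- x))) - 1 / x"
  proof -
    define E where "E = exp (pi * y)"
    have E: "E > 1" using y by (simp add: E_def)
    have e: "exp (- x) = 1 / E^2" "exp (- (pi * y)) = 1 / E"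
      by (simp_all add: xy E_def exp_minus inverse_eq_divide flip: exp_double)
    have "E\<^sup>2 - 1 > 0" using E by (simp add: one_less_power)
    then have "cosh (pi * y) / sinh (pi * y) = (1 + exp (- x)) / (1 - exp (- x))"
      using E unfolding cosh_field_def sinh_field_def e E_def[symmetric] by (simp add: field_simps power2_eq_square)
    moreover have "1 / (2 * pi) * (pi * Q - 1 / y) = Q / 2 - 1 / x" for Q
      using y by (simp add: xy field_simps)
    moreover have "(1 + exp (- x)) / (2 * (1 - exp (- x))) = (1 + exp (- x)) / (1 - exp (- x)) / 2"
      by (simp add: mult.commute)
    ultimately show ?thesis by (simp only:)
  qed
  ultimately show ?thesis by simp
qed

section \<open>Nonnegative integrals of powers, exponentials and rational functions\<close>

lemma nn_integral_Gamma_scaled: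
  assumes "r > 0" "a > 0"
  shows "(\<integral>\<^sup>+x. ennreal (indicator {0<..} x * (x powr (r - 1) * exp (- (a * x)))) \<partial>lborel) = ennreal (Gamma r * a powr (- r))"
proof -
  have "ennreal (Gamma r) = (\<integral>\<^sup>+t. ennreal (indicator {0..} t * t powr (r - 1) / exp t) \<partial>lborel)"
    by (rule Gamma_conv_nn_integral_real) fact
  also have "\<dots> = ennreal a * (\<integral>\<^sup>+x. ennreal (indicator {0..} (0 + a * x) * (0 + a * x) powr (r - 1) / exp (0 + a * x)) \<partial>lborel)"
    using assms by (subst nn_integral_real_affine[where c = a and t = 0]) auto
  also have "(\<integral>\<^sup>+x. ennreal (indicator {0..} (0 + a * x) * (0 + a * x) powr (r - 1) / exp (0 + a * x)) \<partial>lborel) =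
      (\<integral>\<^sup>+x. ennreal (a powr (r - 1)) * ennreal (indicator {0<..} x * (x powr (r - 1) * exp (- (a * x)))) \<partial>lborel)"
    using assms by (intro nn_integral_cong)
      (auto simp: indicator_def zero_le_mult_iff powr_mult exp_minus divide_inverse mult_ac simp flip: ennreal_mult')
  also have "\<dots> = ennreal (a powr (r - 1)) * (\<integral>\<^sup>+x. ennreal (indicator {0<..} x * (x powr (r - 1) * exp (- (a * x)))) \<partial>lborel)"
    by (rule nn_integral_cmult) simp
  finally have "ennreal (Gamma r) = ennreal (a powr r) * (\<integral>\<^sup>+x. ennreal (indicator {0<..} x * (x powr (r - 1) * exp (- (a * x)))) \<partial>lborel)"
    using assms by (simp add: powr_diff flip: mult.assoc ennreal_mult')
  then have "ennreal (a powr (- r)) * ennreal (Gamma r) = ennreal (a powr (- r)) * ennreal (a powr r) * (\<integral>\<^sup>+x. ennreal (indicator {0<..} x * (x powr (r - 1) * exp (- (a * x)))) \<partial>lborel)"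
    by (simp add: mult.assoc)
  also have "ennreal (a powr (- r)) * ennreal (a powr r) = 1"
    using assms by (simp flip: ennreal_mult' powr_add)
  finally have "(\<integral>\<^sup>+x. ennreal (indicator {0<..} x * (x powr (r - 1) * exp (- (a * x)))) \<partial>lborel) = ennreal (a powr (- r)) * ennreal (Gamma r)"
    by (simp only: mult_1)
  also have "\<dots> = ennreal (Gamma r * a powr (- r))"
    using assms by (subst ennreal_mult'[symmetric]) (auto simp: mult.commute)
  finally show ?thesis .
qed

text \<open>The half-line is exhausted by [0, (N + 1)^2] on one side and [0, N + 1] on the other;
  substitution on compact intervals passes to the limit by monotone convergence.\<close>

lemma nn_integral_substitution_square:
  fixes f :: "real \<Rightarrow> ennreal"
  assumes [measurable]: "f \<in> borel_measurable borel"
  shows "(\<integral>\<^sup>+t. f t * indicator {0..} t \<partial>lborel) = (\<integral>\<^sup>+x. f (x\<^sup>2) * ennreal (2 * x) * indicator {0..} x \<partial>lborel)"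
proof -
  have lim: "(\<integral>\<^sup>+t. g t * indicator {0..} t \<partial>lborel) = (SUP N. \<integral>\<^sup>+t. g t * indicator {0..b N} t \<partial>lborel)"
    if [measurable]: "g \<in> borel_measurable borel" and b: "incseq b" "filterlim b at_top sequentially" for g :: "real \<Rightarrow> ennreal" and b :: "nat \<Rightarrow> real"
  proof -
    have "g t * indicator {0..} t = (SUP N. g t * indicator {0..b N} t)" for t
    proof (cases "t \<ge> 0")
      case True
      obtain N where "t \<le> b N" using b(2) by (force simp: filterlim_at_top eventually_sequentially)
      then have "g t \<le> (SUP N. g t * indicator {0..b N} t)"
        using True by (intro SUP_upper2[of N]) auto
      moreover have "(SUP N. g t * indicator {0..b N} t) \<le> g t"
        by (intro SUP_least) (auto simp: indicator_def)
      ultimately show ?thesis using True by (simp add: antisym)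
    qed simp
    then have "(\<integral>\<^sup>+t. g t * indicator {0..} t \<partial>lborel) = (\<integral>\<^sup>+t. (SUP N. g t * indicator {0..b N} t) \<partial>lborel)"
      by simp
    also have "\<dots> = (SUP N. \<integral>\<^sup>+t. g t * indicator {0..b N} t \<partial>lborel)"
      using b(1) by (intro nn_integral_monotone_convergence_SUP)
        (auto simp: incseq_def le_fun_def indicator_def intro: order_trans)
    finally show ?thesis .
  qed
  have "(\<integral>\<^sup>+t. f t * indicator {0..(real (Suc N))\<^sup>2} t \<partial>lborel) = (\<integral>\<^sup>+x. f (x\<^sup>2) * ennreal (2 * x) * indicator {0..real (Suc N)} x \<partial>lborel)" for N
  proof -
    have "((\<lambda>x::real. x\<^sup>2) has_real_derivative 2 * x) (at x)" for x
      by (auto intro!: derivative_eq_intros)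
    then show ?thesis
      using nn_integral_substitution_aux[of f 0 "real (Suc N)" "\<lambda>x. x\<^sup>2" "\<lambda>x. 2 * x"]
      by (auto intro!: continuous_intros simp del: of_nat_Suc)
  qed
  moreover have "filterlim (\<lambda>N. (real (Suc N))\<^sup>2) at_top sequentially" "filterlim (\<lambda>N. real (Suc N)) at_top sequentially"
    by real_asymp+
  ultimately show ?thesis
    by (subst lim[of f "\<lambda>N. (real (Suc N))\<^sup>2"] , simp, simp add: incseq_def power_mono del: of_nat_Suc, simp,
        subst lim[of "\<lambda>x. f (x\<^sup>2) * ennreal (2 * x)" "\<lambda>N. real (Suc N)"])
       (simp_all add: incseq_def)
qed

lemma Gamma_reflection_real:
  fixes p :: real
  assumes "0 < p" "p < 1"
  shows "Gamma p * Gamma (1 - p) = pi / sin (pi * p)"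
proof -
  have "complex_of_real (Gamma p * Gamma (1 - p)) = of_real (pi / sin (pi * p))"
    using Gamma_reflection_complex[of "of_real p"]
    by (simp add: Gamma_complex_of_real[symmetric] sin_of_real[symmetric] del: Gamma_complex_of_real)
  then show ?thesis by (simp only: of_real_eq_iff)
qed

text \<open>1 / (c + t) is the Laplace integral of exp(-(c + t) r) over r > 0. Tonelli leaves two
  Gamma integrals, whose product Gamma(p) Gamma(1 - p) is reflected.\<close>

lemma nn_integral_powr_over_sum:
  assumes p: "0 < p" "p < 1" and c: "c > 0"
  shows "(\<integral>\<^sup>+t. ennreal (indicator {0<..} t * (t powr (p - 1) / (c + t))) \<partial>lborel) = ennreal (pi / sin (pi * p) * c powr (p - 1))"
proof -
  have "(\<integral>\<^sup>+t. ennreal (indicator {0<..} t * (t powr (p - 1) / (c + t))) \<partial>lborel) =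
     (\<integral>\<^sup>+t. (\<integral>\<^sup>+r. ennreal (indicator {0<..} t * indicator {0<..} r * t powr (p - 1) * exp (- ((c + t) * r))) \<partial>lborel) \<partial>lborel)"
  proof (rule nn_integral_cong)
    fix t :: real
    show "ennreal (indicator {0<..} t * (t powr (p - 1) / (c + t))) =
        (\<integral>\<^sup>+r. ennreal (indicator {0<..} t * indicator {0<..} r * t powr (p - 1) * exp (- ((c + t) * r))) \<partial>lborel)"
    proof (cases "t > 0")
      case True
      have "(\<integral>\<^sup>+r. ennreal (indicator {0<..} t * indicator {0<..} r * t powr (p - 1) * exp (- ((c + t) * r))) \<partial>lborel) =
         (\<integral>\<^sup>+r. ennreal (t powr (p - 1)) * ennreal (indicator {0<..} r * (r powr (1 - 1) * exp (- ((c + t) * r)))) \<partial>lborel)"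
        using True by (intro nn_integral_cong) (auto simp: indicator_def simp flip: ennreal_mult')
      also have "\<dots> = ennreal (t powr (p - 1)) * ennreal (Gamma 1 * (c + t) powr (- 1))"
        using True c by (subst nn_integral_cmult, simp, subst nn_integral_Gamma_scaled) auto
      finally show ?thesis using True c by (simp add: powr_minus divide_inverse flip: ennreal_mult')
    qed simp
  qed
  also have "\<dots> = (\<integral>\<^sup>+r. (\<integral>\<^sup>+t. ennreal (indicator {0<..} t * indicator {0<..} r * t powr (p - 1) * exp (- ((c + t) * r))) \<partial>lborel) \<partial>lborel)"
    by (rule lborel_pair.Fubini'[symmetric]) simp
  also have "\<dots> = (\<integral>\<^sup>+r. ennreal (Gamma p) * ennreal (indicator {0<..} r * (r powr ((1 - p) - 1) * exp (- (c * r)))) \<partial>lborel)"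
  proof (rule nn_integral_cong)
    fix r :: real
    show "(\<integral>\<^sup>+t. ennreal (indicator {0<..} t * indicator {0<..} r * t powr (p - 1) * exp (- ((c + t) * r))) \<partial>lborel) =
        ennreal (Gamma p) * ennreal (indicator {0<..} r * (r powr ((1 - p) - 1) * exp (- (c * r))))"
    proof (cases "r > 0")
      case True
      have "(\<integral>\<^sup>+t. ennreal (indicator {0<..} t * indicator {0<..} r * t powr (p - 1) * exp (- ((c + t) * r))) \<partial>lborel) =
         (\<integral>\<^sup>+t. ennreal (exp (- (c * r))) * ennreal (indicator {0<..} t * (t powr (p - 1) * exp (- (r * t)))) \<partial>lborel)"
        using True by (intro nn_integral_cong) (auto simp: indicator_def algebra_simps simp flip: ennreal_mult' exp_add)
      also have "\<dots> = ennreal (exp (- (c * r))) * ennreal (Gamma p * r powr (- p))"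
        using True p by (subst nn_integral_cmult, simp, subst nn_integral_Gamma_scaled) auto
      finally show ?thesis using True p by (simp add: mult_ac flip: ennreal_mult')
    qed simp
  qed
  also have "\<dots> = ennreal (Gamma p) * ennreal (Gamma (1 - p) * c powr (- (1 - p)))"
    using p c by (subst nn_integral_cmult, simp, subst nn_integral_Gamma_scaled) auto
  also have "\<dots> = ennreal (Gamma p * Gamma (1 - p) * c powr (p - 1))"
    using p by (simp add: mult.assoc flip: ennreal_mult')
  finally show ?thesis using p by (simp add: Gamma_reflection_real)
qed

lemma nn_integral_powr_over_squares:
  assumes \<sigma>: "0 < \<sigma>" "\<sigma> < 1" and b: "b > 0"
  shows "(\<integral>\<^sup>+x. ennreal (indicator {0<..} x * (2 * x powr (- \<sigma>) / (b\<^sup>2 + x\<^sup>2))) \<partial>lborel) =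
     ennreal (pi / cos (pi * \<sigma> / 2) * b powr (- \<sigma> - 1))"
proof -
  \<comment> \<open>The exponent produced by t = x^2; it turns sin(pi p) into cos(pi \<sigma> /
    2).\<close>
  define p where "p = (1 - \<sigma>) / 2"
  have p: "0 < p" "p < 1" using \<sigma> by (auto simp: p_def)
  have "(\<integral>\<^sup>+x. ennreal (indicator {0<..} x * (2 * x powr (- \<sigma>) / (b\<^sup>2 + x\<^sup>2))) \<partial>lborel) =
     (\<integral>\<^sup>+x. ennreal (indicator {0<..} (x\<^sup>2) * ((x\<^sup>2) powr (p - 1) / (b\<^sup>2 + x\<^sup>2))) * ennreal (2 * x) * indicator {0..} x \<partial>lborel)"
  proof (rule nn_integral_cong)
    fix x :: real
    show "ennreal (indicator {0<..} x * (2 * x powr (- \<sigma>) / (b\<^sup>2 + x\<^sup>2))) =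
       ennreal (indicator {0<..} (x\<^sup>2) * ((x\<^sup>2) powr (p - 1) / (b\<^sup>2 + x\<^sup>2))) * ennreal (2 * x) * indicator {0..} x"
    proof (cases "x > 0")
      case True
      have x2: "x\<^sup>2 = x powr 2" using True by simp
      have "(x\<^sup>2) powr (p - 1) = x powr (2 * (p - 1))" unfolding x2 powr_powr ..
      also have "2 * (p - 1) = - \<sigma> - 1" by (simp add: p_def)
      also have "x powr (- \<sigma> - 1) = x powr (- \<sigma>) / x" using True by (simp add: powr_diff)
      finally show ?thesis using True by (simp flip: ennreal_mult')
    qed (auto simp: indicator_def)
  qed
  also have "\<dots> = (\<integral>\<^sup>+t. ennreal (indicator {0<..} t * (t powr (p - 1) / (b\<^sup>2 + t))) * indicator {0..} t \<partial>lborel)"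
    by (rule nn_integral_substitution_square[symmetric]) simp
  also have "\<dots> = (\<integral>\<^sup>+t. ennreal (indicator {0<..} t * (t powr (p - 1) / (b\<^sup>2 + t))) \<partial>lborel)"
    by (intro nn_integral_cong) (auto simp: indicator_def)
  also have "\<dots> = ennreal (pi / sin (pi * p) * (b\<^sup>2) powr (p - 1))"
    using p b by (intro nn_integral_powr_over_sum) auto
  also have "(b\<^sup>2) powr (p - 1) = b powr (- \<sigma> - 1)"
  proof -
    have b2: "b\<^sup>2 = b powr 2" using b by simp
    have "2 * (p - 1) = - \<sigma> - 1" by (simp add: p_def)
    then show ?thesis unfolding b2 powr_powr by (simp only:)
  qed
  also have "sin (pi * p) = cos (pi * \<sigma> / 2)"
  proof -
    have "pi * p = pi / 2 - pi * \<sigma> / 2" by (simp add: p_def field_simps)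
    then show ?thesis by (simp add: sin_diff)
  qed
  finally show ?thesis .
qed

section \<open>Zeta on the real segment (-1, 0) as a sum of trapezoidal errors\<close>

definition trapr :: "nat \<Rightarrow> real \<Rightarrow> real" where
  "trapr n \<sigma> = integral {0..1} (\<lambda>u. u * (1 - u) / 2 * (real n + u) powr (\<sigma> - 2))"

text \<open>The closed form matters in \<open>zeta1_neg_real\<close>, where this one term absorbs
  the elementary part of zeta at -\<sigma>.\<close>

lemma trapr_0:
  assumes "0 < \<sigma>" "\<sigma> < 1"
  shows "((\<lambda>u. u * (1 - u) / 2 * (real 0 + u) powr (\<sigma> - 2)) has_integral 1 / (2 * \<sigma> * (1 + \<sigma>))) {0..1}"
proof -
  define G where "G = (\<lambda>u::real. (u powr \<sigma> / \<sigma> - u powr (\<sigma> + 1) / (\<sigma> + 1)) / 2)"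
  have "((\<lambda>u. u * (1 - u) / 2 * (real 0 + u) powr (\<sigma> - 2)) has_integral G 1 - G 0) {0..1}"
  proof (rule fundamental_theorem_of_calculus_interior)
    show "continuous_on {0..1} G"
      using assms unfolding G_def by (intro continuous_intros continuous_on_powr') auto
    fix u :: real assume u: "u \<in> {0<..<1}"
    have D: "((\<lambda>u. u powr a) has_real_derivative a * u powr (a - 1)) (at u)" for a
      using u by (intro has_real_derivative_powr) auto
    have "(G has_real_derivative ((\<sigma> * u powr (\<sigma> - 1)) / \<sigma> - ((\<sigma> + 1) * u powr (\<sigma> + 1 - 1)) / (\<sigma> + 1)) / 2) (at u)"
      unfolding G_def by (intro DERIV_cdivide DERIV_diff D)
    moreover have "((\<sigma> * u powr (\<sigma> - 1)) / \<sigma> - ((\<sigma> + 1) * u powr (\<sigma> + 1 - 1)) / (\<sigma> + 1)) / 2 = u * (1 - u) / 2 * (real 0 + u) powr (\<sigma> - 2)"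
    proof -
      have p: "u powr (a + 1) = u * u powr a" for a using u by (simp add: powr_add)
      have "\<sigma> - 1 = (\<sigma> - 2) + 1" "\<sigma> = (\<sigma> - 2) + 1 + 1" by simp_all
      then have "u powr (\<sigma> - 1) = u * u powr (\<sigma> - 2)" "u powr \<sigma> = u * u * u powr (\<sigma> - 2)"
        using p[of "\<sigma> - 2"] p[of "\<sigma> - 2 + 1"] by (metis, metis mult.assoc)
      moreover have "(\<sigma> * A) / \<sigma> = A" "((\<sigma> + 1) * A) / (\<sigma> + 1) = A" for A
        using assms by simp_all
      ultimately show ?thesis by (simp only: add_diff_cancel_right') (simp add: algebra_simps)
    qed
    ultimately show "(G has_vector_derivative u * (1 - u) / 2 * (real 0 + u) powr (\<sigma> - 2)) (at u)"
      unfolding has_real_derivative_iff_has_vector_derivative[symmetric] by (simp only:)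
  qed simp
  moreover have "G 1 - G 0 = 1 / (2 * \<sigma> * (1 + \<sigma>))"
    using assms by (simp add: G_def field_simps)
  ultimately show ?thesis by simp
qed

lemma trapr_has_integral:
  assumes "0 < \<sigma>" "\<sigma> < 1"
  shows "((\<lambda>u. u * (1 - u) / 2 * (real n + u) powr (\<sigma> - 2)) has_integral trapr n \<sigma>) {0..1}"
proof (cases "n = 0")
  case True
  show ?thesis unfolding trapr_def True
    by (rule integrable_integral, rule has_integral_integrable, rule trapr_0[OF assms])
next
  case False
  then have "continuous_on {0..1} (\<lambda>u. u * (1 - u) / 2 * (real n + u) powr (\<sigma> - 2))"
    by (intro continuous_intros) auto
  then show ?thesis unfolding trapr_def
    by (intro integrable_integral integrable_continuous_real)
qed

lemma trap_of_real:
  assumes "n \<ge> 1"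
  shows "trap n (- of_real \<sigma>) = of_real (trapr n \<sigma>)"
proof -
  have c: "continuous_on {0..1} (\<lambda>u. u * (1 - u) / 2 * (real n + u) powr (\<sigma> - 2))"
    using assms by (intro continuous_intros) auto
  have "((\<lambda>u. complex_of_real (u * (1 - u) / 2 * (real n + u) powr (\<sigma> - 2))) has_integral of_real (trapr n \<sigma>)) {0..1}"
    unfolding trapr_def
    by (intro has_integral_of_real integrable_integral integrable_continuous_real c)
  moreover have "complex_of_real (u * (1 - u) / 2 * (real n + u) powr (\<sigma> - 2)) =
      complex_of_real (u * (1 - u) / 2) * of_real (real n + u) powr (- (- of_real \<sigma>) - 2)" if "u \<in> {0..1}" for u
  proof -
    have "complex_of_real (real n + u) powr of_real (\<sigma> - 2) = of_real ((real n + u) powr (\<sigma> - 2))"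
      using that by (intro powr_of_real) auto
    moreover have "- (- complex_of_real \<sigma>) - 2 = of_real (\<sigma> - 2)" by simp
    ultimately show ?thesis by (simp only: of_real_mult)
  qed
  ultimately have "((\<lambda>u. complex_of_real (u * (1 - u) / 2) * of_real (real n + u) powr (- (- of_real \<sigma>) - 2)) has_integral of_real (trapr n \<sigma>)) {0..1}"
    by (rule has_integral_eq[rotated])
  then show ?thesis unfolding trap_def by (rule integral_unique)
qed

lemma trapr_nonneg: "trapr n \<sigma> \<ge> 0"
proof (cases "(\<lambda>u. u * (1 - u) / 2 * (real n + u) powr (\<sigma> - 2)) integrable_on {0..1}")
  case True
  then show ?thesis unfolding trapr_def
    by (rule Henstock_Kurzweil_Integration.integral_nonneg) auto
\<comment> \<open>A function that is not integrable has integral 0 by convention.\<close>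
qed (simp add: trapr_def not_integrable_integral)

text \<open>Two integrations by parts. This is the contribution of the interval [0, 1] in the
  Laplace picture; the one of [n, n + 1] differs from it by the factor exp(- n x).\<close>

lemma integral_trap_exp:
  fixes x :: real
  assumes x: "x > 0"
  shows "((\<lambda>u. u * (1 - u) / 2 * exp (- (u * x))) has_integral ((1 + exp (- x)) / 2 - (1 - exp (- x)) / x) / x\<^sup>2) {0..1}"
proof -
  define c1 c2 c3 where "c1 = 1 / x" and "c2 = 1 / x\<^sup>2" and "c3 = 1 / x ^ 3"
  have c: "x * c1 = 1" "x * c2 = c1" "x * c3 = c2"
    using x by (simp_all add: c1_def c2_def c3_def power2_eq_square power3_eq_cube)
  define G where "G = (\<lambda>u::real. - exp (- (u * x)) * (u * (1 - u) / 2 * c1 + (1 - 2 * u) / 2 * c2 - c3))"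
  have "((\<lambda>u. u * (1 - u) / 2 * exp (- (u * x))) has_integral G 1 - G 0) {0..1}"
  proof (rule fundamental_theorem_of_calculus)
    fix u :: real
    have D1: "((\<lambda>u. - exp (- (u * x))) has_real_derivative x * exp (- (u * x))) (at u within {0..1})"
      by (auto intro!: derivative_eq_intros)
    have D2: "((\<lambda>u. u * (1 - u) / 2 * c1 + (1 - 2 * u) / 2 * c2 - c3) has_real_derivative (1 - 2 * u) / 2 * c1 - c2) (at u within {0..1})"
      by (auto intro!: derivative_eq_intros simp: field_simps)
    have "(G has_real_derivative x * exp (- (u * x)) * (u * (1 - u) / 2 * c1 + (1 - 2 * u) / 2 * c2 - c3) +
        ((1 - 2 * u) / 2 * c1 - c2) * (- exp (- (u * x)))) (at u within {0..1})"
      unfolding G_def by (rule DERIV_mult[OF D1 D2])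
    moreover have "x * exp (- (u * x)) * (u * (1 - u) / 2 * c1 + (1 - 2 * u) / 2 * c2 - c3) +
        ((1 - 2 * u) / 2 * c1 - c2) * (- exp (- (u * x))) = u * (1 - u) / 2 * exp (- (u * x))"
    proof -
      have "x * e * (k * c1 + l * c2 - c3) + (l * c1 - c2) * (- e) = e * (k * (x * c1) + l * (x * c2) - x * c3) - e * (l * c1 - c2)" for e k l
        by (simp add: algebra_simps)
      also have "e * (k * (x * c1) + l * (x * c2) - x * c3) - e * (l * c1 - c2) = k * e" for e k l
        unfolding c by (simp add: algebra_simps)
      finally show ?thesis .
    qed
    ultimately show "(G has_vector_derivative u * (1 - u) / 2 * exp (- (u * x))) (at u within {0..1})"
      unfolding has_real_derivative_iff_has_vector_derivative[symmetric] by (simp only:)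
  qed simp
  moreover have "G 1 - G 0 = ((1 + exp (- x)) / 2 - (1 - exp (- x)) / x) / x\<^sup>2"
  proof -
    have "G 1 - G 0 = (1 + exp (- x)) / 2 * c2 - (1 - exp (- x)) * c3" by (simp add: G_def algebra_simps)
    moreover have "c2 = 1 / x\<^sup>2" "c3 = 1 / x / x\<^sup>2" by (simp_all add: c2_def c3_def power2_eq_square power3_eq_cube)
    ultimately show ?thesis by (simp add: diff_divide_distrib)
  qed
  ultimately show ?thesis by simp
qed

text \<open>Write the power under the integral as a Laplace integral, sum the geometric series over \<open>n\<close>, and expand the
  resulting \<open>coth\<close> in partial fractions. All terms are nonnegative, hence the formulation in \<open>ennreal\<close>.\<close>
lemma trapr_sum_eq:
  assumes \<sigma>: "0 < \<sigma>" "\<sigma> < 1"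
  shows "ennreal (Gamma (2 - \<sigma>)) * (\<Sum>n. ennreal (trapr n \<sigma>)) =
    (\<Sum>m. ennreal (pi / cos (pi * \<sigma> / 2) * (2 * pi * real (Suc m)) powr (- \<sigma> - 1)))"
proof -
  \<comment> \<open>The weight u (1 - u) / 2 times the Laplace integrand whose x-integral is Gamma(2
    - \<sigma>) (n + u)^(\<sigma> - 2).\<close>
  define F where "F = (\<lambda>n u x. ennreal (indicator {0..1} u * (u * (1 - u) / 2) * (indicator {0<..} x * (x powr ((2 - \<sigma>) - 1) * exp (- ((real n + u) * x))))))"
  have Fm: "case_prod (F n) \<in> borel_measurable (lborel \<Otimes>\<^sub>M lborel)" for n
    unfolding F_def by measurable
  have Fx: "(\<lambda>x. \<integral>\<^sup>+u. F n u x \<partial>lborel) \<in> borel_measurable lborel" for n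
    unfolding F_def by measurable
  have A: "(\<integral>\<^sup>+u. (\<integral>\<^sup>+x. F n u x \<partial>lborel) \<partial>lborel) = ennreal (Gamma (2 - \<sigma>)) * ennreal (trapr n \<sigma>)" for n
  proof -
    have "(\<integral>\<^sup>+u. (\<integral>\<^sup>+x. F n u x \<partial>lborel) \<partial>lborel) =
        (\<integral>\<^sup>+u. ennreal (Gamma (2 - \<sigma>)) * (ennreal (u * (1 - u) / 2 * (real n + u) powr (\<sigma> - 2)) * indicator {0..1} u) \<partial>lborel)"
    proof (rule nn_integral_cong)
      fix u :: real
      show "(\<integral>\<^sup>+x. F n u x \<partial>lborel) = ennreal (Gamma (2 - \<sigma>)) * (ennreal (u * (1 - u) / 2 * (real n + u) powr (\<sigma> - 2)) * indicator {0..1} u)"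
      proof (cases "u \<in> {0<..1}")
        case True
        then have k: "0 \<le> u * (1 - u) / 2" by auto
        have "(\<integral>\<^sup>+x. F n u x \<partial>lborel) = (\<integral>\<^sup>+x. ennreal (u * (1 - u) / 2) * ennreal (indicator {0<..} x * (x powr ((2 - \<sigma>) - 1) * exp (- ((real n + u) * x)))) \<partial>lborel)"
          unfolding F_def ennreal_mult'[OF k, symmetric] using True by (intro nn_integral_cong) simp
        also have "\<dots> = ennreal (u * (1 - u) / 2) * ennreal (Gamma (2 - \<sigma>) * (real n + u) powr (- (2 - \<sigma>)))"
          using True \<sigma> by (subst nn_integral_cmult, simp, subst nn_integral_Gamma_scaled) auto
        also have "\<dots> = ennreal (Gamma (2 - \<sigma>)) * (ennreal (u * (1 - u) / 2 * (real n + u) powr (\<sigma> - 2)) * indicator {0..1} u)"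
        proof -
          define g P where "g = Gamma (2 - \<sigma>)" and "P = (real n + u) powr (\<sigma> - 2)"
          have g: "g \<ge> 0" using \<sigma> by (simp add: g_def)
          have "ennreal (u * (1 - u) / 2) * ennreal (g * P) = ennreal (g * (u * (1 - u) / 2 * P))"
            unfolding ennreal_mult'[OF k, symmetric] by (simp only: mult.left_commute)
          also have "\<dots> = ennreal g * ennreal (u * (1 - u) / 2 * P)" by (rule ennreal_mult'[OF g])
          finally show ?thesis using True unfolding g_def P_def by simp
        qed
        finally show ?thesis .
      next
        case False
        \<comment> \<open>The point u = 0 is set aside since for n = 0 the exponential does not
          decay there; the weight vanishes at it anyway.\<close>
        then have "u = 0 \<or> u \<notin> {0..1}" by auto
        then show ?thesis by (auto simp: F_def)
      qed
    qed
    also have "\<dots> = ennreal (Gamma (2 - \<sigma>)) * (\<integral>\<^sup>+u. ennreal (u * (1 - u) / 2 * (real n + u) powr (\<sigma> - 2)) * indicator {0..1} u \<partial>lborel)"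
      by (rule nn_integral_cmult) simp
    also have "(\<integral>\<^sup>+u. ennreal (u * (1 - u) / 2 * (real n + u) powr (\<sigma> - 2)) * indicator {0..1} u \<partial>lborel) = ennreal (trapr n \<sigma>)"
      by (intro nn_integral_has_integral_lebesgue' trapr_has_integral \<sigma>) auto
    finally show ?thesis .
  qed
  \<comment> \<open>Summing exp(- n x) over n gives \<open>\<kappa>\<close> / (1 - exp(- x)), which
    is (coth(x/2) / 2 - 1/x) / x^2, the function expanded by
    \<open>coth_partial_fractions\<close>.\<close>
  have B: "(\<Sum>n. \<integral>\<^sup>+u. F n u x \<partial>lborel) = (\<Sum>m. ennreal (indicator {0<..} x * (2 * x powr (- \<sigma>) / ((2 * pi * real (Suc m))\<^sup>2 + x\<^sup>2))))" for x
  proof (cases "x > 0")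
    case x: True
    define \<kappa> where "\<kappa> = ((1 + exp (- x)) / 2 - (1 - exp (- x)) / x) / x\<^sup>2"
    have "\<kappa> \<ge> 0"
      unfolding \<kappa>_def by (rule has_integral_nonneg[OF integral_trap_exp[OF x]]) auto
    define c where "c = x powr (1 - \<sigma>)"
    have 1: "(\<integral>\<^sup>+u. F n u x \<partial>lborel) = ennreal (c * \<kappa> * exp (- x) ^ n)" for n
    proof -
      have "(\<integral>\<^sup>+u. F n u x \<partial>lborel) = (\<integral>\<^sup>+u. ennreal (c * exp (- x) ^ n) * (ennreal (u * (1 - u) / 2 * exp (- (u * x))) * indicator {0..1} u) \<partial>lborel)"
      proof (rule nn_integral_cong)
        fix u :: real
        have "- ((real n + u) * x) = real n * (- x) + - (u * x)" by (simp add: algebra_simps)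
        then have e: "exp (- ((real n + u) * x)) = exp (- x) ^ n * exp (- (u * x))"
          by (simp only: exp_add exp_of_nat_mult)
        have c: "c * exp (- x) ^ n \<ge> 0" by (simp add: c_def)
        show "F n u x = ennreal (c * exp (- x) ^ n) * (ennreal (u * (1 - u) / 2 * exp (- (u * x))) * indicator {0..1} u)"
        proof (cases "u \<in> {0..1}")
          case True
          have "F n u x = ennreal (c * exp (- x) ^ n * (u * (1 - u) / 2 * exp (- (u * x))))"
            using x True unfolding F_def e by (simp add: c_def mult_ac)
          also have "\<dots> = ennreal (c * exp (- x) ^ n) * ennreal (u * (1 - u) / 2 * exp (- (u * x)))"
            by (rule ennreal_mult'[OF c])
          finally show ?thesis using True by simp
        qed (simp add: F_def)
      qed
      also have "\<dots> = ennreal (c * exp (- x) ^ n) * (\<integral>\<^sup>+u. ennreal (u * (1 - u) / 2 * exp (- (u * x))) * indicator {0..1} u \<partial>lborel)"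
        by (rule nn_integral_cmult) simp
      also have "(\<integral>\<^sup>+u. ennreal (u * (1 - u) / 2 * exp (- (u * x))) * indicator {0..1} u \<partial>lborel) = ennreal \<kappa>"
        unfolding \<kappa>_def by (intro nn_integral_has_integral_lebesgue' integral_trap_exp x) auto
      also have "ennreal (c * exp (- x) ^ n) * ennreal \<kappa> = ennreal (c * exp (- x) ^ n * \<kappa>)"
        using \<open>\<kappa> \<ge> 0\<close> by (intro ennreal_mult[symmetric]) (auto simp: c_def)
      finally show ?thesis by (simp only: mult_ac)
    qed
    have c0: "c \<ge> 0" by (simp add: c_def)
    have "(\<lambda>n. c * \<kappa> * exp (- x) ^ n) sums (c * \<kappa> * (1 / (1 - exp (- x))))"
      using x by (intro sums_mult geometric_sums) auto
    then have "(\<Sum>n. \<integral>\<^sup>+u. F n u x \<partial>lborel) = ennreal (c * \<kappa> * (1 / (1 - exp (- x))))"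
      unfolding 1 using \<open>\<kappa> \<ge> 0\<close> c0 by (intro suminf_ennreal_eq) simp_all
    moreover have "(\<lambda>m. (c / x\<^sup>2) * (2 * x / ((2 * pi * real (Suc m))\<^sup>2 + x\<^sup>2))) sums ((c / x\<^sup>2) * ((1 + exp (- x)) / (2 * (1 - exp (- x))) - 1 / x))"
      by (intro sums_mult coth_partial_fractions x)
    then have "(\<Sum>m. ennreal ((c / x\<^sup>2) * (2 * x / ((2 * pi * real (Suc m))\<^sup>2 + x\<^sup>2)))) = ennreal ((c / x\<^sup>2) * ((1 + exp (- x)) / (2 * (1 - exp (- x))) - 1 / x))"
    proof (rule suminf_ennreal_eq[rotated])
      show "0 \<le> c / x\<^sup>2 * (2 * x / ((2 * pi * real (Suc i))\<^sup>2 + x\<^sup>2))" for i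
        using x c0 by (intro mult_nonneg_nonneg divide_nonneg_nonneg add_nonneg_nonneg) simp_all
    qed
    moreover have "(c / x\<^sup>2) * ((1 + exp (- x)) / (2 * (1 - exp (- x))) - 1 / x) = c * \<kappa> * (1 / (1 - exp (- x)))"
    proof -
      define d where "d = 1 - exp (- x)"
      have d: "d \<noteq> 0" using x by (simp add: d_def)
      have "(1 + exp (- x)) / (2 * d) - 1 / x = ((1 + exp (- x)) / 2 - d / x) * (1 / d)"
        using d by (simp add: diff_divide_distrib mult.commute)
      then show ?thesis unfolding \<kappa>_def d_def[symmetric] by (simp only: times_divide_eq_left times_divide_eq_right mult_1_right mult_1_left)
    qed
    moreover have "(c / x\<^sup>2) * (2 * x / ((2 * pi * real (Suc m))\<^sup>2 + x\<^sup>2)) = indicator {0<..} x * (2 * x powr (- \<sigma>) / ((2 * pi * real (Suc m))\<^sup>2 + x\<^sup>2))" for m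
    proof -
      have "c = x * x powr (- \<sigma>)" using x powr_add[of x 1 "- \<sigma>"] by (simp add: c_def)
      moreover have "(x * P / x\<^sup>2) * (2 * x / D) = 2 * P / D" for P D
        using x by (simp add: power2_eq_square)
      ultimately show ?thesis using x by (simp only: indicator_simps greaterThan_iff mult_1_left)
    qed
    ultimately show ?thesis by (simp only:)
  qed (simp add: F_def)
  have "ennreal (Gamma (2 - \<sigma>)) * (\<Sum>n. ennreal (trapr n \<sigma>)) = (\<Sum>n. \<integral>\<^sup>+u. (\<integral>\<^sup>+x. F n u x \<partial>lborel) \<partial>lborel)"
    unfolding A by simp
  also have "\<dots> = (\<Sum>n. \<integral>\<^sup>+x. (\<integral>\<^sup>+u. F n u x \<partial>lborel) \<partial>lborel)"
    by (intro suminf_cong lborel_pair.Fubini'[symmetric] Fm)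
  also have "\<dots> = (\<integral>\<^sup>+x. (\<Sum>n. \<integral>\<^sup>+u. F n u x \<partial>lborel) \<partial>lborel)"
    by (intro nn_integral_suminf[symmetric] Fx)
  also have "\<dots> = (\<Sum>m. \<integral>\<^sup>+x. ennreal (indicator {0<..} x * (2 * x powr (- \<sigma>) / ((2 * pi * real (Suc m))\<^sup>2 + x\<^sup>2))) \<partial>lborel)"
    unfolding B by (intro nn_integral_suminf) measurable
  also have "\<dots> = (\<Sum>m. ennreal (pi / cos (pi * \<sigma> / 2) * (2 * pi * real (Suc m)) powr (- \<sigma> - 1)))"
    by (intro suminf_cong nn_integral_powr_over_squares \<sigma>) simp
  finally show ?thesis .
qed

lemma summable_trapr:
  assumes "0 < \<sigma>" "\<sigma> < 1"
  shows "summable (\<lambda>n. trapr n \<sigma>)"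
proof -
  have "summable (\<lambda>n. trap (Suc n) (- of_real \<sigma>))"
    by (rule summable_trap) (use assms in simp)
  then have "summable (\<lambda>n. complex_of_real (trapr (Suc n) \<sigma>))"
    by (simp only: trap_of_real le_add1 plus_1_eq_Suc)
  then have "summable (\<lambda>n. Re (complex_of_real (trapr (Suc n) \<sigma>)))" by (rule summable_Re)
  then have "summable (\<lambda>n. trapr (Suc n) \<sigma>)" by simp
  then show ?thesis by (subst (asm) summable_Suc_iff)
qed

lemma trapr_suminf:
  assumes \<sigma>: "0 < \<sigma>" "\<sigma> < 1"
  shows "Gamma (2 - \<sigma>) * (\<Sum>n. trapr n \<sigma>) =
    pi / cos (pi * \<sigma> / 2) * (2 * pi) powr (- \<sigma> - 1) * (\<Sum>m. real (Suc m) powr (- \<sigma> - 1))"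
proof -
  define K where "K = pi / cos (pi * \<sigma> / 2) * (2 * pi) powr (- \<sigma> - 1)"
  have "cos (pi * \<sigma> / 2) > 0" using \<sigma> by (intro cos_gt_zero) auto
  then have K: "K \<ge> 0" by (simp add: K_def)
  have G: "Gamma (2 - \<sigma>) \<ge> 0" using \<sigma> by simp
  have t: "pi / cos (pi * \<sigma> / 2) * (2 * pi * real (Suc m)) powr (- \<sigma> - 1) = K * real (Suc m) powr (- \<sigma> - 1)" for m
    by (subst powr_mult) (simp_all add: K_def)
  have sm: "summable (\<lambda>m. real (Suc m) powr (- \<sigma> - 1))"
    using \<sigma> by (intro summable_powr_Suc) simp
  have S: "0 \<le> (\<Sum>n. trapr n \<sigma>)" by (intro suminf_nonneg summable_trapr \<sigma> trapr_nonneg)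
  have M: "0 \<le> (\<Sum>m. real (Suc m) powr (- \<sigma> - 1))" by (intro suminf_nonneg sm) simp
  have "ennreal (Gamma (2 - \<sigma>) * (\<Sum>n. trapr n \<sigma>)) = ennreal (Gamma (2 - \<sigma>)) * (\<Sum>n. ennreal (trapr n \<sigma>))"
    unfolding suminf_ennreal2[OF trapr_nonneg summable_trapr[OF \<sigma>]] by (rule ennreal_mult'[OF G])
  also have "\<dots> = (\<Sum>m. ennreal (K * real (Suc m) powr (- \<sigma> - 1)))"
    unfolding trapr_sum_eq[OF \<sigma>] t ..
  also have "\<dots> = ennreal (\<Sum>m. K * real (Suc m) powr (- \<sigma> - 1))"
    using K by (intro suminf_ennreal2 summable_mult sm) simp
  also have "(\<Sum>m. K * real (Suc m) powr (- \<sigma> - 1)) = K * (\<Sum>m. real (Suc m) powr (- \<sigma> - 1))"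
    by (rule suminf_mult[OF sm])
  finally show ?thesis
    using ennreal_inj[OF mult_nonneg_nonneg[OF G S] mult_nonneg_nonneg[OF K M]] unfolding K_def by blast
qed

lemma zeta1_real_Dirichlet:
  assumes "\<sigma> > 0"
  shows "zeta1 (1 + of_real \<sigma>) / of_real \<sigma> = of_real (\<Sum>m. real (Suc m) powr (- \<sigma> - 1))"
proof -
  have "(\<lambda>n. of_nat (Suc n) powr (- (1 + complex_of_real \<sigma>))) sums (zeta1 (1 + of_real \<sigma>) / (1 + of_real \<sigma> - 1))"
    using assms by (intro zeta1_Dirichlet) simp
  moreover have "of_nat (Suc n) powr (- (1 + complex_of_real \<sigma>)) = of_real (real (Suc n) powr (- \<sigma> - 1))" for n
  proof -
    have "complex_of_real (real (Suc n)) powr of_real (- \<sigma> - 1) = of_real (real (Suc n) powr (- \<sigma> - 1))"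
      by (rule powr_of_real) auto
    moreover have "- (1 + complex_of_real \<sigma>) = of_real (- \<sigma> - 1)" by simp
    ultimately show ?thesis by (simp only: of_real_of_nat_eq)
  qed
  moreover have "(\<lambda>n. complex_of_real (real (Suc n) powr (- \<sigma> - 1))) sums of_real (\<Sum>m. real (Suc m) powr (- \<sigma> - 1))"
    using assms by (intro sums_of_real summable_sums summable_powr_Suc) simp
  ultimately show ?thesis using sums_unique2 by fastforce
qed

text \<open>-\<sigma> (1 - \<sigma>) times \<open>trapr 0 \<sigma>\<close> equals 1 / (-\<sigma> -
  1) + 1/2. So the elementary terms of \<open>zeta1\<close> disappear into the sum once it starts at
  n = 0.\<close>

lemma zeta1_neg_real:
  assumes \<sigma>: "0 < \<sigma>" "\<sigma> < 1"
  shows "zeta1 (- of_real \<sigma>) / (- of_real \<sigma> - 1) = of_real (- \<sigma> * (1 - \<sigma>) * (\<Sum>n. trapr n \<sigma>))"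
proof -
  have t0: "trapr 0 \<sigma> = 1 / (2 * \<sigma> * (1 + \<sigma>))"
    using has_integral_unique[OF trapr_has_integral[OF \<sigma>, of 0] trapr_0[OF \<sigma>]] .
  define R where "R = (\<Sum>n. trapr (Suc n) \<sigma>)"
  have S: "(\<Sum>n. trapr n \<sigma>) = 1 / (2 * \<sigma> * (1 + \<sigma>)) + R"
    unfolding R_def using suminf_split_head[OF summable_trapr[OF \<sigma>]] t0 by simp
  have "(\<lambda>n. complex_of_real (trapr (Suc n) \<sigma>)) sums of_real R"
    unfolding R_def using summable_trapr[OF \<sigma>] by (intro sums_of_real summable_sums) (subst summable_Suc_iff)
  then have T: "trap_sum (- of_real \<sigma>) = of_real R"
    unfolding trap_sum_def using sums_unique[symmetric] trap_of_real by (metis (no_types, lifting) ext le_add1 plus_1_eq_Suc)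
  have "zeta1 (- of_real \<sigma>) / (- of_real \<sigma> - 1) = complex_of_real ((1 + (- \<sigma> - 1) * (1 / 2 + - \<sigma> * (- \<sigma> + 1) * R)) / (- \<sigma> - 1))"
    unfolding zeta1_def T by simp
  also have "(1 + (- \<sigma> - 1) * (1 / 2 + - \<sigma> * (- \<sigma> + 1) * R)) / (- \<sigma> - 1) = - \<sigma> * (1 - \<sigma>) * (1 / (2 * \<sigma> * (1 + \<sigma>)) + R)"
  proof -
    have nz: "- \<sigma> - 1 \<noteq> 0" using \<sigma> by simp
    have "- \<sigma> * (1 - \<sigma>) * (1 / (2 * \<sigma> * (1 + \<sigma>))) = 1 / (- \<sigma> - 1) + 1 / 2"
      using \<sigma> by (simp add: divide_simps) (simp add: algebra_simps)
    moreover have "(1 + (- \<sigma> - 1) * q) / (- \<sigma> - 1) = 1 / (- \<sigma> - 1) + q" for q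
      using nz by (simp add: add_divide_distrib)
    ultimately show ?thesis by (simp add: distrib_left)
  qed
  finally show ?thesis unfolding S .
qed

text \<open>\<open>trapr_suminf\<close> already is the functional equation, in its asymmetric form
  with Gamma(2 - \<sigma>) and a cosine. Reflection resolves the cosine into two Gamma values, and
  duplication trades Gamma(-\<sigma>) for Gamma(s/2).\<close>

lemma functional_equation_real:
  assumes \<sigma>: "0 < \<sigma>" "\<sigma> < 1"
  defines "s \<equiv> - complex_of_real \<sigma>"
  shows "zeta1 s / (s - 1) = of_real pi powr (s - 1 / 2) * Gamma ((1 - s) / 2) * rGamma (s / 2) * (zeta1 (1 - s) / (- s))"
proof -
  define S D where "S = (\<Sum>n. trapr n \<sigma>)" and "D = (\<Sum>m. real (Suc m) powr (- \<sigma> - 1))"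
  define g where "g = Gamma (- \<sigma> / 2)"
  define h where "h = Gamma ((1 - \<sigma>) / 2)"
  define k where "k = Gamma ((1 + \<sigma>) / 2)"
  define G where "G = Gamma (- \<sigma>)"
  have nI: "- \<sigma> \<notin> \<int>\<^sub>\<le>\<^sub>0" "1 - \<sigma> \<notin> \<int>\<^sub>\<le>\<^sub>0" "- \<sigma> / 2 \<notin> \<int>\<^sub>\<le>\<^sub>0"
  proof -
    show "- \<sigma> \<notin> \<int>\<^sub>\<le>\<^sub>0" using \<sigma> by (auto elim!: nonpos_Ints_cases')
    show "1 - \<sigma> \<notin> \<int>\<^sub>\<le>\<^sub>0" using \<sigma> by (auto elim!: nonpos_Ints_cases')
    show "- \<sigma> / 2 \<notin> \<int>\<^sub>\<le>\<^sub>0" 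
    proof
      assume "- \<sigma> / 2 \<in> \<int>\<^sub>\<le>\<^sub>0"
      then obtain n where "- \<sigma> / 2 = - real n" by (auto elim: nonpos_Ints_cases')
      then have "\<sigma> = real (2 * n)" by simp
      then show False using \<sigma> by (cases n) auto
    qed
  qed
  have nz: "g \<noteq> 0" "G \<noteq> 0" "h > 0" using nI \<sigma> by (auto simp: g_def G_def h_def Gamma_eq_zero_iff)
  have G2: "Gamma (2 - \<sigma>) = (1 - \<sigma>) * (- \<sigma> * G)"
    using Gamma_plus1[OF nI(1)] Gamma_plus1[OF nI(2)] by (simp add: G_def add.commute)
  have refl: "k * h = pi / cos (pi * \<sigma> / 2)"
  proof -
    have "Gamma ((1 - \<sigma>) / 2) * Gamma (1 - (1 - \<sigma>) / 2) = pi / sin (pi * ((1 - \<sigma>) / 2))"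
      using \<sigma> by (intro Gamma_reflection_real) auto
    moreover have "1 - (1 - \<sigma>) / 2 = (1 + \<sigma>) / 2" by (simp add: field_simps)
    moreover have "sin (pi * ((1 - \<sigma>) / 2)) = cos (pi * \<sigma> / 2)"
    proof -
      have "pi * ((1 - \<sigma>) / 2) = pi / 2 - pi * \<sigma> / 2" by (simp add: field_simps)
      then show ?thesis by (simp only: sin_diff) simp
    qed
    ultimately show ?thesis by (simp only: k_def h_def mult.commute)
  qed
  have dup: "g * h = 2 powr (1 + \<sigma>) * sqrt pi * G"
  proof -
    define z where "z = complex_of_real (- \<sigma> / 2)"
    have z2: "2 * z = of_real (- \<sigma>)" "z + 1 / 2 = of_real ((1 - \<sigma>) / 2)" "1 - 2 * z = of_real (1 + \<sigma>)"
      by (simp_all add: z_def field_simps)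
    have "z \<notin> \<int>\<^sub>\<le>\<^sub>0" using nI(3) unfolding z_def by (simp only: of_real_in_nonpos_Ints_iff not_False_eq_True)
    moreover have "z + 1 / 2 \<notin> \<int>\<^sub>\<le>\<^sub>0"
      unfolding z2 using \<sigma> by (auto elim!: nonpos_Ints_cases' simp: complex_eq_iff)
    ultimately have "Gamma z * Gamma (z + 1 / 2) = exp ((1 - 2 * z) * of_real (ln 2)) * of_real (sqrt pi) * Gamma (2 * z)"
      by (rule Gamma_legendre_duplication)
    then have "complex_of_real (g * h) = of_real (exp ((1 + \<sigma>) * ln 2) * sqrt pi * G)"
      unfolding z2(3) unfolding z2(1,2) unfolding z_def Gamma_complex_of_real exp_of_real of_real_mult[symmetric] g_def h_def G_def .
    then show ?thesis by (simp only: of_real_eq_iff powr_def) simp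
  qed
  have pw: "(2 * pi) powr (- \<sigma> - 1) * (2 powr (1 + \<sigma>) * sqrt pi) = pi powr (- \<sigma> - 1 / 2)"
  proof -
    have "(2 * pi) powr (- \<sigma> - 1) = 2 powr (- \<sigma> - 1) * pi powr (- \<sigma> - 1)" by (simp add: powr_mult)
    moreover have "2 powr (- \<sigma> - 1) * 2 powr (1 + \<sigma>) = (1 :: real)" by (simp flip: powr_add)
    moreover have "pi powr (- \<sigma> - 1) * sqrt pi = pi powr (- \<sigma> - 1 / 2)"
    proof -
      have e: "- \<sigma> - 1 / 2 = (- \<sigma> - 1) + 1 / 2" by simp
      show ?thesis unfolding e powr_add by (simp add: powr_half_sqrt)
    qed
    ultimately show ?thesis by (simp add: mult_ac)
  qed
  have "Gamma (2 - \<sigma>) * S = k * h * (2 * pi) powr (- \<sigma> - 1) * D"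
    unfolding S_def D_def refl by (rule trapr_suminf[OF \<sigma>])
  then have "G * (- \<sigma> * (1 - \<sigma>) * S) = k * h * (2 * pi) powr (- \<sigma> - 1) * D"
    unfolding G2 by (simp only: mult_ac)
  then have "g * h * (- \<sigma> * (1 - \<sigma>) * S) = (2 powr (1 + \<sigma>) * sqrt pi) * (k * h * (2 * pi) powr (- \<sigma> - 1) * D)"
    unfolding dup by (metis mult.assoc)
  also have "\<dots> = h * (k * D * ((2 * pi) powr (- \<sigma> - 1) * (2 powr (1 + \<sigma>) * sqrt pi)))" by (simp only: mult_ac)
  finally have "h * (g * (- \<sigma> * (1 - \<sigma>) * S)) = h * (k * D * pi powr (- \<sigma> - 1 / 2))"
    unfolding pw by (simp only: mult_ac)
  then have "g * (- \<sigma> * (1 - \<sigma>) * S) = k * D * pi powr (- \<sigma> - 1 / 2)"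
    using nz by (simp only: mult_cancel_left) auto
  then have main: "- \<sigma> * (1 - \<sigma>) * S = pi powr (- \<sigma> - 1 / 2) * k * rGamma (- \<sigma> / 2) * D"
    using nz by (simp add: g_def rGamma_inverse_Gamma field_simps)
  have "zeta1 s / (s - 1) = complex_of_real (- \<sigma> * (1 - \<sigma>) * S)"
    unfolding s_def S_def by (rule zeta1_neg_real[OF \<sigma>])
  also have "\<dots> = of_real (pi powr (- \<sigma> - 1 / 2)) * of_real k * of_real (rGamma (- \<sigma> / 2)) * of_real D"
    unfolding main of_real_mult ..
  also have "complex_of_real D = zeta1 (1 - s) / (- s)"
    using zeta1_real_Dirichlet[OF \<sigma>(1)] by (simp add: D_def s_def)
  also have "complex_of_real (pi powr (- \<sigma> - 1 / 2)) = of_real pi powr (s - 1 / 2)"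
    using powr_of_real[of pi "- \<sigma> - 1 / 2"] by (simp add: s_def)
  also have "complex_of_real k = Gamma ((1 - s) / 2)"
    unfolding k_def Gamma_complex_of_real[symmetric] by (simp add: s_def)
  also have "complex_of_real (rGamma (- \<sigma> / 2)) = rGamma (s / 2)"
    unfolding rGamma_complex_of_real[symmetric] by (simp add: s_def)
  finally show ?thesis .
qed

section \<open>From the real segment to the whole plane\<close>

definition zeta_left :: "complex \<Rightarrow> complex" where
  "zeta_left s = of_real pi powr (s - 1 / 2) * Gamma ((1 - s) / 2) * rGamma (s / 2) * (zeta1 (1 - s) / (- s))"

lemma zeta_left_holomorphic: "zeta_left holomorphic_on {s. Re s < 0}"
  unfolding zeta_left_def[abs_def]
  by (intro holomorphic_intros) (auto elim!: nonpos_Ints_cases' simp: complex_eq_iff)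

lemma zeta_right_holomorphic: "(\<lambda>s. zeta1 s / (s - 1)) holomorphic_on ({s. Re s > - 1} - {1})"
  by (intro holomorphic_intros) auto

text \<open>Both sides are holomorphic in this strip, the overlap of the half-planes of the two
  formulas, and they agree on the real segment from -3/4 to -1/4; the identity theorem
  applies.\<close>

lemma functional_equation_strip:
  assumes "- 1 < Re s" "Re s < 0"
  shows "zeta1 s / (s - 1) = zeta_left s"
proof -
  define U where "U = {s. - 1 < Re s \<and> Re s < 0}"
  define V where "V = closed_segment (complex_of_real (- 3 / 4)) (of_real (- 1 / 4))"
  have U: "U = {s. Re s > - 1} \<inter> {s. Re s < 0}" by (auto simp: U_def)
  have VE: "\<exists>\<sigma>. z = - of_real \<sigma> \<and> 0 < \<sigma> \<and> \<sigma> < 1" if "z \<in> V" for z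
  proof -
    have "z \<in> of_real ` closed_segment (- 3 / 4) (- 1 / 4)"
      using that unfolding V_def closed_segment_of_real .
    then obtain u where u: "z = of_real u" "u \<in> closed_segment (- 3 / 4) (- 1 / 4)"
      by (rule imageE)
    then show ?thesis by (intro exI[of _ "- u"]) (auto simp: closed_segment_eq_real_ivl)
  qed
  have "zeta1 s / (s - 1) - zeta_left s = 0"
  proof (rule analytic_continuation[where f = "\<lambda>s. zeta1 s / (s - 1) - zeta_left s" and w = s and S = U and U = V and \<xi> = "of_real (- 3 / 4)"])
    show "(\<lambda>s. zeta1 s / (s - 1) - zeta_left s) holomorphic_on U"
      by (intro holomorphic_on_diff holomorphic_on_subset[OF zeta_left_holomorphic] holomorphic_on_subset[OF zeta_right_holomorphic])
         (auto simp: U_def)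
    show "open U" unfolding U by (intro open_Int open_halfspace_Re_gt open_halfspace_Re_lt)
    show "connected U" unfolding U
      by (intro convex_connected convex_Int convex_halfspace_Re_gt convex_halfspace_Re_lt)
    show "V \<subseteq> U" using VE by (force simp: U_def)
    show "complex_of_real (- 3 / 4) \<in> U" by (simp add: U_def)
    show "complex_of_real (- 3 / 4) islimpt V"
    proof (rule connected_imp_perfect)
      show "V \<noteq> {x}" for x
      proof
        assume "V = {x}"
        moreover have "complex_of_real (- 3 / 4) \<in> V" "complex_of_real (- 1 / 4) \<in> V"
          unfolding V_def by (rule ends_in_segment)+
        ultimately have "complex_of_real (- 3 / 4) = of_real (- 1 / 4)" by (metis singletonD)
        then show False by (simp only: of_real_eq_iff)
      qed
    qed (auto simp: V_def)
    show "zeta1 z / (z - 1) - zeta_left z = 0" if z: "z \<in> V" for z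
    proof -
      obtain \<sigma> where "z = - of_real \<sigma>" "0 < \<sigma>" "\<sigma> < 1" using VE[OF z] by blast
      then show ?thesis using functional_equation_real[of \<sigma>] by (simp add: zeta_left_def)
    qed
    show "s \<in> U" using assms by (simp add: U_def)
  qed
  then show ?thesis by simp
qed

text \<open>Existence in \<open>zeta_def\<close> comes from gluing the two half-plane formulas along
  the strip. Uniqueness is the identity theorem, starting from Re s > 1, on the connected complement
  of 1; the value at 1 is prescribed.\<close>

lemma zeta_eq:
  "zeta = (\<lambda>s. if s = 1 then 0 else if Re s > - 1 then zeta1 s / (s - 1) else zeta_left s)"
  (is "_ = ?f")
proof -
  have R: "?f holomorphic_on ({s. Re s > - 1} - {1})"
    by (rule holomorphic_transform[OF zeta_right_holomorphic]) auto
  have L: "?f holomorphic_on {s. Re s < 0}"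
    by (rule holomorphic_transform[OF zeta_left_holomorphic]) (auto simp: functional_equation_strip)
  have "- {1} = ({s. Re s > - 1} - {1}) \<union> {s :: complex. Re s < 0}" by auto
  then have hol: "?f holomorphic_on - {1}"
    using holomorphic_on_Un[OF R L] by (simp only: open_Diff open_halfspace_Re_gt open_halfspace_Re_lt closed_singleton)
  have sums: "(\<lambda>n. of_nat (Suc n) powr (- s)) sums ?f s" if "Re s > 1" for s
  proof -
    have "?f s = zeta1 s / (s - 1)" using that by auto
    then show ?thesis using zeta1_Dirichlet[OF that] by (simp only:)
  qed
  have ex: "?f holomorphic_on - {1} \<and> ?f 1 = 0 \<and> (\<forall>s. 1 < Re s \<longrightarrow> (\<lambda>n. of_nat (Suc n) powr (- s)) sums ?f s)"
    using hol sums by simp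
  have un: "g = ?f" if g: "g holomorphic_on - {1} \<and> g 1 = 0 \<and> (\<forall>s. 1 < Re s \<longrightarrow> (\<lambda>n. of_nat (Suc n) powr (- s)) sums g s)" for g
  proof
    fix s
    show "g s = ?f s"
    proof (cases "s = 1")
      case False
      show ?thesis
      proof (rule analytic_continuation_open[where f = g and g = ?f and z = s and s = "{s. Re s > 1}" and s' = "- {1}"])
        show "open {s. Re s > 1}" by (rule open_halfspace_Re_gt)
        show "connected (- {1 :: complex})" by (rule connected_punctured_universe) simp
        have "2 \<in> {s. Re s > 1}" by simp
        then show "{s. Re s > 1} \<noteq> {}" by blast
        show "g holomorphic_on - {1}" using g by blast
        show "?f holomorphic_on - {1}" by (rule hol)
        show "g z = ?f z" if "z \<in> {s. Re s > 1}" for z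
          using that sums[of z] g sums_unique2 by blast
      qed (use False in auto)
    next
      case True
      then show ?thesis using g by simp
    qed
  qed
  show ?thesis
    unfolding zeta_def by (rule the_equality) (fact ex, erule un)
qed

lemma zeta_right: "Re s > - 1 \<Longrightarrow> s \<noteq> 1 \<Longrightarrow> zeta s = zeta1 s / (s - 1)"
  by (simp add: zeta_eq)

lemma zeta1_eq: "Re s > - 1 \<Longrightarrow> zeta1 s = (if s = 1 then 1 else (s - 1) * zeta s)"
  by (simp add: zeta_right)

lemma zeta_functional_equation:
  assumes "Re s < 0"
  shows "zeta s = of_real pi powr (s - 1 / 2) * Gamma ((1 - s) / 2) * rGamma (s / 2) * zeta (1 - s)"
proof -
  have "zeta s = zeta_left s"
    using assms functional_equation_strip[of s] by (auto simp: zeta_eq)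
  moreover have "zeta (1 - s) = zeta1 (1 - s) / (- s)"
    using assms by (subst zeta_right) auto
  ultimately show ?thesis by (simp add: zeta_left_def)
qed

lemma zeta_Dirichlet: "Re s > 1 \<Longrightarrow> (\<lambda>n. of_nat (Suc n) powr (- s)) sums zeta s"
  using zeta1_Dirichlet[of s] by (subst zeta_right) auto

lemma trap_cnj: "trap n (cnj s) = cnj (trap n s)" if "n \<ge> 1"
proof -
  let ?f = "\<lambda>u. complex_of_real (u * (1 - u) / 2) * of_real (real n + u) powr (- s - 2)"
  have "(?f has_integral trap n s) {0..1}" unfolding trap_def
    by (intro integrable_integral integrable_continuous_real trap_integrand_continuous that)
  then have "((cnj \<circ> ?f) has_integral cnj (trap n s)) {0..1}"
    by (rule has_integral_linear) (rule bounded_linear_cnj)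
  moreover have "(cnj \<circ> ?f) u = complex_of_real (u * (1 - u) / 2) * of_real (real n + u) powr (- cnj s - 2)" if "u \<in> {0..1}" for u
    using that cnj_powr[of "complex_of_real (real n + u)" "- s - 2"] by (simp add: complex_is_Real_iff)
  ultimately have "((\<lambda>u. complex_of_real (u * (1 - u) / 2) * of_real (real n + u) powr (- cnj s - 2)) has_integral cnj (trap n s)) {0..1}"
    by (rule has_integral_eq[rotated])
  then show ?thesis unfolding trap_def by (rule integral_unique)
qed

text \<open>Carries lower bounds from the upper to the lower half-plane.\<close>

lemma zeta1_cnj:
  assumes "Re s > - 1"
  shows "zeta1 (cnj s) = cnj (zeta1 s)"
proof -
  have "(\<lambda>n. cnj (trap (Suc n) s)) sums cnj (trap_sum s)"
    unfolding trap_sum_def by (subst sums_cnj) (rule summable_sums[OF summable_trap[OF assms]])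
  moreover have "(\<lambda>n. cnj (trap (Suc n) s)) = (\<lambda>n. trap (Suc n) (cnj s))" by (simp add: trap_cnj)
  ultimately have "trap_sum (cnj s) = cnj (trap_sum s)"
    unfolding trap_sum_def[of "cnj s"] using sums_unique by metis
  then show ?thesis by (simp add: zeta1_def)
qed

lemma zeta_0: "zeta 0 = - 1 / 2"
  by (subst zeta_right) (auto simp: zeta1_def)

text \<open>A zero at 1/2 would force \<open>trap_sum (1 / 2)\<close> to be 2, far above its bound
  (1/8) (pi^2 / 6). Hence 1/2 is a pole of the quotient distinct from all zeros of zeta.\<close>

lemma zeta_half_nonzero: "zeta (1 / 2) \<noteq> 0"
proof
  assume z: "zeta (1 / 2) = 0"
  have "norm (trap_sum (1 / 2)) \<le> (\<Sum>n. 1 / 8 * (1 / real ((n + 1)\<^sup>2)))"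
    unfolding trap_sum_def
  proof (rule norm_suminf_le)
    show "summable (\<lambda>n. 1 / 8 * (1 / real ((n + 1)\<^sup>2)))"
      by (intro summable_mult sums_summable[OF inverse_squares_sums])
    fix n
    \<comment> \<open>The exponent for \<sigma> = 0 suffices although Re s is 1/2; it makes the
      majorant a multiple of the series of 1/n^2.\<close>
    have "norm (trap (Suc n) (1 / 2)) \<le> 1 / 8 * real (Suc n) powr (- 0 - 2)" by (rule norm_trap_le_eighth) auto
    also have "real (Suc n) powr (- 0 - 2) = 1 / real ((n + 1)\<^sup>2)" by (simp add: powr_minus divide_inverse add.commute)
    finally show "norm (trap (Suc n) (1 / 2)) \<le> 1 / 8 * (1 / real ((n + 1)\<^sup>2))" .
  qed
  also have "(\<Sum>n. 1 / 8 * (1 / real ((n + 1)\<^sup>2))) = 1 / 8 * (pi\<^sup>2 / 6)"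
    by (intro sums_unique[symmetric] sums_mult inverse_squares_sums)
  also have "\<dots> \<le> 1 / 8 * (4\<^sup>2 / 6)" using pi_less_4 by (intro mult_left_mono divide_right_mono power_mono) auto
  finally have b: "norm (trap_sum (1 / 2)) \<le> 1 / 3" by simp
  have "zeta1 (1 / 2) = 0" using z by (subst zeta1_eq) auto
  then have "3 / 4 - (3 / 8) * trap_sum (1 / 2) = 0" by (simp add: zeta1_def algebra_simps)
  then have "trap_sum (1 / 2) = 2" by (simp add: algebra_simps)
  then show False using b by simp
qed

section \<open>Dirichlet series of the Liouville function and of the coefficients c\<close>

abbreviation norm_summable_on :: "('a \<Rightarrow> complex) \<Rightarrow> 'a set \<Rightarrow> bool" (infix "norm'_summable'_on" 46) where
  "f norm_summable_on A \<equiv> (\<lambda>x. norm (f x)) summable_on A"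

lemma norm_summable_product:
  fixes a :: "'a \<Rightarrow> complex" and b :: "'b \<Rightarrow> complex"
  assumes "a norm_summable_on S" "b norm_summable_on T"
  shows "(\<lambda>(x, y). a x * b y) norm_summable_on (S \<times> T)"
  unfolding Infinite_Sum.abs_summable_on_Sigma_iff
proof (intro conjI ballI)
  fix x
  show "(\<lambda>y. case (x, y) of (x, y) \<Rightarrow> a x * b y) norm_summable_on T"
    unfolding prod.case norm_mult by (rule summable_on_cmult_right[OF assms(2)])
next
  have "(\<lambda>x. norm (a x) * infsum (\<lambda>y. norm (b y)) T) summable_on S"
    by (rule summable_on_cmult_left[OF assms(1)])
  moreover have "norm (infsum (\<lambda>y. norm (case (x, y) of (x, y) \<Rightarrow> a x * b y)) T) = norm (a x) * infsum (\<lambda>y. norm (b y)) T" for x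
    by (simp add: norm_mult infsum_cmult_right' infsum_nonneg abs_mult)
  ultimately show "(\<lambda>x. norm (infsum (\<lambda>y. norm (case (x, y) of (x, y) \<Rightarrow> a x * b y)) T)) summable_on S"
    by (simp only:)
qed

lemma has_sum_product:
  fixes a :: "'a \<Rightarrow> complex" and b :: "'b \<Rightarrow> complex"
  assumes "a norm_summable_on S" "b norm_summable_on T" "(a has_sum A) S" "(b has_sum B) T"
  shows "((\<lambda>(x, y). a x * b y) has_sum (A * B)) (S \<times> T)"
proof (rule has_sum_SigmaI)
  show "((\<lambda>y. case (x, y) of (x, y) \<Rightarrow> a x * b y) has_sum a x * B) T" for x
    unfolding prod.case by (rule has_sum_cmult_right[OF assms(4)])
  show "((\<lambda>x. a x * B) has_sum A * B) S"
    by (rule has_sum_cmult_left[OF assms(3)])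
  show "(\<lambda>(x, y). a x * b y) summable_on S \<times> T"
    by (rule Infinite_Sum.abs_summable_summable[OF norm_summable_product[OF assms(1,2)]])
qed

lemma summable_Suc_iff_norm_summable:
  fixes f :: "nat \<Rightarrow> complex"
  shows "f norm_summable_on {0<..} \<longleftrightarrow> summable (\<lambda>n. norm (f (Suc n)))"
proof -
  have "{0<..} = Suc ` UNIV" by (auto simp: image_iff gr0_conv_Suc)
  then have "f norm_summable_on {0<..} \<longleftrightarrow> ((\<lambda>n. norm (f n)) \<circ> Suc) summable_on UNIV"
    by (simp add: summable_on_reindex)
  also have "\<dots> \<longleftrightarrow> summable (\<lambda>n. norm (f (Suc n)))"
    using norm_summable_imp_summable_on[of "\<lambda>n. norm (f (Suc n))"]
    by (auto simp: o_def dest: summable_on_imp_summable)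
  finally show ?thesis .
qed

lemma has_sum_Suc_imp_sums:
  fixes f :: "nat \<Rightarrow> complex"
  assumes "(f has_sum S) {0<..}"
  shows "(\<lambda>n. f (Suc n)) sums S"
proof -
  have "{0<..} = Suc ` UNIV" by (auto simp: image_iff gr0_conv_Suc)
  then have "((f \<circ> Suc) has_sum S) UNIV" using assms by (simp add: has_sum_reindex)
  then show ?thesis by (simp add: o_def has_sum_imp_sums)
qed

lemma nat_powr_mult:
  "(of_nat (m * k) powr z :: complex) = of_nat m powr z * of_nat k powr z"
  by (simp add: powr_times_real)

lemma norm_nat_powr: "n > 0 \<Longrightarrow> norm (of_nat n powr z :: complex) = real n powr Re z"
  using norm_powr_real_powr[of "of_nat n" z] by simp

lemma norm_summable_nat_powr:
  assumes "Re s > 1"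
  shows "(\<lambda>n. of_nat n powr (- s) :: complex) norm_summable_on {0<..}"
  unfolding summable_Suc_iff_norm_summable
  using summable_powr_Suc[of "- Re s"] assms by (simp add: norm_nat_powr del: of_nat_Suc)

lemma zeta_has_sum:
  assumes "Re s > 1"
  shows "((\<lambda>n. of_nat n powr (- s)) has_sum zeta s) {0<..}"
proof -
  have "((\<lambda>n. of_nat n powr (- s)) has_sum (infsum (\<lambda>n. of_nat n powr (- s)) {0<..})) {0<..}"
    by (rule has_sum_infsum[OF Infinite_Sum.abs_summable_summable[OF norm_summable_nat_powr[OF assms]]])
  moreover from has_sum_Suc_imp_sums[OF this] have "infsum (\<lambda>n. of_nat n powr (- s)) {0<..} = zeta s"
    using zeta_Dirichlet[OF assms] sums_unique2 by blast
  ultimately show ?thesis by simp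
qed

section \<open>Moebius inversion\<close>

lemma squarefree_nat_pos:
  fixes n :: nat
  assumes "squarefree n"
  shows "n > 0"
proof (rule Nat.gr0I)
  assume "n = 0"
  then have "2\<^sup>2 dvd n" by simp
  then have "is_unit (2 :: nat)" using assms unfolding squarefree_def by blast
  then show False by simp
qed

lemma norm_moebius_le: "norm (of_int (moebius n) :: complex) \<le> 1"
  by (simp add: moebius_def norm_power)

lemma norm_summable_moebius:
  assumes "Re s > 1"
  shows "(\<lambda>n. of_int (moebius n) * of_nat n powr (- s) :: complex) norm_summable_on A \<inter> {0<..}"
proof (rule Infinite_Sum.abs_summable_on_comparison_test[of "\<lambda>n. of_nat n powr (- s) :: complex"])
  show "(\<lambda>n. of_nat n powr (- s) :: complex) norm_summable_on A \<inter> {0<..}"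
    by (rule summable_on_subset_banach[OF norm_summable_nat_powr[OF assms]]) auto
  show "norm (of_int (moebius n) * of_nat n powr (- s) :: complex) \<le> norm (of_nat n powr (- s) :: complex)" for n
    unfolding norm_mult using mult_right_mono[OF norm_moebius_le[of n]] by simp
qed

lemma moebius_mult_prime:
  fixes p d :: nat
  assumes p: "prime p" and d: "squarefree d" "\<not> p dvd d"
  shows "squarefree (p * d)" "moebius (p * d) = - moebius d"
proof -
  have cop: "coprime p d" using p d(2) by (simp add: prime_imp_coprime)
  have d0: "d \<noteq> 0" using d(1) squarefree_nat_pos by blast
  show sq: "squarefree (p * d)"
    by (rule squarefree_mult_coprime[OF cop squarefree_prime[OF p] d(1)])
  have "prime_factors (p * d) = insert p (prime_factors d)"
    using p d0 by (subst prime_factorization_mult) (auto simp: prime_factorization_prime prime_gt_0_nat)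
  moreover have "p \<notin> prime_factors d" using d(2) by (auto dest: in_prime_factors_imp_dvd)
  ultimately show "moebius (p * d) = - moebius d"
    using sq d(1) by (simp add: moebius_def)
qed

text \<open>For a prime p dividing n, multiplication by p pairs the squarefree divisors not
  divisible by p with those divisible by p, and it flips the sign.\<close>

lemma sum_moebius_divisors:
  assumes "n > 0"
  shows "(\<Sum>d | d dvd n. moebius d) = (if n = 1 then 1 else 0)"
proof (cases "n = 1")
  case False
  then obtain p where p: "prime p" "p dvd n" by (metis prime_factor_nat)
  define A where "A = {d. d dvd n \<and> squarefree d \<and> \<not> p dvd d}"
  define B where "B = {d. d dvd n \<and> squarefree d \<and> p dvd d}"
  have fin: "finite {d. d dvd n}" using assms by (intro finite_divisors_nat)
  have finAB: "finite A" "finite B" by (rule finite_subset[OF _ fin]; auto simp: A_def B_def)+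
  have "(\<Sum>d | d dvd n. moebius d) = (\<Sum>d\<in>A \<union> B. moebius d)"
    by (rule sum.mono_neutral_right[OF fin]) (auto simp: A_def B_def moebius_def)
  also have "\<dots> = (\<Sum>d\<in>A. moebius d) + (\<Sum>d\<in>B. moebius d)"
    by (rule sum.union_disjoint[OF finAB]) (auto simp: A_def B_def)
  also have "B = (*) p ` A"
  proof (intro set_eqI iffI)
    fix d assume d: "d \<in> B"
    then obtain e where e: "d = p * e" by (auto simp: B_def)
    have "\<not> p dvd e"
    proof
      assume "p dvd e"
      then have "p\<^sup>2 dvd d" by (simp add: e power2_eq_square)
      then have "is_unit p" using d by (auto simp: B_def squarefree_def)
      then show False using p by auto
    qed
    moreover have "squarefree e" "e dvd n"
      using d e squarefree_multD(2)[of p e] dvd_mult_right[of p e n] by (auto simp: B_def)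
    ultimately show "d \<in> (*) p ` A" using e by (auto simp: A_def)
  next
    fix d assume "d \<in> (*) p ` A"
    then obtain e where e: "d = p * e" "e \<in> A" by blast
    then have "coprime p e" using p by (simp add: A_def prime_imp_coprime)
    then have "p * e dvd n" using p e by (intro divides_mult) (auto simp: A_def)
    then show "d \<in> B" using e moebius_mult_prime(1)[OF p(1), of e] by (auto simp: A_def B_def)
  qed
  also have "(\<Sum>d\<in>(*) p ` A. moebius d) = (\<Sum>d\<in>A. moebius (p * d))"
    using p by (subst sum.reindex) (auto simp: inj_on_def)
  also have "\<dots> = (\<Sum>d\<in>A. - moebius d)"
    using moebius_mult_prime(2)[OF p(1)] by (intro sum.cong) (auto simp: A_def)
  finally show ?thesis using False by (simp add: sum_negf)
qed (simp add: moebius_def)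

text \<open>The product of the series is an absolutely convergent sum over pairs (m, k); grouping it
  by n = m k leaves the divisor sums of \<open>moebius\<close>.\<close>

lemma zeta_moebius:
  assumes s: "Re s > 1"
  shows "zeta s * (\<Sum>\<^sub>\<infinity>k\<in>{0<..}. of_int (moebius k) * of_nat k powr (- s)) = 1"
proof -
  define M where "M = (\<Sum>\<^sub>\<infinity>k\<in>{0<..}. of_int (moebius k) * of_nat k powr (- s) :: complex)"
  have absM: "(\<lambda>n. of_int (moebius n) * of_nat n powr (- s) :: complex) norm_summable_on {0<..}"
    using norm_summable_moebius[OF s, of UNIV] unfolding Int_UNIV_left .
  have hM: "((\<lambda>n. of_int (moebius n) * of_nat n powr (- s) :: complex) has_sum M) {0<..}"
    unfolding M_def by (rule has_sum_infsum[OF Infinite_Sum.abs_summable_summable[OF absM]])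
  have "((\<lambda>(m, k). of_nat m powr (- s) * (of_int (moebius k) * of_nat k powr (- s))) has_sum (zeta s * M)) ({0<..} \<times> {0<..})"
    by (rule has_sum_product[OF norm_summable_nat_powr[OF s] absM zeta_has_sum[OF s] hM])
  also have "?this \<longleftrightarrow> ((\<lambda>(n, k). of_int (moebius k) * of_nat n powr (- s)) has_sum (zeta s * M)) (Sigma {0<..} (\<lambda>n. {k. k dvd n}))"
  proof (rule has_sum_reindex_bij_witness[where j = "\<lambda>(m, k). (m * k, k)" and i = "\<lambda>(n, k). (n div k, k)"])
    fix x :: "nat \<times> nat" assume x: "x \<in> {0<..} \<times> {0<..}"
    obtain m k where mk: "x = (m, k)" "m > 0" "k > 0" using x by (cases x) auto
    show "(case case x of (m, k) \<Rightarrow> (m * k, k) of (n, k) \<Rightarrow> (n div k, k)) = x" using mk by simp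
    show "(case x of (m, k) \<Rightarrow> (m * k, k)) \<in> Sigma {0<..} (\<lambda>n. {k. k dvd n})" using mk by simp
    show "(case case x of (m, k) \<Rightarrow> (m * k, k) of (n, k) \<Rightarrow> of_int (moebius k) * of_nat n powr (- s)) =
        (case x of (m, k) \<Rightarrow> of_nat m powr (- s) * (of_int (moebius k) * of_nat k powr (- s)))"
      using mk by (simp only: prod.case nat_powr_mult mult.left_commute)
  next
    fix x :: "nat \<times> nat" assume x: "x \<in> Sigma {0<..} (\<lambda>n. {k. k dvd n})"
    obtain n k where nk: "x = (n, k)" "n > 0" "k dvd n" using x by (cases x) auto
    show "(case case x of (n, k) \<Rightarrow> (n div k, k) of (m, k) \<Rightarrow> (m * k, k)) = x" using nk by simp
    have "k > 0" "n div k > 0" using nk by (auto intro!: Nat.gr0I simp: dvd_div_eq_0_iff)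
    then show "(case x of (n, k) \<Rightarrow> (n div k, k)) \<in> {0<..} \<times> {0<..}" using nk by simp
  qed (rule refl)
  finally have "((\<lambda>n. of_int (if n = 1 then 1 else 0) * of_nat n powr (- s)) has_sum (zeta s * M)) {0<..}"
  proof (rule has_sum_SigmaD)
    fix n :: nat assume n: "n \<in> {0<..}"
    have "((\<lambda>k. of_int (moebius k) * of_nat n powr (- s)) has_sum (\<Sum>k | k dvd n. of_int (moebius k) * of_nat n powr (- s))) {k. k dvd n}"
      using n by (intro has_sum_finite finite_divisors_nat) auto
    also have "(\<Sum>k | k dvd n. of_int (moebius k) * of_nat n powr (- s)) = of_int (\<Sum>k | k dvd n. moebius k) * of_nat n powr (- s)"
      by (simp add: sum_distrib_right)
    also have "(\<Sum>k | k dvd n. moebius k) = (if n = 1 then 1 else 0)"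
      using n by (intro sum_moebius_divisors) simp
    finally show "((\<lambda>k. case (n, k) of (n, k) \<Rightarrow> of_int (moebius k) * of_nat n powr (- s)) has_sum of_int (if n = 1 then 1 else 0) * of_nat n powr (- s)) {k. k dvd n}"
      unfolding prod.case .
  qed
  also have "?this \<longleftrightarrow> ((\<lambda>n. 1 :: complex) has_sum (zeta s * M)) {1 :: nat}"
    by (rule has_sum_cong_neutral) auto
  finally have "zeta s * M = 1"
    using has_sum_unique[OF _ has_sum_finite[of "{1 :: nat}" "\<lambda>n. 1 :: complex"]] by simp
  then show ?thesis by (simp add: M_def)
qed

lemma zeta_nonzero: "Re s > 1 \<Longrightarrow> zeta s \<noteq> 0"
  using zeta_moebius[of s] by auto

lemma moebius_has_sum:
  assumes s: "Re s > 1"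
  shows "((\<lambda>k. of_int (moebius k) * of_nat k powr (- s)) has_sum (1 / zeta s)) {k. squarefree k}"
proof -
  have "((\<lambda>k. of_int (moebius k) * of_nat k powr (- s) :: complex) has_sum (\<Sum>\<^sub>\<infinity>k\<in>{0<..}. of_int (moebius k) * of_nat k powr (- s))) {0<..}"
    using norm_summable_moebius[OF s, of UNIV] unfolding Int_UNIV_left
    by (rule has_sum_infsum[OF Infinite_Sum.abs_summable_summable])
  also have "(\<Sum>\<^sub>\<infinity>k\<in>{0<..}. of_int (moebius k) * of_nat k powr (- s)) = 1 / zeta s"
    using zeta_moebius[OF s] by (metis nonzero_eq_divide_eq zeta_nonzero[OF s] mult.commute)
  also have "((\<lambda>k. of_int (moebius k) * of_nat k powr (- s) :: complex) has_sum (1 / zeta s)) {0<..} \<longleftrightarrow>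
      ((\<lambda>k. of_int (moebius k) * of_nat k powr (- s) :: complex) has_sum (1 / zeta s)) {k. squarefree k}"
  proof (rule has_sum_cong_neutral)
    fix k :: nat
    show "of_int (moebius k) * of_nat k powr (- s) = (0 :: complex)" if "k \<in> {k. squarefree k} - {0<..}"
      using that squarefree_nat_pos[of k] by blast
    show "of_int (moebius k) * of_nat k powr (- s) = (0 :: complex)" if "k \<in> {0<..} - {k. squarefree k}"
      using that by (simp add: moebius_def)
  qed (rule refl)
  finally show ?thesis .
qed

section \<open>The decomposition n = m^2 k and the two Dirichlet series\<close>

text \<open>Multiplicities of a squarefree k are at most 1, so halving those of m^2 k, rounded down,
  recovers m. This makes the reindexing by (m, k) a bijection.\<close>

lemma square_part_mult_squarefree:
  fixes m k :: nat
  assumes m: "m > 0" and k: "squarefree k"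
  shows "square_part (m\<^sup>2 * k) = m" "squarefree_part (m\<^sup>2 * k) = k"
proof -
  have k0: "k \<noteq> 0" using k squarefree_nat_pos by blast
  have "multiplicity p (square_part (m\<^sup>2 * k)) = multiplicity p m" if p: "prime p" for p
  proof -
    have "multiplicity p k \<le> 1" using k p k0 by (simp add: squarefree_factorial_semiring'')
    then show ?thesis
      using m k0 p by (simp add: prime_multiplicity_square_part prime_elem_multiplicity_mult_distrib prime_elem_multiplicity_power_distrib)
  qed
  then have "normalize (square_part (m\<^sup>2 * k)) = normalize m"
    using m k0 by (intro multiplicity_eq_imp_eq) auto
  then show 1: "square_part (m\<^sup>2 * k) = m" by simp
  show "squarefree_part (m\<^sup>2 * k) = k"
    using m k0 by (simp add: squarefree_part_def 1)
qed

text \<open>The square contributes an even number of prime factors, and in a squarefree number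
  counting with or without multiplicity is the same.\<close>

lemma liouville_mult_square:
  fixes m k :: nat
  assumes m: "m > 0" and k: "squarefree k"
  shows "liouville (m\<^sup>2 * k) = moebius k"
proof -
  have k0: "k \<noteq> 0" using k squarefree_nat_pos by blast
  have "size (prime_factorization k) = (\<Sum>p\<in>prime_factors k. count (prime_factorization k) p)"
    by (simp add: size_multiset_overloaded_eq)
  also have "\<dots> = (\<Sum>p\<in>prime_factors k. 1)"
  proof (intro sum.cong refl)
    fix p assume p: "p \<in> prime_factors k"
    then have "count (prime_factorization k) p > 0" by simp
    moreover have "count (prime_factorization k) p \<le> 1"
      using p k k0 by (auto simp: count_prime_factorization squarefree_factorial_semiring'' dest: in_prime_factors_imp_prime)
    ultimately show "count (prime_factorization k) p = 1" by linarith
  qed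
  finally have "size (prime_factorization k) = card (prime_factors k)" by simp
  moreover have "size (prime_factorization (m\<^sup>2 * k)) = 2 * size (prime_factorization m) + size (prime_factorization k)"
    using m k0 by (simp add: prime_factorization_mult power2_eq_square)
  ultimately show ?thesis using k by (simp add: liouville_def moebius_def power_add)
qed

text \<open>The unique decomposition n = m^2 k splits the series into one over m and the
  \<open>moebius\<close> series of 1 / zeta(s). Taking g m = m^(-2 s) yields the Liouville function,
  g m = m^(1 - 2 s) yields \<open>c_coeff\<close>.\<close>

lemma square_decomposition_Dirichlet:
  fixes g :: "nat \<Rightarrow> complex" and f :: "nat \<Rightarrow> int"
  assumes s: "Re s > 1" and g: "g norm_summable_on {0<..}" "(g has_sum G) {0<..}"
    and f: "\<And>m k. m > 0 \<Longrightarrow> squarefree k \<Longrightarrow> of_int (f (m\<^sup>2 * k)) * of_nat (m\<^sup>2 * k) powr (- s) = g m * (of_int (moebius k) * of_nat k powr (- s))"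
  shows "(\<lambda>n. of_int (f (Suc n)) * of_nat (Suc n) powr (- s)) sums (G / zeta s)"
    and "summable (\<lambda>n. norm (of_int (f (Suc n)) * of_nat (Suc n) powr (- s) :: complex))"
proof -
  let ?F = "\<lambda>n. of_int (f n) * of_nat n powr (- s) :: complex"
  let ?P = "\<lambda>(m, k). g m * (of_int (moebius k) * of_nat k powr (- s))"
  have sub: "{k :: nat. squarefree k} \<inter> {0<..} = {k. squarefree k}"
    using squarefree_nat_pos by blast
  have absM: "(\<lambda>n. of_int (moebius n) * of_nat n powr (- s) :: complex) norm_summable_on {k. squarefree k}"
    using norm_summable_moebius[OF s, of "{k. squarefree k}"] unfolding sub .
  have bij: "bij_betw (\<lambda>(m, k). m\<^sup>2 * k) ({0<..} \<times> {k :: nat. squarefree k}) {0<..}"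
  proof (rule bij_betwI[where g = "\<lambda>n. (square_part n, squarefree_part n)"])
    show "(\<lambda>n. (square_part n, squarefree_part n)) \<in> {0<..} \<rightarrow> {0<..} \<times> {k :: nat. squarefree k}"
      by (auto intro!: Nat.gr0I)
    show "(\<lambda>(m, k). m\<^sup>2 * k) \<in> {0<..} \<times> {k :: nat. squarefree k} \<rightarrow> {0<..}"
    proof (intro Pi_I)
      fix x :: "nat \<times> nat" assume x: "x \<in> {0<..} \<times> {k. squarefree k}"
      then obtain m k where "x = (m, k)" "m > 0" "k > 0" using squarefree_nat_pos by blast
      then show "(case x of (m, k) \<Rightarrow> m\<^sup>2 * k) \<in> {0<..}" by simp
    qed
    show "(case (square_part n, squarefree_part n) of (m, k) \<Rightarrow> m\<^sup>2 * k) = n" for n :: nat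
      using squarefree_decompose[of n] by (simp add: mult.commute)
    show "(\<lambda>n. (square_part n, squarefree_part n)) (case x of (m, k) \<Rightarrow> m\<^sup>2 * k) = x"
      if "x \<in> {0<..} \<times> {k :: nat. squarefree k}" for x
      using that by (cases x) (simp add: square_part_mult_squarefree)
  qed
  have eq: "?F (case x of (m, k) \<Rightarrow> m\<^sup>2 * k) = ?P x" if xin: "x \<in> {0<..} \<times> {k. squarefree k}" for x
  proof -
    obtain m k where x: "x = (m, k)" "m > 0" "squarefree k" using xin by (cases x) auto
    show ?thesis unfolding x(1) prod.case by (rule f[OF x(2,3)])
  qed
  have "(?P has_sum (G * (1 / zeta s))) ({0<..} \<times> {k. squarefree k})"
    by (rule has_sum_product[OF g(1) absM g(2) moebius_has_sum[OF s]])
  then have "((\<lambda>x. ?F (case x of (m, k) \<Rightarrow> m\<^sup>2 * k)) has_sum (G * (1 / zeta s))) ({0<..} \<times> {k. squarefree k})"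
    by (subst has_sum_cong[OF eq])
  then have "(?F has_sum (G * (1 / zeta s))) {0<..}"
    using has_sum_reindex_bij_betw[OF bij, of ?F "G * (1 / zeta s)"] by blast
  from has_sum_Suc_imp_sums[OF this] show "(\<lambda>n. ?F (Suc n)) sums (G / zeta s)" by simp
  have "?P norm_summable_on ({0<..} \<times> {k. squarefree k})"
    by (rule norm_summable_product[OF g(1) absM])
  moreover have "norm (?F (case x of (m, k) \<Rightarrow> m\<^sup>2 * k)) = norm (?P x)" if "x \<in> {0<..} \<times> {k. squarefree k}" for x
    by (rule arg_cong[OF eq[OF that]])
  ultimately have "(\<lambda>x. norm (?F (case x of (m, k) \<Rightarrow> m\<^sup>2 * k))) summable_on ({0<..} \<times> {k. squarefree k})"
    by (subst summable_on_cong[where g = "\<lambda>x. norm (?P x)"]) assumption+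
  then have "(\<lambda>n. norm (?F n)) summable_on {0<..}"
    using summable_on_reindex_bij_betw[OF bij, of "\<lambda>n. norm (?F n)"] by blast
  then show "summable (\<lambda>n. norm (?F (Suc n)))"
    unfolding summable_Suc_iff_norm_summable .
qed

lemma liouville_Dirichlet:
  assumes s: "Re s > 1"
  shows "(\<lambda>n. of_int (liouville (Suc n)) * of_nat (Suc n) powr (- s)) sums (zeta (2 * s) / zeta s)"
proof (rule square_decomposition_Dirichlet(1)[OF s])
  show "(\<lambda>n. of_nat n powr (- (2 * s)) :: complex) norm_summable_on {0<..}"
    by (rule norm_summable_nat_powr) (use s in simp)
  show "((\<lambda>n. of_nat n powr (- (2 * s)) :: complex) has_sum zeta (2 * s)) {0<..}"
    by (rule zeta_has_sum) (use s in simp)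
  fix m k :: nat assume mk: "m > 0" "squarefree k"
  have eq: "(of_nat m powr (- (2 * s)) :: complex) = of_nat m powr (- s) * of_nat m powr (- s)"
    by (simp flip: powr_add)
  show "of_int (liouville (m\<^sup>2 * k)) * of_nat (m\<^sup>2 * k) powr (- s) =
      of_nat m powr (- (2 * s)) * (of_int (moebius k) * of_nat k powr (- s) :: complex)"
    unfolding liouville_mult_square[OF mk] eq unfolding power2_eq_square nat_powr_mult by (simp only: mult_ac)
qed

lemma c_coeff_Dirichlet:
  assumes s: "Re s > 1"
  shows "(\<lambda>n. of_int (c_coeff (Suc n)) * of_nat (Suc n) powr (- s)) sums (zeta (2 * s - 1) / zeta s)" (is ?A)
    and "summable (\<lambda>n. norm (of_int (c_coeff (Suc n)) * of_nat (Suc n) powr (- s) :: complex))" (is ?B)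
proof -
  have 1: "(\<lambda>n. of_nat n powr (- (2 * s - 1)) :: complex) norm_summable_on {0<..}"
    by (rule norm_summable_nat_powr) (use s in simp)
  have 2: "((\<lambda>n. of_nat n powr (- (2 * s - 1)) :: complex) has_sum zeta (2 * s - 1)) {0<..}"
    by (rule zeta_has_sum) (use s in simp)
  have 3: "of_int (c_coeff (m\<^sup>2 * k)) * of_nat (m\<^sup>2 * k) powr (- s) =
      of_nat m powr (- (2 * s - 1)) * (of_int (moebius k) * of_nat k powr (- s) :: complex)" if mk: "m > 0" "squarefree k" for m k
  proof -
    have e: "- (2 * s - 1) = 1 + (- s + - s)" by simp
    have eq: "(of_nat m powr (- (2 * s - 1)) :: complex) = of_nat m * (of_nat m powr (- s) * of_nat m powr (- s))"
      unfolding e powr_add by simp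
    show ?thesis
      unfolding c_coeff_def square_part_mult_squarefree[OF mk] eq
      unfolding power2_eq_square nat_powr_mult of_int_mult of_int_of_nat_eq by (simp only: mult_ac)
  qed
  show ?A by (rule square_decomposition_Dirichlet(1)[OF s 1 2 3])
  show ?B by (rule square_decomposition_Dirichlet(2)[OF s 1 2 3])
qed

section \<open>Lower bounds for zeta on horizontal lines\<close>

text \<open>Every point of \<open>Z\<close> is divided out once, whatever its multiplicity;
  \<open>g\<close> may still vanish there.\<close>

lemma factor_out_zeros:
  assumes "finite Z" "open S" "f holomorphic_on S" "Z \<subseteq> S" "\<And>a. a \<in> Z \<Longrightarrow> f a = (0::complex)"
  shows "\<exists>g. g holomorphic_on S \<and> (\<forall>z\<in>S. f z = (\<Prod>a\<in>Z. z - a) * g z)"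
  using assms(1,4,5)
proof (induction Z rule: finite_induct)
  case empty
  then show ?case using assms(3) by auto
next
  case (insert a Z)
  then obtain g where g: "g holomorphic_on S" "\<And>z. z \<in> S \<Longrightarrow> f z = (\<Prod>a\<in>Z. z - a) * g z"
    by auto
  have ga: "g a = 0"
  proof -
    have "(\<Prod>b\<in>Z. a - b) \<noteq> 0" using insert.hyps by (auto simp: prod_zero_iff)
    moreover have "(\<Prod>b\<in>Z. a - b) * g a = 0" using g(2)[of a] insert.prems by auto
    ultimately show ?thesis by simp
  qed
  define h where "h = (\<lambda>z. if z = a then deriv g a else (g z - g a) / (z - a))"
  have "h holomorphic_on S" unfolding h_def by (rule pole_lemma_open[OF g(1) assms(2)])
  moreover have "g z = (z - a) * h z" if "z \<in> S" for z
    using ga by (simp add: h_def)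
  then have "f z = (\<Prod>b\<in>insert a Z. z - b) * h z" if "z \<in> S" for z
    using g(2)[OF that] that insert.hyps by (simp add: mult_ac)
  ultimately show ?case by blast
qed

text \<open>Harnack's inequality for the positive harmonic function \<open>ln (M / \<bar>G\<bar>)\<close>.\<close>
lemma nonvanishing_lower_bound:
  fixes G :: "complex \<Rightarrow> complex"
  assumes \<rho>: "\<rho> > 0" and G: "G holomorphic_on ball 0 \<rho>" "\<And>z. z \<in> ball 0 \<rho> \<Longrightarrow> G z \<noteq> 0"
    "\<And>z. z \<in> ball 0 \<rho> \<Longrightarrow> norm (G z) < M"
    and z: "norm z < \<rho>"
  shows "norm (G z) \<ge> M * exp (- ((\<rho> + norm z) / (\<rho> - norm z)) * ln (M / norm (G 0)))"
proof -
  obtain h where h: "h holomorphic_on ball 0 \<rho>" "\<And>x. x \<in> ball 0 \<rho> \<Longrightarrow> exp (h x) = G x"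
    using holomorphic_logarithm_exists[OF convex_ball open_ball G(1,2), of 0] \<rho> by auto
  have M: "M > 0" using G(3)[of 0] \<rho> by (auto intro: le_less_trans[OF norm_ge_zero])
  \<comment> \<open>ln M minus a logarithm of G, rescaled to the unit disc: its real part is the
    positive harmonic function. The imaginary constant makes \<open>k 0\<close> real.\<close>
  define k where "k = (\<lambda>w. of_real (ln M) + \<i> * of_real (Im (h 0)) - h (of_real \<rho> * w))"
  define A where "A = ln (M / norm (G 0))"
  have in_ball: "of_real \<rho> * w \<in> ball 0 \<rho>" if "norm w < 1" for w :: complex
    using that \<rho> by (simp add: norm_mult)
  have Gh: "norm (G x) = exp (Re (h x))" if "x \<in> ball 0 \<rho>" for x
    using h(2)[OF that] by (metis norm_exp_eq_Re)
  have Re_k: "Re (k w) = ln (M / norm (G (of_real \<rho> * w)))" if "norm w < 1" for w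
    using Gh[OF in_ball[OF that]] M by (simp add: k_def ln_div)
  have Re_pos: "Re (k w) > 0" if "norm w < 1" for w
    using G(2,3)[OF in_ball[OF that]] M unfolding Re_k[OF that] by (intro ln_gt_zero) simp
  have k0: "k 0 = of_real A"
    using Re_k[of 0] by (simp add: complex_eq_iff A_def) (simp add: k_def)
  have A: "A > 0" using Re_pos[of 0] k0 by simp
  have kA: "k w + of_real A \<noteq> 0" if "norm w < 1" for w
    using Re_pos[OF that] A by (auto simp: complex_eq_iff)
  \<comment> \<open>The Cayley transform of the right half-plane that sends A to 0, so that the
    Schwarz lemma applies.\<close>
  define \<phi> where "\<phi> = (\<lambda>w. (k w - of_real A) / (k w + of_real A))"
  have "(\<lambda>w. h (of_real \<rho> * w)) holomorphic_on ball 0 1"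
    using in_ball by (intro holomorphic_on_compose_gen[OF _ h(1), unfolded o_def] holomorphic_intros) auto
  then have hol: "\<phi> holomorphic_on ball 0 1"
    unfolding \<phi>_def using kA unfolding k_def by (intro holomorphic_intros) auto
  have lt1: "norm (\<phi> w) < 1" if "norm w < 1" for w
  proof -
    have "(norm (k w + of_real A))\<^sup>2 - (norm (k w - of_real A))\<^sup>2 = 4 * (A * Re (k w))"
      by (simp add: cmod_power2) (simp add: power2_eq_square algebra_simps)
    then have "(norm (k w - of_real A))\<^sup>2 < (norm (k w + of_real A))\<^sup>2"
      using mult_pos_pos[OF A Re_pos[OF that]] by linarith
    then have "norm (k w - of_real A) < norm (k w + of_real A)"
      by (rule power_less_imp_less_base) simp
    then show ?thesis using kA[OF that] by (simp add: \<phi>_def norm_divide)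
  qed
  define w where "w = z / of_real \<rho>"
  define q where "q = norm w"
  have w: "norm w < 1" "of_real \<rho> * w = z" using z \<rho> by (simp_all add: w_def norm_divide)
  have q: "q < 1" "0 \<le> q" using w by (simp_all add: q_def)
  have "norm (\<phi> w) \<le> norm w"
    by (rule Schwarz_Lemma(1)[OF hol _ lt1 w(1)]) (simp_all add: \<phi>_def k0)
  then have "norm (k w - of_real A) \<le> q * norm (k w + of_real A)"
    using kA[OF w(1)] by (simp add: \<phi>_def norm_divide divide_le_eq q_def)
  also have "\<dots> \<le> q * (norm (k w) + A)"
    using norm_triangle_ineq[of "k w" "of_real A"] A q by (intro mult_left_mono) auto
  finally have "norm (k w) - A \<le> q * (norm (k w) + A)"
    using norm_triangle_ineq2[of "k w" "of_real A"] A by simp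
  then have "norm (k w) * (1 - q) \<le> A * (1 + q)" by (simp add: algebra_simps)
  then have "norm (k w) \<le> A * (1 + q) / (1 - q)" using q by (simp add: pos_le_divide_eq)
  then have "Re (k w) \<le> A * (1 + q) / (1 - q)" using complex_Re_le_cmod[of "k w"] by linarith
  also have "A * (1 + q) / (1 - q) = (\<rho> + norm z) / (\<rho> - norm z) * A"
  proof -
    have nz: "norm z = \<rho> * q" using w(2) \<rho> by (auto simp: q_def norm_mult)
    have "\<rho> + norm z = \<rho> * (1 + q)" "\<rho> - norm z = \<rho> * (1 - q)" by (simp_all add: nz algebra_simps)
    then show ?thesis using \<rho> by simp
  qed
  finally have le: "ln (M / norm (G z)) \<le> (\<rho> + norm z) / (\<rho> - norm z) * A"
    unfolding Re_k[OF w(1)] w(2) .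
  have Gz: "norm (G z) > 0" using G(2)[of z] z by simp
  have "M / norm (G z) \<le> exp ((\<rho> + norm z) / (\<rho> - norm z) * A)"
    using le M Gz by (metis exp_le_cancel_iff exp_ln divide_pos_pos)
  then have "M \<le> norm (G z) * exp ((\<rho> + norm z) / (\<rho> - norm z) * A)"
    using Gz by (simp add: divide_le_eq mult.commute)
  then have "M * exp (- ((\<rho> + norm z) / (\<rho> - norm z) * A)) \<le> norm (G z)"
    by (simp add: exp_minus field_simps)
  then show ?thesis by (simp add: A_def)
qed

text \<open>On the circle R^2 is z times its conjugate, so z can be factored out.\<close>

lemma Blaschke_factor_norm:
  assumes "norm (z :: complex) = R"
  shows "norm (of_real (R\<^sup>2) - cnj a * z) = R * norm (z - a)"
proof -
  have "complex_of_real (R\<^sup>2) = z * cnj z" using complex_norm_square[of z] assms by simp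
  then have "of_real (R\<^sup>2) - cnj a * z = z * cnj (z - a)" by (simp add: algebra_simps)
  then show ?thesis by (simp only: norm_mult complex_mod_cnj assms)
qed

text \<open>Roles of the radii: the bound is wanted on r, the zeros are removed and Harnack is
  applied on r1, the Blaschke factors live on the circle R, and f is holomorphic up to R'. The zero
  count is Jensen's inequality.\<close>

lemma simple_zeros_lower_bound:
  fixes f :: "complex \<Rightarrow> complex"
  assumes R: "0 < r" "r < r1" "r1 < R" "R < R'"
    and f: "f holomorphic_on ball 0 R'" "f 0 \<noteq> 0" "\<And>z. norm z \<le> R \<Longrightarrow> norm (f z) \<le> M0" "M0 < M"
    and simple: "\<And>z. norm z \<le> r1 \<Longrightarrow> f z = 0 \<Longrightarrow> deriv f z \<noteq> 0"
  defines "Z \<equiv> {z. norm z \<le> r1 \<and> f z = 0}" and "L \<equiv> ln (M / norm (f 0))"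
  shows "finite Z" "real (card Z) * ln (R / r1) \<le> L"
    "\<And>z. norm z \<le> r \<Longrightarrow> norm (f z) \<ge> (\<Prod>a\<in>Z. norm (z - a) / (2 * R)) * (M * exp (- ((r1 + r) / (r1 - r)) * L))"
proof -
  have R0: "0 < r1" "0 < R" "0 < R'" using R by auto
  have sub: "cball 0 r1 \<subseteq> ball (0::complex) R'" using R by auto
  have Z': "Z = {z \<in> cball 0 r1. f z = 0}" by (auto simp: Z_def)
  have "\<not> f constant_on ball 0 R'" if "Z \<noteq> {}"
  proof -
    obtain a where "a \<in> Z" using \<open>Z \<noteq> {}\<close> by auto
    then have "f a = 0" "a \<in> ball 0 R'" using sub by (auto simp: Z')
    then show ?thesis using f(2) R0 unfolding constant_on_def by force
  qed
  then have fin: "finite Z"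
    using holomorphic_compact_finite_zeros[OF f(1) open_ball connected_ball compact_cball sub] unfolding Z'
    by (metis finite.emptyI)
  then show "finite Z" .
  have "Z \<subseteq> ball 0 R'" using sub by (auto simp: Z')
  then have "\<exists>g. g holomorphic_on ball 0 R' \<and> (\<forall>z\<in>ball 0 R'. f z = (\<Prod>a\<in>Z. z - a) * g z)"
    by (rule factor_out_zeros[OF fin open_ball f(1)]) (simp add: Z_def)
  then obtain g where g: "g holomorphic_on ball 0 R'" "\<And>z. z \<in> ball 0 R' \<Longrightarrow> f z = (\<Prod>a\<in>Z. z - a) * g z"
    by blast
  have Zr: "norm a \<le> r1" if "a \<in> Z" for a using that by (simp add: Z_def)
  \<comment> \<open>A zero of g here would be a multiple zero of f, against simplicity.\<close>
  have gnz: "g z \<noteq> 0" if z: "norm z \<le> r1" for z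
  proof
    assume g0: "g z = 0"
    have zin: "z \<in> ball 0 R'" using z R by simp
    then have fz: "f z = 0" using g(2) g0 by simp
    then have zZ: "z \<in> Z" using z by (simp add: Z_def)
    have dg: "(g has_field_derivative deriv g z) (at z)"
      by (rule holomorphic_derivI[OF g(1) open_ball zin])
    define p where "p = (\<lambda>w. \<Prod>a\<in>Z. w - a)"
    have "p holomorphic_on UNIV" unfolding p_def by (intro holomorphic_intros)
    then have dp: "(p has_field_derivative deriv p z) (at z)"
      by (rule holomorphic_derivI) auto
    have "((\<lambda>w. p w * g w) has_field_derivative deriv p z * g z + deriv g z * p z) (at z)"
      by (rule DERIV_mult[OF dp dg])
    moreover have "p z = 0" using fin zZ by (auto simp: p_def)
    ultimately have "((\<lambda>w. p w * g w) has_field_derivative 0) (at z)" by (simp add: g0)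
    then have "(f has_field_derivative 0) (at z)"
      by (rule has_field_derivative_transform_within_open[OF _ open_ball zin]) (simp add: g(2) p_def)
    then have "deriv f z = 0" by (rule DERIV_imp_deriv)
    then show False using simple[OF z fz] by simp
  qed
  define B where "B = (\<lambda>a z. (of_real (R\<^sup>2) - cnj a * z) / of_real R)"
  have Bnz: "B a z \<noteq> 0" if "a \<in> Z" "norm z \<le> R" for a z
  proof
    assume "B a z = 0"
    then have "of_real (R\<^sup>2) = cnj a * z" using R0 by (simp add: B_def)
    then have "norm (complex_of_real (R\<^sup>2)) = norm (cnj a * z)" by (simp only:)
    then have "R\<^sup>2 = norm a * norm z" by (simp only: norm_mult norm_of_real complex_mod_cnj abs_power2)
    also have "\<dots> \<le> r1 * R" using Zr[OF that(1)] that(2) R0 by (intro mult_mono) auto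
    also have "\<dots> < R\<^sup>2" using R R0 by (simp add: power2_eq_square)
    finally show False by simp
  qed
  have Ble: "norm (B a z) \<le> 2 * R" if "a \<in> Z" "norm z \<le> R" for a z
  proof -
    have "norm (of_real (R\<^sup>2) - cnj a * z) \<le> norm (complex_of_real (R\<^sup>2)) + norm (cnj a * z)" by (rule norm_triangle_ineq4)
    also have "\<dots> = R\<^sup>2 + norm a * norm z"
      by (simp only: norm_mult norm_of_real complex_mod_cnj abs_power2)
    also have "\<dots> \<le> R\<^sup>2 + R * R"
      using Zr[OF that(1)] that(2) R R0 by (intro add_mono mult_mono) auto
    finally show ?thesis using R0 by (simp add: B_def norm_divide divide_le_eq power2_eq_square)
  qed
  \<comment> \<open>g is multiplied by the Blaschke numerators instead of dividing f by Blaschke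
    factors, which avoids removable singularities. On |z| = R the norm of \<open>B a z\<close> is |z
    - a|, so |G| = |f| there.\<close>
  define G where "G = (\<lambda>z. g z * (\<Prod>a\<in>Z. B a z))"
  have holG: "G holomorphic_on ball 0 R'"
    unfolding G_def B_def using g(1) R0 by (intro holomorphic_intros) auto
  have Gsphere: "norm (G z) \<le> M0" if z: "norm z = R" for z
  proof -
    have "norm (B a z) = norm (z - a)" for a
      using Blaschke_factor_norm[OF z, of a] R0 by (simp add: B_def norm_divide)
    then have "norm (G z) = norm (f z)"
      using g(2)[of z] z R by (simp add: G_def norm_mult prod_norm[symmetric] mult.commute)
    then show ?thesis using f(3)[of z] z by simp
  qed
  have GM: "norm (G z) \<le> M0" if "norm z \<le> R" for z
  proof (rule maximum_modulus_frontier[where S = "cball 0 R" and f = G])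
    show "G holomorphic_on interior (cball 0 R)" "continuous_on (closure (cball 0 R)) G"
      using R by (auto intro!: holomorphic_on_subset[OF holG] continuous_on_subset[OF holomorphic_on_imp_continuous_on[OF holG]])
  qed (use that Gsphere in auto)
  have Gnz: "G z \<noteq> 0" if "norm z \<le> r1" for z
    using gnz[OF that] Bnz that R fin by (auto simp: G_def prod_zero_iff)
  \<comment> \<open>Jensen's inequality in product form: each zero contributes a factor at least R /
    r1 at the centre.\<close>
  have G0: "norm (G 0) \<ge> norm (f 0) * (R / r1) ^ card Z"
  proof -
    have "norm (f 0) = (\<Prod>a\<in>Z. norm a) * norm (g 0)"
      using g(2)[of 0] R0 by (simp add: norm_mult prod_norm[symmetric])
    also have "\<dots> \<le> r1 ^ card Z * norm (g 0)"
      using prod_mono[of Z norm "\<lambda>_. r1"] Zr by (intro mult_right_mono) auto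
    finally have "norm (f 0) * (R / r1) ^ card Z \<le> r1 ^ card Z * norm (g 0) * (R / r1) ^ card Z"
      using R0 by (intro mult_right_mono) auto
    also have "\<dots> = norm (g 0) * R ^ card Z" using R0 by (simp add: power_divide)
    also have "\<dots> = norm (G 0)"
      using R0 by (simp add: G_def B_def norm_mult norm_power power2_eq_square)
    finally show ?thesis .
  qed
  have f0: "norm (f 0) > 0" using f(2) by simp
  have pw1: "1 \<le> (R / r1) ^ card Z" using R R0 by (intro one_le_power) auto
  have f0G0: "norm (f 0) \<le> norm (G 0)"
    using G0 mult_left_mono[OF pw1, of "norm (f 0)"] by simp
  have M: "M > 0" using f(4) order_trans[OF norm_ge_zero GM[of 0]] R0 by simp
  have "norm (f 0) * (R / r1) ^ card Z \<le> M" using G0 GM[of 0] R0 f(4) by simp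
  then have "(R / r1) ^ card Z \<le> M / norm (f 0)" using f0 by (simp add: field_simps)
  then have "ln ((R / r1) ^ card Z) \<le> L" unfolding L_def
    using R0 by (intro ln_mono) (auto intro!: zero_less_power divide_pos_pos)
  then show "real (card Z) * ln (R / r1) \<le> L" using R0 by (simp add: ln_realpow)
  fix z :: complex assume z: "norm z \<le> r"
  have "norm (G z) \<ge> M * exp (- ((r1 + norm z) / (r1 - norm z)) * ln (M / norm (G 0)))"
  proof (rule nonvanishing_lower_bound)
    show "G holomorphic_on ball 0 r1" using R by (intro holomorphic_on_subset[OF holG]) auto
    show "norm (G x) < M" if "x \<in> ball 0 r1" for x using GM[of x] that R f(4) by simp
  qed (use z R R0 Gnz in auto)
  moreover have "(r1 + norm z) / (r1 - norm z) * ln (M / norm (G 0)) \<le> (r1 + r) / (r1 - r) * L"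
  proof (rule mult_mono)
    show "(r1 + norm z) / (r1 - norm z) \<le> (r1 + r) / (r1 - r)"
      using z R by (intro frac_le) auto
    show "ln (M / norm (G 0)) \<le> L"
    proof -
      have G0: "norm (G 0) > 0" using f0 f0G0 by linarith
      then have "M / norm (G 0) \<le> M / norm (f 0)"
        using f0 f0G0 M by (intro divide_left_mono mult_pos_pos) auto
      then show ?thesis unfolding L_def using G0 f0 M by (intro ln_mono divide_pos_pos) auto
    qed
    show "0 \<le> ln (M / norm (G 0))"
      using GM[of 0] R0 f(4) f0 f0G0 by (intro ln_ge_zero) (auto simp: le_divide_eq_1)
  qed (use R R0 in auto)
  ultimately have lowG: "norm (G z) \<ge> M * exp (- ((r1 + r) / (r1 - r)) * L)"
    using M by (elim order_trans[rotated]) auto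
  \<comment> \<open>Return from G to f: f is G times the product of (z - a) / \<open>B a z\<close>,
    and the denominators are at most 2 R in norm.\<close>
  have "(\<Prod>a\<in>Z. norm (z - a) / (2 * R)) * norm (G z) \<le> (\<Prod>a\<in>Z. norm (z - a) / norm (B a z)) * norm (G z)"
  proof (intro mult_right_mono prod_mono conjI)
    fix a assume a: "a \<in> Z"
    have zR: "norm z \<le> R" using z R by simp
    show "norm (z - a) / (2 * R) \<le> norm (z - a) / norm (B a z)"
      using Ble[OF a zR] Bnz[OF a zR] R0 by (intro divide_left_mono mult_pos_pos) auto
  qed (use R0 in auto)
  also have "\<dots> = norm (f z)"
  proof -
    have zR: "norm z \<le> R" "z \<in> ball 0 R'" using z R by auto
    have "(\<Prod>a\<in>Z. norm (B a z)) \<noteq> 0" using Bnz zR fin by (auto simp: prod_zero_iff)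
    then show ?thesis
      using g(2)[OF zR(2)] by (simp add: G_def norm_mult prod_dividef prod_norm[symmetric])
  qed
  finally have "(\<Prod>a\<in>Z. norm (z - a) / (2 * R)) * norm (G z) \<le> norm (f z)" .
  moreover have "(\<Prod>a\<in>Z. norm (z - a) / (2 * R)) * (M * exp (- ((r1 + r) / (r1 - r)) * L)) \<le> (\<Prod>a\<in>Z. norm (z - a) / (2 * R)) * norm (G z)"
    using lowG R0 by (intro mult_left_mono prod_nonneg) auto
  ultimately show "norm (f z) \<ge> (\<Prod>a\<in>Z. norm (z - a) / (2 * R)) * (M * exp (- ((r1 + r) / (r1 - r)) * L))"
    by linarith
qed

text \<open>Pigeonhole: cut the interval into card F + 1 equal pieces. A point of F is closer than
  half a piece to at most one midpoint, so some midpoint is far from all of F.\<close>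

lemma avoid_finite_set:
  fixes F :: "real set"
  assumes F: "finite F" and l: "l > 0"
  shows "\<exists>t\<in>{a..a + l}. \<forall>\<gamma>\<in>F. \<bar>t - \<gamma>\<bar> \<ge> l / (2 * (real (card F) + 1))"
proof (rule ccontr)
  assume neg: "\<not> ?thesis"
  define n where "n = card F"
  define d where "d = l / (real n + 1)"
  have d: "d > 0" using l by (simp add: d_def)
  define t where "t = (\<lambda>k. a + (real k + 1 / 2) * d)"
  have tin: "t k \<in> {a..a + l}" if "k \<le> n" for k
  proof -
    have "(real k + 1 / 2) * d \<le> (real n + 1) * d" using that d by (intro mult_right_mono) auto
    also have "\<dots> = l" by (simp add: d_def)
    finally show ?thesis using d by (simp add: t_def)
  qed
  have "\<exists>\<gamma>\<in>F. \<bar>t k - \<gamma>\<bar> < d / 2" if "k \<le> n" for k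
  proof -
    have "l / (2 * (real (card F) + 1)) = d / 2" by (simp add: d_def n_def)
    then show ?thesis using neg tin[OF that] by (metis not_le)
  qed
  then obtain \<gamma> where \<gamma>: "\<And>k. k \<le> n \<Longrightarrow> \<gamma> k \<in> F" "\<And>k. k \<le> n \<Longrightarrow> \<bar>t k - \<gamma> k\<bar> < d / 2" by metis
  have "inj_on \<gamma> {..n}"
  proof (rule inj_onI)
    fix i j assume ij: "i \<in> {..n}" "j \<in> {..n}" "\<gamma> i = \<gamma> j"
    have "\<bar>t i - \<gamma> j\<bar> < d / 2" "\<bar>t j - \<gamma> j\<bar> < d / 2"
      using \<gamma>(2)[of i] \<gamma>(2)[of j] ij by simp_all
    then have "\<bar>t i - t j\<bar> < d" unfolding abs_less_iff by linarith
    moreover have "t i - t j = (real i - real j) * d" by (simp add: t_def algebra_simps)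
    ultimately have "\<bar>real i - real j\<bar> * d < 1 * d" using d by (simp add: abs_mult)
    then have "\<bar>real i - real j\<bar> < 1" using d by (simp only: mult_less_cancel_right_pos)
    then show "i = j" by linarith
  qed
  then have "card {..n} \<le> card F" using F \<gamma>(1) by (intro card_inj_on_le) auto
  then show False by (simp add: n_def)
qed

section \<open>Location and simplicity of the zeros\<close>

text \<open>For Re s < 0 the only factor of the functional equation that can vanish is rGamma(s/2),
  which accounts for the trivial zeros; for Re s > 1 Moebius inversion excludes zeros.\<close>

lemma nontrivial_zeros_strip:
  assumes "\<rho> \<in> nontrivial_zeros"
  shows "zeta \<rho> = 0" "\<rho> \<noteq> 1" "\<rho> \<noteq> 0" "\<rho> \<noteq> 1 / 2" "0 \<le> Re \<rho>" "Re \<rho> \<le> 1"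
proof -
  show z: "zeta \<rho> = 0" and "\<rho> \<noteq> 1" using assms by (auto simp: nontrivial_zeros_def)
  show "\<rho> \<noteq> 0" using z zeta_0 by auto
  show "\<rho> \<noteq> 1 / 2"
  proof
    assume "\<rho> = 1 / 2"
    then show False using z zeta_half_nonzero by (simp only:)
  qed
  show "Re \<rho> \<le> 1" using z zeta_nonzero[of \<rho>] by force
  show "0 \<le> Re \<rho>"
  proof (rule ccontr)
    assume "\<not> 0 \<le> Re \<rho>"
    then have re: "Re \<rho> < 0" by simp
    have "Gamma ((1 - \<rho>) / 2) \<noteq> 0"
      using re by (intro Gamma_nonzero) (auto elim!: nonpos_Ints_cases' simp: complex_eq_iff)
    moreover have "zeta (1 - \<rho>) \<noteq> 0" using re by (intro zeta_nonzero) simp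
    ultimately have "rGamma (\<rho> / 2) = 0"
      using zeta_functional_equation[OF re] z by simp
    then obtain k where "\<rho> / 2 = - of_nat k"
      by (auto simp: rGamma_eq_zero_iff elim: nonpos_Ints_cases')
    then have "\<rho> = - 2 * of_nat k" by (simp add: field_simps)
    moreover from this have "k \<ge> 1" using re by (cases k) auto
    ultimately show False using assms by (auto simp: nontrivial_zeros_def)
  qed
qed

text \<open>The first trivial zero is -2, outside the half-plane, and the pole at 1 is cleared with
  value 1.\<close>

lemma zeta1_eq_0_iff:
  assumes "Re s > - 1"
  shows "zeta1 s = 0 \<longleftrightarrow> s \<in> nontrivial_zeros"
proof
  assume z: "zeta1 s = 0"
  then have "s \<noteq> 1" by auto
  moreover have "zeta s = 0" using z zeta1_eq[OF assms] \<open>s \<noteq> 1\<close> by simp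
  moreover have "s \<noteq> - 2 * of_nat k" if "k \<ge> 1" for k
  proof
    assume "s = - 2 * of_nat k"
    then have "Re s = - 2 * real k" by simp
    then show False using assms that by simp
  qed
  ultimately show "s \<in> nontrivial_zeros" by (simp add: nontrivial_zeros_def)
next
  assume "s \<in> nontrivial_zeros"
  then show "zeta1 s = 0" using nontrivial_zeros_strip[of s] zeta1_eq[OF assms] by simp
qed

lemma zeta1_holomorphic_right: "zeta1 holomorphic_on {s. Re s > - 1}"
  by (rule zeta1_holomorphic) (auto intro: holomorphic_on_ident)

lemma finite_nontrivial_zeros: "finite {\<rho> \<in> nontrivial_zeros. \<bar>Im \<rho>\<bar> < R}"
proof -
  let ?S = "{s. Re s > - 1}" and ?K = "cbox (Complex 0 (- R)) (Complex 1 R)"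
  have sub: "?K \<subseteq> ?S" by (auto simp: in_cbox_complex_iff)
  have iff: "z \<in> nontrivial_zeros \<longleftrightarrow> zeta1 z = 0" if "z \<in> ?K" for z
    using zeta1_eq_0_iff[of z] sub that by auto
  have "finite {z \<in> ?K. zeta1 z = 0}"
  proof (cases "{z \<in> ?K. zeta1 z = 0} = {}")
    case False
    then obtain a where a: "a \<in> ?S" "zeta1 a = 0" using sub by blast
    have "\<not> zeta1 constant_on ?S"
    proof
      assume "zeta1 constant_on ?S"
      then obtain k where k: "\<And>x. x \<in> ?S \<Longrightarrow> zeta1 x = k" unfolding constant_on_def by blast
      have "zeta1 1 = k" by (rule k) simp
      then show False using k[OF a(1)] a(2) by (simp add: zeta1_1)
    qed
    then show ?thesis
      by (rule holomorphic_compact_finite_zeros[OF zeta1_holomorphic_right open_halfspace_Re_gt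
            convex_connected[OF convex_halfspace_Re_gt] compact_cbox sub])
  next
    case True
    show ?thesis unfolding True by simp
  qed
  moreover have "{\<rho> \<in> nontrivial_zeros. \<bar>Im \<rho>\<bar> < R} \<subseteq> {z \<in> ?K. zeta1 z = 0}"
  proof (intro subsetI CollectI conjI)
    fix \<rho> assume \<rho>: "\<rho> \<in> {\<rho> \<in> nontrivial_zeros. \<bar>Im \<rho>\<bar> < R}"
    then show K: "\<rho> \<in> ?K" using nontrivial_zeros_strip(5,6)[of \<rho>] by (auto simp: in_cbox_complex_iff)
    then show "zeta1 \<rho> = 0" using iff[OF K] \<rho> by simp
  qed
  ultimately show ?thesis by (rule rev_finite_subset)
qed

lemma zeta_holomorphic_right: "zeta holomorphic_on ({s. Re s > - 1} - {1})"
  by (rule holomorphic_transform[OF zeta_right_holomorphic]) (auto simp: zeta_right)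

text \<open>Order 1 means that zeta(w) is w - \<rho> times a function that is nonzero at \<rho>, and
  the derivative at \<rho> is its value. The second equation transfers simplicity to
  \<open>zeta1\<close>.\<close>

lemma zeta_simple_zero:
  assumes "\<rho> \<in> nontrivial_zeros" "zorder zeta \<rho> = 1"
  shows "deriv zeta \<rho> \<noteq> 0" "deriv zeta1 \<rho> = (\<rho> - 1) * deriv zeta \<rho>"
proof -
  note \<rho> = nontrivial_zeros_strip[OF assms(1)]
  let ?S = "{s :: complex. Re s > - 1} - {1}"
  have S: "open ?S" "connected ?S" "\<rho> \<in> ?S"
  proof -
    show "open ?S" by (intro open_Diff open_halfspace_Re_gt) simp
    show "connected ?S"
      by (intro connected_open_delete[OF open_halfspace_Re_gt convex_connected[OF convex_halfspace_Re_gt]]) simp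
    show "\<rho> \<in> ?S" using \<rho> by simp
  qed
  have "\<exists>w\<in>?S. zeta w \<noteq> 0"
    by (rule bexI[of _ 2]) (auto intro!: zeta_nonzero)
  from zorder_exist_zero[OF zeta_holomorphic_right S this]
  obtain r where r: "r > 0" "cball \<rho> r \<subseteq> ?S" "zor_poly zeta \<rho> holomorphic_on cball \<rho> r"
    and r': "\<forall>w\<in>cball \<rho> r. zeta w = zor_poly zeta \<rho> w * (w - \<rho>) ^ nat (zorder zeta \<rho>) \<and> zor_poly zeta \<rho> w \<noteq> 0"
    by blast
  have rz: "zeta w = zor_poly zeta \<rho> w * (w - \<rho>)" "zor_poly zeta \<rho> w \<noteq> 0" if "w \<in> cball \<rho> r" for w
    using r' that assms(2) by auto
  let ?g = "zor_poly zeta \<rho>"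
  have "?g holomorphic_on ball \<rho> r" by (rule holomorphic_on_subset[OF r(3)]) auto
  then have dg: "(?g has_field_derivative deriv ?g \<rho>) (at \<rho>)"
    by (rule holomorphic_derivI) (use r in auto)
  have "((\<lambda>w. ?g w * (w - \<rho>)) has_field_derivative deriv ?g \<rho> * (\<rho> - \<rho>) + 1 * ?g \<rho>) (at \<rho>)"
    by (rule DERIV_mult[OF dg]) (auto intro!: derivative_eq_intros)
  then have "((\<lambda>w. ?g w * (w - \<rho>)) has_field_derivative ?g \<rho>) (at \<rho>)" by simp
  then have "(zeta has_field_derivative ?g \<rho>) (at \<rho>)"
    by (rule has_field_derivative_transform_within_open[where S = "ball \<rho> r"]) (use r(1) in \<open>auto simp: rz\<close>)
  then have dz: "deriv zeta \<rho> = ?g \<rho>" by (rule DERIV_imp_deriv)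
  then show "deriv zeta \<rho> \<noteq> 0" using r(1) rz(2)[of \<rho>] by simp
  have "(zeta has_field_derivative deriv zeta \<rho>) (at \<rho>)"
    by (rule holomorphic_derivI[OF zeta_holomorphic_right S(1,3)])
  then have "((\<lambda>s. (s - 1) * zeta s) has_field_derivative 1 * zeta \<rho> + deriv zeta \<rho> * (\<rho> - 1)) (at \<rho>)"
    by (intro DERIV_mult) (auto intro!: derivative_eq_intros)
  then have "((\<lambda>s. (s - 1) * zeta s) has_field_derivative (\<rho> - 1) * deriv zeta \<rho>) (at \<rho>)"
    using \<rho>(1) by (simp add: mult.commute)
  then have "(zeta1 has_field_derivative (\<rho> - 1) * deriv zeta \<rho>) (at \<rho>)"
    by (rule has_field_derivative_transform_within_open[OF _ S(1,3)]) (auto simp: zeta1_eq)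
  then show "deriv zeta1 \<rho> = (\<rho> - 1) * deriv zeta \<rho>" by (rule DERIV_imp_deriv)
qed

text \<open>1 / zeta(s) is the \<open>moebius\<close> series, bounded by pi^2 / 6 and so, as pi < 4,
  by 8/3.\<close>

lemma norm_zeta_ge:
  assumes "Re s = 2"
  shows "norm (zeta s) \<ge> 3 / 8"
proof -
  let ?m = "\<lambda>n. of_int (moebius n) * of_nat n powr (- s) :: complex"
  define M where "M = (\<Sum>\<^sub>\<infinity>k\<in>{0<..}. ?m k)"
  have s: "Re s > 1" using assms by simp
  have "?m norm_summable_on {0<..}"
    using norm_summable_moebius[OF s, of UNIV] unfolding Int_UNIV_left .
  then have "(?m has_sum M) {0<..}"
    unfolding M_def by (rule has_sum_infsum[OF Infinite_Sum.abs_summable_summable])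
  then have "M = (\<Sum>n. ?m (Suc n))" by (rule sums_unique[OF has_sum_Suc_imp_sums])
  also have "norm \<dots> \<le> (\<Sum>n. 1 / real ((n + 1)\<^sup>2))"
  proof (rule norm_suminf_le)
    show "summable (\<lambda>n. 1 / real ((n + 1)\<^sup>2))" by (rule sums_summable[OF inverse_squares_sums])
    fix n
    have "norm (?m (Suc n)) \<le> 1 * real (Suc n) powr Re (- s)"
      unfolding norm_mult by (intro mult_mono norm_moebius_le) (simp_all add: norm_nat_powr del: of_nat_Suc)
    also have "\<dots> = 1 / real ((n + 1)\<^sup>2)"
      using assms by (simp add: powr_minus divide_inverse add.commute)
    finally show "norm (?m (Suc n)) \<le> 1 / real ((n + 1)\<^sup>2)" .
  qed
  also have "(\<Sum>n. 1 / real ((n + 1)\<^sup>2)) = pi\<^sup>2 / 6" by (rule sums_unique[OF inverse_squares_sums, symmetric])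
  also have "\<dots> \<le> 4\<^sup>2 / 6" using pi_less_4 by (intro divide_right_mono power_mono) auto
  finally have M: "norm M \<le> 8 / 3" by simp
  have "1 = norm (zeta s) * norm M" using zeta_moebius[OF s] by (simp add: M_def flip: norm_mult)
  also have "\<dots> \<le> norm (zeta s) * (8 / 3)" by (intro mult_left_mono M) auto
  finally show ?thesis by simp
qed

text \<open>The discs are centred at 2 + i T, at distance 3 from the line Re = -1, and the radii
  23/10, 13/5, 29/10, 59/20 fit below 3. The innermost one covers the segments: the farthest
  abscissa -1/4 is 9/4 away, heights vary by 2/5, and (9/4)^2 + (2/5)^2 is below (23/10)^2.\<close>

lemma zeta1_lower_bound_heights:
  assumes simple: "\<And>\<rho>. \<rho> \<in> nontrivial_zeros \<Longrightarrow> deriv zeta1 \<rho> \<noteq> 0"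
  shows "\<exists>T0. \<forall>T\<ge>T0. \<exists>t\<in>{T..T+1}. \<forall>s. - 1 / 4 \<le> Re s \<and> Re s \<le> 5 / 4 \<and> \<bar>Im s\<bar> = t \<longrightarrow> norm (zeta1 s) \<ge> exp (- t / 4)"
proof -
  obtain C0 where C0: "C0 > 0" "\<And>s. - 19 / 20 \<le> Re s \<Longrightarrow> norm (zeta1 s) \<le> C0 * (1 + norm s) ^ 3"
    using zeta1_growth[of "- 19 / 20"] by auto
  define C where "C = C0 + 1"
  have C: "C \<ge> 1" "\<And>s. - 19 / 20 \<le> Re s \<Longrightarrow> norm (zeta1 s) \<le> C * (1 + norm s) ^ 3"
  proof -
    show "C \<ge> 1" using C0 by (simp add: C_def)
    fix s assume "- 19 / 20 \<le> Re s"
    then have "norm (zeta1 s) \<le> C0 * (1 + norm s) ^ 3" by (rule C0)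
    also have "\<dots> \<le> C * (1 + norm s) ^ 3" by (intro mult_right_mono) (auto simp: C_def)
    finally show "norm (zeta1 s) \<le> C * (1 + norm s) ^ 3" .
  qed
  \<comment> \<open>Upper bound for \<open>L\<close>: the growth bound gives (T + 6)^3, and 2 /
    (3/8) = 16/3 is rounded up to 6.\<close>
  define \<Lambda> where "\<Lambda> = (\<lambda>T::real. ln (6 * C * (T + 6) ^ 3))"
  \<comment> \<open>The first summand is the cost of the distances to the zeros, the second the
    Harnack loss with (13/5 + 23/10) / (13/5 - 23/10) = 49/3 < 17. Both are powers of log T.\<close>
  have "\<forall>\<^sub>F T in at_top. 290 * \<Lambda> T * (10 * \<Lambda> T + 1) + 17 * \<Lambda> T \<le> T / 4"
    unfolding \<Lambda>_def using C(1) by real_asymp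
  then obtain T1 where T1: "\<And>T. T \<ge> T1 \<Longrightarrow> 290 * \<Lambda> T * (10 * \<Lambda> T + 1) + 17 * \<Lambda> T \<le> T / 4"
    by (auto simp: eventually_at_top_linorder)
  show ?thesis
  proof (intro exI[of _ "max T1 1"] allI impI)
    fix T assume T: "max T1 1 \<le> T"
    define z0 where "z0 = Complex 2 T"
    define f where "f = (\<lambda>w. zeta1 (z0 + w))"
    define M0 where "M0 = C * (T + 6) ^ 3"
    define Z where "Z = {z. norm z \<le> 13 / 5 \<and> f z = 0}"
    define L where "L = ln (2 * M0 / norm (f 0))"
    have M0: "M0 \<ge> 1"
    proof -
      have "1 \<le> (T + 6) ^ 3" using T by (intro one_le_power) auto
      then show ?thesis unfolding M0_def using C(1) mult_mono[of 1 C 1 "(T + 6) ^ 3"] by simp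
    qed
    have Re_w: "\<bar>Re w\<bar> \<le> norm w" for w :: complex by (rule abs_Re_le_cmod)
    have rgt: "Re (z0 + w) > - 1" if "norm w < 59 / 20" for w
      using Re_w[of w] that by (simp add: z0_def)
    have hol: "f holomorphic_on ball 0 (59 / 20)"
      unfolding f_def using rgt by (intro holomorphic_intros) auto
    have f0: "norm (f 0) \<ge> 3 / 8"
    proof -
      have "f 0 = (z0 - 1) * zeta z0" unfolding f_def by (subst zeta1_eq) (auto simp: z0_def complex_eq_iff)
      moreover have "norm (z0 - 1) \<ge> 1" using Re_w[of "z0 - 1"] by (simp add: z0_def)
      moreover have "norm (zeta z0) \<ge> 3 / 8" by (rule norm_zeta_ge) (simp add: z0_def)
      ultimately show ?thesis using mult_mono[of 1 "norm (z0 - 1)" "3 / 8" "norm (zeta z0)"] by (simp add: norm_mult)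
    qed
    have fM: "norm (f w) \<le> M0" if "norm w \<le> 29 / 10" for w
    proof -
      have "norm (f w) \<le> C * (1 + norm (z0 + w)) ^ 3"
        unfolding f_def using Re_w[of w] that by (intro C(2)) (simp add: z0_def)
      also have "\<dots> \<le> M0" unfolding M0_def
      proof (intro mult_left_mono power_mono)
        have "norm z0 \<le> 2 + T" using cmod_le[of z0] T by (simp add: z0_def)
        then show "1 + norm (z0 + w) \<le> T + 6" using norm_triangle_ineq[of z0 w] that by simp
      qed (use C in auto)
      finally show ?thesis .
    qed
    have Zsimple: "deriv f z \<noteq> 0" if z: "norm z \<le> 13 / 5" "f z = 0" for z
    proof -
      have "z0 + z \<in> nontrivial_zeros"
        using z rgt[of z] zeta1_eq_0_iff[of "z0 + z"] by (simp add: f_def)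
      moreover have "deriv f z = deriv zeta1 (z0 + z)"
      proof -
        have "(zeta1 has_field_derivative deriv zeta1 (z0 + z)) (at (z0 + z))"
          by (rule holomorphic_derivI[OF zeta1_holomorphic_right open_halfspace_Re_gt]) (use rgt[of z] z in auto)
        then have "((\<lambda>w. zeta1 (z0 + w)) has_field_derivative deriv zeta1 (z0 + z) * 1) (at z)"
          by (rule DERIV_chain2) (auto intro!: derivative_eq_intros)
        then have "(f has_field_derivative deriv zeta1 (z0 + z)) (at z)"
          unfolding f_def by simp
        then show ?thesis by (rule DERIV_imp_deriv)
      qed
      ultimately show ?thesis using simple by simp
    qed
    have slb: "finite Z" "real (card Z) * ln ((29 / 10) / (13 / 5)) \<le> L"
      "\<And>z. norm z \<le> 23 / 10 \<Longrightarrow> norm (f z) \<ge> (\<Prod>a\<in>Z. norm (z - a) / (2 * (29 / 10))) * (2 * M0 * exp (- ((13 / 5 + 23 / 10) / (13 / 5 - 23 / 10)) * L))"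
    proof -
      have r: "(0 :: real) < 23 / 10" "23 / 10 < (13 / 5 :: real)" "13 / 5 < (29 / 10 :: real)" "29 / 10 < (59 / 20 :: real)"
        by simp_all
      have f0': "f 0 \<noteq> 0" using f0 by auto
      have M02: "M0 < 2 * M0" using M0 by simp
      note slb = simple_zeros_lower_bound[OF r hol f0' _ M02]
      show "finite Z" unfolding Z_def by (rule slb(1)) (erule fM, erule (1) Zsimple)
      show "real (card Z) * ln ((29 / 10) / (13 / 5)) \<le> L"
        unfolding Z_def L_def by (rule slb(2)) (erule fM, erule (1) Zsimple)
      show "norm (f z) \<ge> (\<Prod>a\<in>Z. norm (z - a) / (2 * (29 / 10))) * (2 * M0 * exp (- ((13 / 5 + 23 / 10) / (13 / 5 - 23 / 10)) * L))"
        if "norm z \<le> 23 / 10" for z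
        unfolding Z_def L_def by (rule slb(3)) (erule fM, erule (1) Zsimple, rule that)
    qed
    define n where "n = card Z"
    have L: "L \<le> \<Lambda> T"
    proof -
      have "2 * M0 / norm (f 0) \<le> 2 * M0 / (3 / 8)"
        using f0 M0 by (intro divide_left_mono) auto
      also have "\<dots> \<le> 6 * C * (T + 6) ^ 3" using M0 by (simp add: M0_def)
      finally show ?thesis unfolding L_def \<Lambda>_def using f0 M0 by (intro ln_mono) (auto intro!: divide_pos_pos)
    qed
    have n: "real n \<le> 10 * L"
    proof -
      \<comment> \<open>ln(29/26) is at least 3/29 > 1/10, which turns the zero count into n <= 10
        L.\<close>
      have "ln (26 / 29 :: real) \<le> 26 / 29 - 1" by (rule ln_le_minus_one) simp
      then have "1 / 10 \<le> ln ((29 / 10) / (13 / 5) :: real)" by (simp add: ln_div)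
      then have "real n * (1 / 10) \<le> real n * ln ((29 / 10) / (13 / 5))" by (intro mult_left_mono) auto
      then show ?thesis using slb(2) by (simp add: n_def)
    qed
    define F where "F = (\<lambda>a. T + Im a) ` Z"
    have F: "finite F" "card F \<le> n" using slb(1) by (auto simp: F_def n_def card_image_le)
    obtain t where t: "t \<in> {T..T + 2 / 5}" "\<And>\<gamma>. \<gamma> \<in> F \<Longrightarrow> \<bar>t - \<gamma>\<bar> \<ge> (2 / 5) / (2 * (real (card F) + 1))"
      using avoid_finite_set[OF F(1), of "2 / 5" T] by auto
    have main: "norm (zeta1 s) \<ge> exp (- t / 4)" if s: "- 1 / 4 \<le> Re s" "Re s \<le> 5 / 4" "Im s = t" for s
    proof -
      define w where "w = s - z0"
      have w: "\<bar>Re w\<bar> \<le> 9 / 4" "Im w = t - T" "\<bar>Im w\<bar> \<le> 2 / 5" using s t(1) by (auto simp: w_def z0_def)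
      have "(norm w)\<^sup>2 \<le> (9 / 4)\<^sup>2 + (2 / 5)\<^sup>2"
        unfolding cmod_power2 using w by (intro add_mono abs_le_square_iff[THEN iffD1]) simp_all
      also have "\<dots> \<le> (23 / 10)\<^sup>2" by (simp add: power2_eq_square)
      finally have nw: "norm w \<le> 23 / 10" by (rule power2_le_imp_le) simp
      \<comment> \<open>Zeros are at distance at least 1 / (5 (n + 1)); division by 2 R = 29/5 gives
        1/x. The crude bound exp(- x) <= 1/x suffices, since n x is still of order log^2 T.\<close>
      define x where "x = 29 * (real n + 1)"
      have fac: "exp (- x) \<le> norm (w - a) / (2 * (29 / 10))" if a: "a \<in> Z" for a
      proof -
        have "(1 / 5) / (real n + 1) \<le> (2 / 5) / (2 * (real (card F) + 1))"
          using F(2) by (simp add: field_simps)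
        also have "\<dots> \<le> \<bar>t - (T + Im a)\<bar>" using a by (intro t(2)) (auto simp: F_def)
        also have "\<dots> = \<bar>Im (w - a)\<bar>" using w by simp
        also have "\<dots> \<le> norm (w - a)" by (rule abs_Im_le_cmod)
        finally have le: "(1 / 5) / (real n + 1) / (29 / 5) \<le> norm (w - a) / (29 / 5)"
          by (rule divide_right_mono) simp
        have "1 / 5 / m / (29 / 5) = 1 / (29 * m)" if "m > 0" for m :: real using that by (simp add: field_simps)
        from this[of "real n + 1"] have "(1 / 5) / (real n + 1) / (29 / 5) = 1 / x" by (simp add: x_def)
        then have "1 / x \<le> norm (w - a) / (2 * (29 / 10))" using le by simp
        moreover have "exp (- x) \<le> 1 / x"
        proof -
          have "x > 0" by (simp add: x_def)
          moreover have "x \<le> exp x" using exp_ge_add_one_self[of x] by linarith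
          ultimately show ?thesis by (simp add: exp_minus inverse_eq_divide frac_le)
        qed
        ultimately show ?thesis by simp
      qed
      have "exp (- x) ^ n \<le> (\<Prod>a\<in>Z. norm (w - a) / (2 * (29 / 10)))"
        using prod_mono[of Z "\<lambda>_. exp (- x)" "\<lambda>a. norm (w - a) / (2 * (29 / 10))"] fac by (simp add: n_def)
      then have p: "exp (- (real n * x)) \<le> (\<Prod>a\<in>Z. norm (w - a) / (2 * (29 / 10)))"
        by (simp flip: exp_of_nat_mult)
      have L0: "0 \<le> L" using n of_nat_0_le_iff[of n, where 'a = real] by linarith
      have prod_eq: "(10 * l) * (29 * m) = 290 * l * m" for l m :: real by simp
      define p where "p = real n * x"
      define q where "q = (13 / 5 + 23 / 10) / (13 / 5 - 23 / 10) * L"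
      have "p \<le> (10 * \<Lambda> T) * (29 * (10 * \<Lambda> T + 1))"
        unfolding x_def p_def using n L L0 by (intro mult_mono) auto
      also have "\<dots> = 290 * \<Lambda> T * (10 * \<Lambda> T + 1)"
        by (rule prod_eq)
      finally have p': "p \<le> 290 * \<Lambda> T * (10 * \<Lambda> T + 1)" .
      have q': "q \<le> 17 * \<Lambda> T" unfolding q_def using L L0 by simp
      have pq: "p + q \<le> T / 4"
        using T1[of T] T p' q' by linarith
      have "exp (- (T / 4)) \<le> exp (- (real n * x) + - ((13 / 5 + 23 / 10) / (13 / 5 - 23 / 10)) * L)"
        unfolding exp_le_cancel_iff using pq unfolding p_def q_def by linarith
      also have "\<dots> = exp (- (real n * x)) * (1 * exp (- ((13 / 5 + 23 / 10) / (13 / 5 - 23 / 10)) * L))"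
        by (simp only: exp_add mult_1)
      also have "\<dots> \<le> (\<Prod>a\<in>Z. norm (w - a) / (2 * (29 / 10))) * (2 * M0 * exp (- ((13 / 5 + 23 / 10) / (13 / 5 - 23 / 10)) * L))"
        using M0 by (intro mult_mono p) (auto intro!: prod_nonneg)
      also have "\<dots> \<le> norm (f w)" by (rule slb(3)[OF nw])
      also have "f w = zeta1 s" by (simp add: f_def w_def)
      finally have "exp (- (T / 4)) \<le> norm (zeta1 s)" .
      moreover have "exp (- t / 4) \<le> exp (- (T / 4))" using t(1) by simp
      ultimately show ?thesis by linarith
    qed
    show "\<exists>t\<in>{T..T + 1}. \<forall>s. - 1 / 4 \<le> Re s \<and> Re s \<le> 5 / 4 \<and> \<bar>Im s\<bar> = t \<longrightarrow> exp (- t / 4) \<le> norm (zeta1 s)"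
    proof (intro bexI[of _ t] allI impI)
      fix s assume s: "- 1 / 4 \<le> Re s \<and> Re s \<le> 5 / 4 \<and> \<bar>Im s\<bar> = t"
      show "exp (- t / 4) \<le> norm (zeta1 s)"
      proof (cases "Im s = t")
        case False
        then have "Im (cnj s) = t" using s by auto
        then have "exp (- t / 4) \<le> norm (zeta1 (cnj s))" using s by (intro main) auto
        then show ?thesis using s by (simp add: zeta1_cnj)
      qed (use s main in auto)
    qed (use t in auto)
  qed
qed

section \<open>The residue expansion\<close>

text \<open>On the line the norm of the n-th integrand is |q n| (n + 1)^(-c) times one fixed
  integrable function, so integration is termwise. The power of n + 1 merges with that of y, making
  each term a Mellin integral at y (n + 1).\<close>

lemma hker_Dirichlet_series:
  fixes q :: "nat \<Rightarrow> complex"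
  assumes a: "0 \<le> a" "a \<le> 1 / 2" and y: "y > 0" and c: "1 < c" "c \<le> 3"
    and q: "summable (\<lambda>n. norm (q n) * real (Suc n) powr (- c))"
    and D: "\<And>t. (\<lambda>n. q n * of_nat (Suc n) powr (- Complex c t)) sums D t"
  shows "integrable lborel (\<lambda>t. hker a (Complex c t) * D t * of_real y powr (- Complex c t))"
    and "(\<lambda>n. q n * (LINT t|lborel. hker a (Complex c t) * of_real (y * real (Suc n)) powr (- Complex c t))) sums
           (LINT t|lborel. hker a (Complex c t) * D t * of_real y powr (- Complex c t))"
proof -
  define F where "F = (\<lambda>n t. q n * (hker a (Complex c t) * of_real (y * real (Suc n)) powr (- Complex c t)))"
  define h where "h = (\<lambda>t. hker a (Complex c t) * of_real y powr (- Complex c t))"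
  have F: "F n t = h t * (q n * of_nat (Suc n) powr (- Complex c t))" for n t
  proof -
    have "complex_of_real (y * real (Suc n)) powr (- Complex c t) =
        of_real y powr (- Complex c t) * of_nat (Suc n) powr (- Complex c t)"
      using y by (simp add: powr_times_real del: of_nat_Suc)
    then show ?thesis by (simp only: F_def h_def mult_ac)
  qed
  have nF: "norm (F n t) = norm (q n) * real (Suc n) powr (- c) * norm (h t)" for n t
    unfolding F norm_mult by (simp add: norm_nat_powr mult_ac del: of_nat_Suc)
  have c': "c \<noteq> a - real k" for k using a c by (auto simp: algebra_simps)
  have int_F: "integrable lborel (F n)" for n
    unfolding F_def using y by (intro integrable_mult_right hker_line_integrable a c c') auto
  have sF: "(\<lambda>n. F n t) sums (h t * D t)" for t
    unfolding F by (intro sums_mult D)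
  have F_suminf: "(\<Sum>n. F n t) = hker a (Complex c t) * D t * of_real y powr (- Complex c t)" for t
    using sums_unique[OF sF[of t]] by (simp add: h_def mult_ac)
  have s1: "AE t in lborel. summable (\<lambda>n. norm (F n t))"
    unfolding nF by (intro AE_I2 summable_mult2 q)
  have s2: "summable (\<lambda>n. LINT t|lborel. norm (F n t))"
    unfolding nF by (simp only: integral_mult_right_zero) (intro summable_mult2 q)
  show "integrable lborel (\<lambda>t. hker a (Complex c t) * D t * of_real y powr (- Complex c t))"
    using integrable_suminf[OF int_F s1 s2] unfolding F_suminf .
  have "(LINT t|lborel. F n t) = q n * (LINT t|lborel. hker a (Complex c t) * of_real (y * real (Suc n)) powr (- Complex c t))" for n
    unfolding F_def by (rule integral_mult_right_zero)
  then show "(\<lambda>n. q n * (LINT t|lborel. hker a (Complex c t) * of_real (y * real (Suc n)) powr (- Complex c t))) sums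
           (LINT t|lborel. hker a (Complex c t) * D t * of_real y powr (- Complex c t))"
    using sums_integral[OF int_F s1 s2] unfolding F_suminf by simp
qed

lemma hker_Mellin_0:
  assumes "y > 0" "1 < c" "c \<le> 3"
  shows "(LINT t|lborel. hker 0 (Complex c t) * of_real y powr (- Complex c t)) =
           of_real (sqrt pi * y * exp (- y\<^sup>2 / 4))"
proof -
  have "(LINT t|lborel. hker 0 (Complex c t) * of_real y powr (- Complex c t)) / (2 * pi) =
      of_real (y / (2 * sqrt pi) * exp (- y\<^sup>2 / 4))"
    by (rule sums_unique2[OF hker_Mellin_inversion hker_series_0]) (use assms in auto)
  then have "(LINT t|lborel. hker 0 (Complex c t) * of_real y powr (- Complex c t)) =
      of_real (2 * pi * (y / (2 * sqrt pi) * exp (- y\<^sup>2 / 4)))"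
    by (simp add: field_simps)
  also have "2 * pi * (y / (2 * sqrt pi) * exp (- y\<^sup>2 / 4)) = sqrt pi * y * exp (- y\<^sup>2 / 4)"
    using real_sqrt_pow2[of pi] by (simp add: field_simps power2_eq_square)
  finally show ?thesis .
qed

lemma hker_Mellin_half:
  assumes "y > 0" "1 < c" "c \<le> 3"
  shows "(LINT t|lborel. hker (1 / 2) (Complex c t) * of_real y powr (- Complex c t)) =
           of_real (y / (2 * sqrt 2) * exp (- (y\<^sup>2 / 8))) *
             (Bessel_K (1 / 4) (of_real (y\<^sup>2 / 8)) + Bessel_K (3 / 4) (of_real (y\<^sup>2 / 8)))"
proof -
  have "(LINT t|lborel. hker (1 / 2) (Complex c t) * of_real y powr (- Complex c t)) / (2 * pi) =
      of_real (y / (4 * sqrt 2 * pi)) * (exp (- complex_of_real (y\<^sup>2 / 8)) *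
        (Bessel_K (1 / 4) (complex_of_real (y\<^sup>2 / 8)) + Bessel_K (3 / 4) (complex_of_real (y\<^sup>2 / 8))))"
    by (rule sums_unique2[OF hker_Mellin_inversion hker_series_half]) (use assms in auto)
  then have "(LINT t|lborel. hker (1 / 2) (Complex c t) * of_real y powr (- Complex c t)) =
      of_real (2 * pi * (y / (4 * sqrt 2 * pi))) * (exp (- complex_of_real (y\<^sup>2 / 8)) *
        (Bessel_K (1 / 4) (complex_of_real (y\<^sup>2 / 8)) + Bessel_K (3 / 4) (complex_of_real (y\<^sup>2 / 8))))"
    by (simp add: divide_eq_eq)
  also have "2 * pi * (y / (4 * sqrt 2 * pi)) = y / (2 * sqrt 2)" by (simp add: field_simps)
  also have "exp (- complex_of_real (y\<^sup>2 / 8)) = of_real (exp (- (y\<^sup>2 / 8)))"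
    by (simp flip: exp_of_real)
  finally show ?thesis by (simp only: of_real_mult mult.assoc)
qed

text \<open>The literal integrand. The contour argument uses it on the two vertical lines only: at
  0, for instance, \<open>Gamma\<close> has the default value 0 and the integrand is not
  continuous.\<close>

definition residue_integrand :: "real \<Rightarrow> complex \<Rightarrow> complex" where
  "residue_integrand x s = hker 0 s * (zeta (2 * s) / zeta s) * of_real (sqrt pi * x) powr (- s)"

lemma residue_integrand_right:
  assumes x: "x > 0"
  shows "integrable lborel (\<lambda>t. residue_integrand x (Complex (5 / 4) t))"
    and "(\<lambda>n. of_real (pi * x) * (of_nat (Suc n) * of_int (liouville (Suc n)) * of_real (exp (- pi * real (Suc n) ^ 2 * x ^ 2 / 4)))) sums
      (LINT t|lborel. residue_integrand x (Complex (5 / 4) t))"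
proof -
  define D where "D = (\<lambda>t. zeta (2 * Complex (5 / 4) t) / zeta (Complex (5 / 4) t))"
  have q: "summable (\<lambda>n. norm (of_int (liouville (Suc n)) :: complex) * real (Suc n) powr (- (5 / 4)))"
    using summable_powr_Suc[of "- (5 / 4)"] by (simp add: liouville_def norm_power)
  have D: "(\<lambda>n. of_int (liouville (Suc n)) * of_nat (Suc n) powr (- Complex (5 / 4) t)) sums D t" for t
    unfolding D_def by (rule liouville_Dirichlet) simp
  have X: "sqrt pi * x > 0" using x by simp
  have a: "(0 :: real) \<le> 0" "(0 :: real) \<le> 1 / 2" and c: "(1 :: real) < 5 / 4" "(5 / 4 :: real) \<le> 3" by simp_all
  note H = hker_Dirichlet_series[OF a X c q D]
  show "integrable lborel (\<lambda>t. residue_integrand x (Complex (5 / 4) t))"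
    using H(1) unfolding D_def residue_integrand_def .
  have "of_int (liouville (Suc n)) * (LINT t|lborel. hker 0 (Complex (5 / 4) t) * of_real (sqrt pi * x * real (Suc n)) powr (- Complex (5 / 4) t)) =
     of_real (pi * x) * (of_nat (Suc n) * of_int (liouville (Suc n)) * complex_of_real (exp (- pi * real (Suc n) ^ 2 * x ^ 2 / 4)))" for n
  proof -
    define m where "m = real (Suc n)"
    have "m > 0" by (simp add: m_def)
    have e: "- (sqrt pi * x * m)\<^sup>2 / 4 = - pi * m\<^sup>2 * x\<^sup>2 / 4"
      by (simp add: power_mult_distrib mult_ac)
    have eq: "sqrt pi * (sqrt pi * x * m) = pi * x * m"
      by (simp flip: mult.assoc)
    have "(LINT t|lborel. hker 0 (Complex (5 / 4) t) * of_real (sqrt pi * x * m) powr (- Complex (5 / 4) t)) =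
        of_real (pi * x * m * exp (- pi * m\<^sup>2 * x\<^sup>2 / 4))"
      by (rule hker_Mellin_0[OF mult_pos_pos[OF X \<open>m > 0\<close>] c, unfolded e eq])
    then show ?thesis unfolding m_def of_real_mult of_real_of_nat_eq by (simp only: mult_ac)
  qed
  then show "(\<lambda>n. of_real (pi * x) * (of_nat (Suc n) * of_int (liouville (Suc n)) * of_real (exp (- pi * real (Suc n) ^ 2 * x ^ 2 / 4)))) sums
      (LINT t|lborel. residue_integrand x (Complex (5 / 4) t))"
    using H(2) unfolding D_def residue_integrand_def by (simp only:)
qed

text \<open>The factor rGamma(s) from zeta(2 s) cancels Gamma(s), and the factor rGamma(s/2) from
  zeta(s) cancels the one in the kernel. What is left is the kernel with a = 1/2 at 1 - s and a
  factor pi^s, which is combined with (sqrt pi x)^(-s).\<close>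

lemma residue_integrand_reflect:
  assumes x: "x > 0" and s: "Re s = - 1 / 4"
  shows "residue_integrand x s = of_real (sqrt pi / x) *
    (hker (1 / 2) (1 - s) * (zeta (2 * (1 - s) - 1) / zeta (1 - s)) * of_real (sqrt pi / x) powr (- (1 - s)))"
proof -
  have z1: "zeta s = of_real pi powr (s - 1 / 2) * Gamma ((1 - s) / 2) * rGamma (s / 2) * zeta (1 - s)"
    by (rule zeta_functional_equation) (use s in simp)
  have z2: "zeta (2 * s) = of_real pi powr (2 * s - 1 / 2) * Gamma ((1 - 2 * s) / 2) * rGamma (2 * s / 2) * zeta (1 - 2 * s)"
    by (rule zeta_functional_equation) (use s in simp)
  have "real n * 4 \<noteq> 1" "real n * 8 \<noteq> 1" for n by (cases n; simp)+
  then have "s \<notin> \<int>\<^sub>\<le>\<^sub>0" "s / 2 \<notin> \<int>\<^sub>\<le>\<^sub>0" "(1 - s) / 2 \<notin> \<int>\<^sub>\<le>\<^sub>0"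
    using s by (auto elim!: nonpos_Ints_cases' simp: complex_eq_iff)
  then have G: "Gamma s * rGamma s = 1" "rGamma (s / 2) \<noteq> 0" "Gamma ((1 - s) / 2) \<noteq> 0"
    by (simp_all add: rGamma_inverse_Gamma Gamma_eq_zero_iff)
  have z3: "zeta (1 - s) \<noteq> 0" by (rule zeta_nonzero) (use s in simp)
  have P: "complex_of_real pi powr (s - 1 / 2) \<noteq> 0" by simp
  have P2: "complex_of_real pi powr (2 * s - 1 / 2) = of_real pi powr (s - 1 / 2) * of_real pi powr s"
    by (simp flip: powr_add)
  have R: "of_real pi powr s * of_real (sqrt pi * x) powr (- s) = of_real (sqrt pi / x) * complex_of_real (sqrt pi / x) powr (- (1 - s))"
  proof -
    have e: "complex_of_real r powr z = exp (z * of_real (ln r))" if "r > 0" for r z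
      using that by (simp add: powr_def Ln_of_real)
    have l: "complex_of_real (ln (sqrt pi * x)) = of_real (ln pi) / 2 + of_real (ln x)"
      "complex_of_real (ln (sqrt pi / x)) = of_real (ln pi) / 2 - of_real (ln x)"
      using x by (simp_all add: ln_mult ln_div ln_sqrt)
    have "of_real pi powr s * of_real (sqrt pi * x) powr (- s) = exp (s * of_real (ln pi) + - s * of_real (ln (sqrt pi * x)))"
      using x by (simp only: e[OF pi_gt_zero] e[of "sqrt pi * x"] exp_add mult_pos_pos real_sqrt_gt_zero pi_gt_zero)
    also have "s * of_real (ln pi) + - s * of_real (ln (sqrt pi * x)) = of_real (ln (sqrt pi / x)) + - (1 - s) * of_real (ln (sqrt pi / x))"
    proof -
      have h2: "2 * (of_real (ln pi) / 2) = complex_of_real (ln pi)" by simp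
      have "s * (2 * p) + - s * (p + q) = (p - q) + - (1 - s) * (p - q)" for p q
        by (simp add: algebra_simps)
      from this[of "of_real (ln pi) / 2" "of_real (ln x)"] show ?thesis
        unfolding l h2 .
    qed
    also have "exp (of_real (ln (sqrt pi / x)) + - (1 - s) * of_real (ln (sqrt pi / x))) =
        exp (complex_of_real (ln (sqrt pi / x))) * complex_of_real (sqrt pi / x) powr (- (1 - s))"
      using x by (subst exp_add, subst e) simp_all
    also have "exp (complex_of_real (ln (sqrt pi / x))) = of_real (sqrt pi / x)"
      using x by (subst exp_of_real, subst exp_ln) simp_all
    finally show ?thesis .
  qed
  define g where "g = Gamma ((1 - 2 * s) / 2)"
  define r where "r = rGamma ((1 - s) / 2)"
  have r: "r * Gamma ((1 - s) / 2) = 1" using G(3) by (simp add: r_def rGamma_inverse_Gamma)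
  have e1: "(1 - 2 * s) / 2 = 1 - s - 1 / 2" by (simp add: field_simps)
  have h: "hker (1 / 2) (1 - s) = g * r" unfolding hker_def g_def r_def e1 by simp
  have PP: "complex_of_real pi powr (s - 1 / 2) / of_real pi powr (s - 1 / 2) = 1" using P by (rule divide_self)
  have BB: "rGamma (s / 2) / rGamma (s / 2) = 1" using G(2) by (rule divide_self)
  have gr: "g / Gamma ((1 - s) / 2) = g * r" unfolding r_def rGamma_inverse_Gamma divide_inverse ..
  have w: "2 * (1 - s) - 1 = 1 - 2 * s" by (simp add: algebra_simps)
  \<comment> \<open>Quotients such as P / P are left standing, so this regrouping is valid without
    nonvanishing conditions and follows from commutativity alone.\<close>
  have alg: "(A * B) * ((P * Q * g' * C * z2) / (P * G' * B * z1)) * X = (A * C) * (P / P) * (B / B) * (g' / G') * (z2 / z1) * (Q * X)"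
    for A B P Q g' C z2 G' z1 X :: complex
    by (simp only: divide_inverse inverse_mult_distrib mult_ac)
  have s2: "2 * s / 2 = s" by simp
  have hker_0: "hker 0 s = Gamma s * rGamma (s / 2)" by (simp add: hker_def)
  have "residue_integrand x s = (Gamma s * rGamma s) * (of_real pi powr (s - 1 / 2) / of_real pi powr (s - 1 / 2)) *
      (rGamma (s / 2) / rGamma (s / 2)) * (g / Gamma ((1 - s) / 2)) * (zeta (1 - 2 * s) / zeta (1 - s)) *
      (of_real pi powr s * of_real (sqrt pi * x) powr (- s))"
    unfolding residue_integrand_def hker_0 z1 z2 P2 g_def[symmetric] s2 by (rule alg)
  also have "\<dots> = g * r * (zeta (1 - 2 * s) / zeta (1 - s)) * (of_real pi powr s * of_real (sqrt pi * x) powr (- s))"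
    by (simp only: G(1) PP BB gr mult_1 mult_1_right)
  finally show ?thesis unfolding R h w by (simp only: mult_ac)
qed

lemma residue_integrand_left:
  assumes x: "x > 0"
  shows "integrable lborel (\<lambda>t. residue_integrand x (Complex (- 1 / 4) t))"
    and "(\<lambda>n. of_real (pi / (2 * sqrt 2 * x\<^sup>2)) * (of_nat (Suc n) * of_int (c_coeff (Suc n)) *
             of_real (exp (- pi * real (Suc n) ^ 2 / (8 * x ^ 2))) *
             (Bessel_K (1 / 4) (of_real (pi * real (Suc n) ^ 2 / (8 * x ^ 2))) +
              Bessel_K (3 / 4) (of_real (pi * real (Suc n) ^ 2 / (8 * x ^ 2)))))) sums
      (LINT t|lborel. residue_integrand x (Complex (- 1 / 4) t))"
proof -
  define D where "D = (\<lambda>t. zeta (2 * Complex (5 / 4) t - 1) / zeta (Complex (5 / 4) t))"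
  have q: "summable (\<lambda>n. norm (of_int (c_coeff (Suc n)) :: complex) * real (Suc n) powr (- (5 / 4)))"
    using c_coeff_Dirichlet(2)[of "5 / 4"] by (simp add: norm_mult norm_nat_powr del: of_nat_Suc)
  have D: "(\<lambda>n. of_int (c_coeff (Suc n)) * of_nat (Suc n) powr (- Complex (5 / 4) t)) sums D t" for t
    unfolding D_def by (rule c_coeff_Dirichlet) simp
  define y where "y = sqrt pi / x"
  have y: "y > 0" using x by (simp add: y_def)
  have a: "(0 :: real) \<le> 1 / 2" "(1 / 2 :: real) \<le> 1 / 2" and c: "(1 :: real) < 5 / 4" "(5 / 4 :: real) \<le> 3" by simp_all
  note H = hker_Dirichlet_series[OF a y c q D]
  define G where "G = (\<lambda>t. of_real y * (hker (1 / 2) (Complex (5 / 4) t) * D t * of_real y powr (- Complex (5 / 4) t)))"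
  \<comment> \<open>s -> 1 - s reverses the direction of the line, hence the substitution t ->
    -t.\<close>
  have refl: "residue_integrand x (Complex (- 1 / 4) t) = G (0 + - 1 * t)" for t
  proof -
    have "1 - Complex (- 1 / 4) t = Complex (5 / 4) (0 + - 1 * t)" by (simp add: complex_eq_iff)
    then show ?thesis
      using residue_integrand_reflect[OF x, of "Complex (- 1 / 4) t"]
      unfolding G_def D_def y_def by simp
  qed
  have intG: "integrable lborel G" unfolding G_def by (intro integrable_mult_right H(1))
  show "integrable lborel (\<lambda>t. residue_integrand x (Complex (- 1 / 4) t))"
    unfolding refl by (rule lborel_integrable_real_affine[OF intG]) simp
  have "(LINT t|lborel. residue_integrand x (Complex (- 1 / 4) t)) = (LINT t|lborel. G t)"
    unfolding refl by (subst (2) lborel_integral_real_affine[of "- 1" _ 0]) simp_all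
  also have "\<dots> = of_real y * (LINT t|lborel. hker (1 / 2) (Complex (5 / 4) t) * D t * of_real y powr (- Complex (5 / 4) t))"
    unfolding G_def by (rule integral_mult_right_zero)
  finally have int_eq: "(LINT t|lborel. residue_integrand x (Complex (- 1 / 4) t)) = \<dots>" .
  have "of_real y * (of_int (c_coeff (Suc n)) * (LINT t|lborel. hker (1 / 2) (Complex (5 / 4) t) * of_real (y * real (Suc n)) powr (- Complex (5 / 4) t))) =
     of_real (pi / (2 * sqrt 2 * x\<^sup>2)) * (of_nat (Suc n) * of_int (c_coeff (Suc n)) *
             of_real (exp (- pi * real (Suc n) ^ 2 / (8 * x ^ 2))) *
             (Bessel_K (1 / 4) (of_real (pi * real (Suc n) ^ 2 / (8 * x ^ 2))) +
              Bessel_K (3 / 4) (of_real (pi * real (Suc n) ^ 2 / (8 * x ^ 2)))))" for n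
  proof -
    define m where "m = real (Suc n)"
    have "m > 0" by (simp add: m_def)
    have y2: "(y * m)\<^sup>2 / 8 = pi * m\<^sup>2 / (8 * x\<^sup>2)"
      by (simp add: y_def power_mult_distrib power_divide mult_ac)
    have y3: "y * (y * m / (2 * sqrt 2)) = pi / (2 * sqrt 2 * x\<^sup>2) * m"
    proof -
      have "y * y = pi / x\<^sup>2" by (simp add: y_def power2_eq_square)
      then have "y * y * m / (2 * sqrt 2) = pi / x\<^sup>2 * m / (2 * sqrt 2)" by simp
      then show ?thesis by (simp add: mult_ac)
    qed
    have M: "(LINT t|lborel. hker (1 / 2) (Complex (5 / 4) t) * of_real (y * m) powr (- Complex (5 / 4) t)) =
        of_real (y * m / (2 * sqrt 2) * exp (- (pi * m\<^sup>2 / (8 * x\<^sup>2)))) *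
        (Bessel_K (1 / 4) (of_real (pi * m\<^sup>2 / (8 * x\<^sup>2))) + Bessel_K (3 / 4) (of_real (pi * m\<^sup>2 / (8 * x\<^sup>2))))" (is "?I = _ * ?K")
      by (rule hker_Mellin_half[OF mult_pos_pos[OF y \<open>m > 0\<close>] c, unfolded y2])
    have "of_real y * (of_int (c_coeff (Suc n)) * ?I) =
        of_real (y * (y * m / (2 * sqrt 2))) * (of_int (c_coeff (Suc n)) * of_real (exp (- (pi * m\<^sup>2 / (8 * x\<^sup>2)))) * ?K)"
      unfolding M unfolding of_real_mult by (simp only: mult_ac)
    also have "\<dots> = of_real (pi / (2 * sqrt 2 * x\<^sup>2)) * (of_real m * of_int (c_coeff (Suc n)) * of_real (exp (- (pi * m\<^sup>2 / (8 * x\<^sup>2)))) * ?K)"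
      unfolding y3 of_real_mult by (simp only: mult_ac)
    also have "- (pi * m\<^sup>2 / (8 * x\<^sup>2)) = - pi * m\<^sup>2 / (8 * x\<^sup>2)" by simp
    finally show ?thesis unfolding m_def of_real_of_nat_eq .
  qed
  then show "(\<lambda>n. of_real (pi / (2 * sqrt 2 * x\<^sup>2)) * (of_nat (Suc n) * of_int (c_coeff (Suc n)) *
             of_real (exp (- pi * real (Suc n) ^ 2 / (8 * x ^ 2))) *
             (Bessel_K (1 / 4) (of_real (pi * real (Suc n) ^ 2 / (8 * x ^ 2))) +
              Bessel_K (3 / 4) (of_real (pi * real (Suc n) ^ 2 / (8 * x ^ 2)))))) sums
      (LINT t|lborel. residue_integrand x (Complex (- 1 / 4) t))"
    using sums_mult[OF H(2), of "of_real y"] unfolding int_eq by (simp only:)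
qed

section \<open>Residues and decay of the quotient inside the strip\<close>

lemma hker_0_eq:
  assumes "Re s > - 1" "s \<noteq> 0"
  shows "hker 0 s = of_real 2 powr (s - 1) / of_real (sqrt pi) * Gamma ((s + 1) / 2)"
proof -
  have n: "s / 2 \<notin> \<int>\<^sub>\<le>\<^sub>0"
  proof
    assume "s / 2 \<in> \<int>\<^sub>\<le>\<^sub>0"
    then obtain n where "s / 2 = - of_nat n" by (auto elim: nonpos_Ints_cases')
    then have "s = - of_nat (2 * n)" by (simp add: field_simps)
    then show False using assms by (cases n) auto
  qed
  have "s / 2 + 1 / 2 \<notin> \<int>\<^sub>\<le>\<^sub>0"
    using assms by (auto elim!: nonpos_Ints_cases' simp: complex_eq_iff)
  from Gamma_legendre_duplication[OF n this]
  have "Gamma (s / 2) * Gamma (s / 2 + 1 / 2) = exp ((1 - s) * of_real (ln 2)) * of_real (sqrt pi) * Gamma s" by simp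
  moreover have "exp ((1 - s) * of_real (ln 2)) = inverse (of_real 2 powr (s - 1))"
    using Ln_of_real[of 2] by (simp add: powr_def left_diff_distrib flip: exp_minus)
  ultimately have e: "Gamma s = of_real 2 powr (s - 1) / of_real (sqrt pi) * (Gamma (s / 2) * Gamma (s / 2 + 1 / 2))"
    by (simp add: field_simps)
  have G: "Gamma (s / 2) * rGamma (s / 2) = 1"
    using n by (simp add: rGamma_inverse_Gamma Gamma_eq_zero_iff)
  have "hker 0 s = of_real 2 powr (s - 1) / of_real (sqrt pi) * (Gamma (s / 2) * Gamma (s / 2 + 1 / 2)) * rGamma (s / 2)"
    unfolding hker_def e[symmetric] by simp
  also have "\<dots> = of_real 2 powr (s - 1) / of_real (sqrt pi) * Gamma (s / 2 + 1 / 2) * (Gamma (s / 2) * rGamma (s / 2))"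
    by (simp only: mult_ac)
  also have "s / 2 + 1 / 2 = (s + 1) / 2" by (simp add: add_divide_distrib)
  finally show ?thesis unfolding G by simp
qed

text \<open>The numerator of \<open>residue_integrand\<close> after cancelling \<open>zeta s = zeta1 s / (s - 1)\<close>; the
  duplication formula removes the spurious singularity of \<open>hker 0\<close> at \<open>0\<close>.\<close>
definition residue_numerator :: "real \<Rightarrow> complex \<Rightarrow> complex" where
  "residue_numerator x s = of_real 2 powr (s - 1) / of_real (sqrt pi) * Gamma ((s + 1) / 2) *
     (zeta1 (2 * s) * (s - 1)) * of_real (sqrt pi * x) powr (- s)"

lemma residue_numerator_holomorphic:
  assumes "x > 0"
  shows "residue_numerator x holomorphic_on {s. Re s > - 1 / 2}"
proof -
  have "(s + 1) / 2 \<notin> \<int>\<^sub>\<le>\<^sub>0" if "Re s > - 1 / 2" for s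
    using that by (auto elim!: nonpos_Ints_cases' simp: complex_eq_iff)
  then have "(\<lambda>s. Gamma ((s + 1) / 2)) holomorphic_on {s. Re s > - 1 / 2}"
    by (intro holomorphic_intros) simp_all
  moreover have "(\<lambda>s. zeta1 (2 * s)) holomorphic_on {s. Re s > - 1 / 2}"
    by (intro holomorphic_intros) auto
  moreover have "(\<lambda>s. of_real (sqrt pi * x) powr (- s)) holomorphic_on {s. Re s > - 1 / 2}"
    by (intro holomorphic_intros)
  moreover have "(\<lambda>s. of_real 2 powr (s - 1) / of_real (sqrt pi)) holomorphic_on {s. Re s > - 1 / 2}"
    by (intro holomorphic_intros) auto
  ultimately show ?thesis
    unfolding residue_numerator_def[abs_def]
    by (intro holomorphic_on_mult holomorphic_on_diff holomorphic_on_ident holomorphic_on_const)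
qed

lemma residue_numerator_eq:
  assumes "Re s > - 1 / 2" "s \<noteq> 0" 
  shows "residue_numerator x s = hker 0 s * (zeta1 (2 * s) * (s - 1)) * of_real (sqrt pi * x) powr (- s)"
  unfolding residue_numerator_def using assms by (subst hker_0_eq) auto

lemma residue_integrand_eq:
  assumes s: "Re s > - 1 / 2" "s \<noteq> 0" "s \<noteq> 1 / 2" "s \<noteq> 1"
  shows "residue_integrand x s = residue_numerator x s / ((2 * s - 1) * zeta1 s)"
proof -
  have s': "2 * s - 1 \<noteq> 0" "s - 1 \<noteq> 0" "2 * s \<noteq> 1" using s by (auto simp: field_simps)
  have z: "zeta (2 * s) = zeta1 (2 * s) / (2 * s - 1)" "zeta s = zeta1 s / (s - 1)"
    using s s' by (auto intro!: zeta_right)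
  show ?thesis
    unfolding residue_numerator_eq[OF s(1,2)] residue_integrand_def z by (simp add: divide_inverse mult_ac)
qed

text \<open>At 1/2 the factor \<open>zeta1 (2 * s)\<close> is 1, and s - 1 = -1/2 cancels the same
  factor in zeta1(1/2) = - zeta(1/2) / 2. The kernel is sqrt pi / Gamma(1/4).\<close>

lemma residue_integrand_half:
  assumes x: "x > 0"
  shows "residue_numerator x (1 / 2) / (2 * zeta1 (1 / 2)) =
    of_real (pi powr (1 / 4)) / (2 * of_real (sqrt x) * Gamma (1 / 4) * zeta (1 / 2))"
proof -
  have z: "zeta1 (1 / 2) = - (1 / 2) * zeta (1 / 2)" by (subst zeta1_eq) simp_all
  have h: "hker 0 (1 / 2) = of_real (sqrt pi) / Gamma (1 / 4)"
  proof -
    have "(1 / 2 / 2 :: complex) = 1 / 4" by simp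
    then show ?thesis
      unfolding hker_def of_real_0 diff_zero Gamma_one_half_complex by (simp only: rGamma_inverse_Gamma divide_inverse)
  qed
  have e: "complex_of_real (sqrt pi * x) powr (- (1 / 2)) = of_real ((sqrt pi * x) powr (- (1 / 2)))"
  proof -
    have "complex_of_real (sqrt pi * x) powr of_real (- (1 / 2)) = of_real ((sqrt pi * x) powr (- (1 / 2)))"
      by (rule powr_of_real) (use x in simp)
    moreover have "complex_of_real (- (1 / 2)) = - (1 / 2)" by simp
    ultimately show ?thesis by (simp only:)
  qed
  have p: "sqrt pi * (sqrt pi * x) powr (- (1 / 2)) = pi powr (1 / 4) / sqrt x"
  proof -
    have "(sqrt pi * x) powr (- (1 / 2)) = sqrt pi powr (- (1 / 2)) * x powr (- (1 / 2))"
      by (rule powr_mult)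
    then have "sqrt pi * (sqrt pi * x) powr (- (1 / 2)) = (pi powr (1 / 2) * pi powr (1 / 2 * - (1 / 2))) * x powr (- (1 / 2))"
      unfolding powr_powr[symmetric] using powr_half_sqrt[of pi] by (simp only: mult.assoc pi_ge_zero)
    also have "pi powr (1 / 2) * pi powr (1 / 2 * - (1 / 2)) = pi powr (1 / 4)"
      unfolding powr_add[symmetric] by simp
    also have "x powr (- (1 / 2)) = inverse (sqrt x)"
      by (simp only: powr_minus powr_half_sqrt[OF less_imp_le[OF x]])
    finally show ?thesis unfolding divide_inverse .
  qed
  have "residue_numerator x (1 / 2) / (2 * zeta1 (1 / 2)) =
      hker 0 (1 / 2) * (- (1 / 2)) * of_real (sqrt pi * x) powr (- (1 / 2)) / (2 * zeta1 (1 / 2))"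
    by (subst residue_numerator_eq) (simp_all add: zeta1_1)
  also have "\<dots> = of_real (sqrt pi * (sqrt pi * x) powr (- (1 / 2))) / (2 * Gamma (1 / 4) * zeta (1 / 2))"
    unfolding h e z
  proof -
    have "A / B * (- (1 / 2)) * C / (2 * (- (1 / 2) * D)) = A * C / (2 * B * D)" for A B C D :: complex
      by (cases "B = 0"; cases "D = 0") (simp_all add: divide_simps)
    from this[of "of_real (sqrt pi)"] show "of_real (sqrt pi) / Gamma (1 / 4) * (- (1 / 2)) * of_real ((sqrt pi * x) powr (- (1 / 2))) / (2 * (- (1 / 2) * zeta (1 / 2))) =
        of_real (sqrt pi * (sqrt pi * x) powr (- (1 / 2))) / (2 * Gamma (1 / 4) * zeta (1 / 2))"
      unfolding of_real_mult[of "sqrt pi"] .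
  qed
  finally show ?thesis unfolding p of_real_divide by (simp only: divide_divide_eq_left mult_ac)
qed

text \<open>Kernel decay exp(- T/2) over a denominator of size at least exp(- T/4) leaves exp(-
  T/4). Three of the four powers come from \<open>zeta1_growth\<close> at 2 s, one from s -
  1.\<close>

lemma residue_integrand_bound:
  assumes x: "x > 0"
  obtains C where "C \<ge> 0" "\<And>s. - 1 / 4 \<le> Re s \<Longrightarrow> Re s \<le> 5 / 4 \<Longrightarrow> \<bar>Im s\<bar> \<ge> 1 \<Longrightarrow>
     norm (zeta1 s) \<ge> exp (- \<bar>Im s\<bar> / 4) \<Longrightarrow>
     norm (residue_numerator x s / ((2 * s - 1) * zeta1 s)) \<le> C * (2 * \<bar>Im s\<bar> + 4) ^ 4 * exp (- \<bar>Im s\<bar> / 4)"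
proof -
  have X: "sqrt pi * x > 0" using x by simp
  obtain C1 where C1: "C1 \<ge> 0" "\<And>s. - 1 / 4 \<le> Re s \<Longrightarrow> Re s \<le> 3 \<Longrightarrow> \<bar>Im s\<bar> \<ge> 1 \<Longrightarrow>
     norm (hker 0 s * of_real (sqrt pi * x) powr (- s)) \<le> C1 * exp (- \<bar>Im s\<bar> / 2)"
    using hker_powr_decay[of 0 "sqrt pi * x" "- 1 / 4"] X by auto
  obtain C2 where C2: "C2 > 0" "\<And>s. - 1 / 2 \<le> Re s \<Longrightarrow> norm (zeta1 s) \<le> C2 * (1 + norm s) ^ 3"
    using zeta1_growth[of "- 1 / 2"] by auto
  show thesis
  proof
    show "C1 * C2 \<ge> 0" using C1 C2 by simp
    fix s assume s: "- 1 / 4 \<le> Re s" "Re s \<le> 5 / 4" "\<bar>Im s\<bar> \<ge> 1" "norm (zeta1 s) \<ge> exp (- \<bar>Im s\<bar> / 4)"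
    define T where "T = \<bar>Im s\<bar>"
    have ns: "norm s \<le> 5 / 4 + T" using cmod_le[of s] s by (simp add: T_def)
    have h: "norm (hker 0 s * of_real (sqrt pi * x) powr (- s)) \<le> C1 * exp (- T / 2)"
      unfolding T_def using s by (intro C1) auto
    have "norm (zeta1 (2 * s)) \<le> C2 * (1 + norm (2 * s)) ^ 3" using s by (intro C2) simp
    also have "\<dots> \<le> C2 * (2 * T + 4) ^ 3"
      using ns C2 by (intro mult_left_mono power_mono) (auto simp: norm_mult)
    finally have z: "norm (zeta1 (2 * s)) \<le> C2 * (2 * T + 4) ^ 3" .
    have s1: "norm (s - 1) \<le> 2 * T + 4" using norm_triangle_ineq4[of s 1] ns s by (simp add: T_def)
    have "1 \<le> \<bar>Im (2 * s - 1)\<bar>" using s by simp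
    then have s2: "1 \<le> norm (2 * s - 1)" using abs_Im_le_cmod order_trans by blast
    have den: "1 * exp (- T / 4) \<le> norm ((2 * s - 1) * zeta1 s)"
      unfolding norm_mult T_def using s s2 by (intro mult_mono) auto
    have "residue_numerator x s = (hker 0 s * of_real (sqrt pi * x) powr (- s)) * (zeta1 (2 * s) * (s - 1))"
      using s by (subst residue_numerator_eq) (auto simp: mult_ac)
    then have "norm (residue_numerator x s) = norm (hker 0 s * of_real (sqrt pi * x) powr (- s)) * (norm (zeta1 (2 * s)) * norm (s - 1))"
      by (simp only: norm_mult)
    also have "\<dots> \<le> (C1 * exp (- T / 2)) * ((C2 * (2 * T + 4) ^ 3) * (2 * T + 4))"
      using C1 C2 s by (intro mult_mono h z s1) (auto simp: T_def)
    also have "\<dots> = (C1 * C2 * (2 * T + 4) ^ 4 * exp (- T / 4)) * exp (- T / 4)"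
    proof -
      have "exp (- T / 2) = exp (- T / 4) * exp (- T / 4)" by (simp flip: exp_add)
      moreover have "(2 * T + 4) ^ 4 = (2 * T + 4) ^ 3 * (2 * T + 4)" by (simp add: eval_nat_numeral)
      ultimately show ?thesis by (simp only: mult_ac)
    qed
    also have "\<dots> \<le> (C1 * C2 * (2 * T + 4) ^ 4 * exp (- T / 4)) * norm ((2 * s - 1) * zeta1 s)"
      using den C1 C2 by (intro mult_left_mono) (auto simp: T_def)
    finally have "norm (residue_numerator x s) \<le> (C1 * C2 * (2 * T + 4) ^ 4 * exp (- T / 4)) * norm ((2 * s - 1) * zeta1 s)" .
    moreover have "0 < norm ((2 * s - 1) * zeta1 s)" using den by (rule less_le_trans[rotated]) simp
    ultimately show "norm (residue_numerator x s / ((2 * s - 1) * zeta1 s)) \<le> C1 * C2 * (2 * \<bar>Im s\<bar> + 4) ^ 4 * exp (- \<bar>Im s\<bar> / 4)"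
      unfolding norm_divide T_def by (simp only: pos_divide_le_eq)
  qed
qed

lemma residue_quotient_at_half:
  assumes x: "x > 0"
  shows "residue (\<lambda>s. residue_numerator x s / ((2 * s - 1) * zeta1 s)) (1 / 2) =
    of_real (pi powr (1 / 4)) / (2 * of_real (sqrt x) * Gamma (1 / 4) * zeta (1 / 2))"
proof -
  have z: "zeta1 (1 / 2) \<noteq> 0"
    using zeta_half_nonzero by (subst zeta1_eq) auto
  have op: "open {s. Re s > - 1 / 2}" by (rule open_halfspace_Re_gt)
  have zh: "zeta1 holomorphic_on {s. Re s > - 1 / 2}"
    by (rule zeta1_holomorphic) (auto intro: holomorphic_on_ident)
  then have zc: "continuous (at (1 / 2)) zeta1"
    using op by (auto dest!: holomorphic_on_imp_continuous_on simp: continuous_on_eq_continuous_at)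
  then obtain e where e: "e > 0" "\<And>y. dist (1 / 2) y < e \<Longrightarrow> zeta1 y \<noteq> 0"
    using continuous_at_avoid[OF zc z] by blast
  \<comment> \<open>A disc inside Re s > -1/2 without zeros of \<open>zeta1\<close>, so that 2 s - 1
    is the only vanishing factor.\<close>
  define S where "S = (ball (1 / 2) (min e (1 / 2)) :: complex set)"
  have S: "zeta1 s \<noteq> 0" "Re s > - 1 / 2" if "s \<in> S" for s
  proof -
    show "zeta1 s \<noteq> 0" using that by (intro e(2)) (auto simp: S_def)
    have "\<bar>Re (1 / 2 - s)\<bar> \<le> norm (1 / 2 - s)" by (rule abs_Re_le_cmod)
    also have "\<dots> < 1 / 2" using that by (auto simp: S_def dist_norm)
    finally have "\<bar>1 / 2 - Re s\<bar> < 1 / 2" by simp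
    then show "Re s > - 1 / 2" by linarith
  qed
  have sub: "S - {1 / 2} \<subseteq> {s. Re s > - 1 / 2}" using S by auto
  have "residue (\<lambda>s. residue_numerator x s / ((2 * s - 1) * zeta1 s)) (1 / 2) = residue_numerator x (1 / 2) / (2 * zeta1 (1 / 2))"
  proof (rule residue_simple')
    show "open S" "1 / 2 \<in> S" using e by (auto simp: S_def)
    show "(\<lambda>s. residue_numerator x s / ((2 * s - 1) * zeta1 s)) holomorphic_on S - {1 / 2}"
      by (intro holomorphic_intros holomorphic_on_subset[OF residue_numerator_holomorphic[OF x] sub]
          holomorphic_on_subset[OF zh sub])
        (use S in \<open>auto simp: field_simps\<close>)
    have "((\<lambda>s. residue_numerator x s / (2 * zeta1 s)) \<longlongrightarrow> residue_numerator x (1 / 2) / (2 * zeta1 (1 / 2))) (at (1 / 2))"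
    proof (intro tendsto_intros)
      show "residue_numerator x \<midarrow>1 / 2\<rightarrow> residue_numerator x (1 / 2)"
        using holomorphic_on_imp_continuous_on[OF residue_numerator_holomorphic[OF x]] op
        by (auto simp: continuous_on_eq_continuous_at isCont_def)
      show "zeta1 \<midarrow>1 / 2\<rightarrow> zeta1 (1 / 2)" using zc by (simp add: isCont_def)
    qed (use z in auto)
    moreover have "\<forall>\<^sub>F s in at (1 / 2). residue_numerator x s / (2 * zeta1 s) =
        residue_numerator x s / ((2 * s - 1) * zeta1 s) * (s - 1 / 2)"
    proof -
      have "residue_numerator x s / (2 * zeta1 s) = residue_numerator x s / ((2 * s - 1) * zeta1 s) * (s - 1 / 2)" if "s \<noteq> 1 / 2" for s
      proof -
        have d: "s - 1 / 2 \<noteq> 0" "2 * s - 1 = 2 * (s - 1 / 2)" using that by (auto simp: algebra_simps)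
        have alg: "N / (2 * Z) = N / (2 * d * Z) * d" if "d \<noteq> 0" for N Z d :: complex
          using that by (cases "Z = 0") simp_all
        show ?thesis unfolding d(2) by (rule alg[OF d(1)])
      qed
      then show ?thesis by (auto simp: eventually_at_filter)
    qed
    ultimately show "((\<lambda>s. residue_numerator x s / ((2 * s - 1) * zeta1 s) * (s - 1 / 2)) \<longlongrightarrow> residue_numerator x (1 / 2) / (2 * zeta1 (1 / 2))) (at (1 / 2))"
      by (rule Lim_transform_eventually)
  qed
  then show ?thesis using residue_integrand_half[OF x] by simp
qed

lemma residue_quotient_at_zero:
  assumes x: "x > 0" and \<rho>: "\<rho> \<in> nontrivial_zeros" and simple: "zorder zeta \<rho> = 1"
  shows "residue (\<lambda>s. residue_numerator x s / ((2 * s - 1) * zeta1 s)) \<rho> =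
    zeta (2 * \<rho>) / deriv zeta \<rho> * (Gamma \<rho> / Gamma (\<rho> / 2)) * of_real (sqrt pi * x) powr (- \<rho>)"
proof -
  note z = nontrivial_zeros_strip[OF \<rho>]
  have d0: "deriv zeta1 \<rho> \<noteq> 0" using zeta_simple_zero[OF \<rho> simple] z by simp
  have op: "open {s. Re s > - 1 / 2}" by (rule open_halfspace_Re_gt)
  have zh: "zeta1 holomorphic_on {s. Re s > - 1 / 2}"
    by (rule zeta1_holomorphic) (auto intro: holomorphic_on_ident)
  have \<rho>S: "\<rho> \<in> {s. Re s > - 1 / 2}" using z by simp
  have z0: "zeta1 \<rho> = 0" using zeta1_eq_0_iff[of \<rho>] z \<rho> by simp
  have der: "(zeta1 has_field_derivative deriv zeta1 \<rho>) (at \<rho>)"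
    by (rule holomorphic_derivI[OF zh op \<rho>S])
  have lim: "((\<lambda>s. zeta1 s / (s - \<rho>)) \<longlongrightarrow> deriv zeta1 \<rho>) (at \<rho>)"
    using der z0 by (simp add: has_field_derivative_iff)
  define R where "R = \<bar>Im \<rho>\<bar> + 1"
  \<comment> \<open>Truncation at height R leaves finitely many other zeros to delete, which keeps
    the set open.\<close>
  define S where "S = ({s. Re s > - 1 / 2} \<inter> {s. \<bar>Im s\<bar> < R}) - ({\<sigma> \<in> nontrivial_zeros. \<bar>Im \<sigma>\<bar> < R} - {\<rho>}) - {1 / 2}"
  have "open {s. \<bar>Im s\<bar> < R}"
    by (rule open_Collect_less) (auto intro!: continuous_intros)
  then have opS: "open S" unfolding S_def
    by (intro open_Diff open_Int op finite_imp_closed finite_Diff finite_nontrivial_zeros) auto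
  have \<rho>S': "\<rho> \<in> S" using z by (auto simp: S_def R_def)
  have sub: "S - {\<rho>} \<subseteq> {s. Re s > - 1 / 2}" by (auto simp: S_def)
  have nz: "zeta1 s \<noteq> 0" "2 * s - 1 \<noteq> 0" if "s \<in> S - {\<rho>}" for s
    using that zeta1_eq_0_iff[of s] by (auto simp: S_def field_simps)
  have "residue (\<lambda>s. residue_numerator x s / ((2 * s - 1) * zeta1 s)) \<rho> = residue_numerator x \<rho> / ((2 * \<rho> - 1) * deriv zeta1 \<rho>)"
  proof (rule residue_simple'[OF opS \<rho>S'])
    show "(\<lambda>s. residue_numerator x s / ((2 * s - 1) * zeta1 s)) holomorphic_on S - {\<rho>}"
      by (intro holomorphic_intros holomorphic_on_subset[OF residue_numerator_holomorphic[OF x] sub]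
          holomorphic_on_subset[OF zh sub]) (use nz in auto)
    have "((\<lambda>s. residue_numerator x s / ((2 * s - 1) * (zeta1 s / (s - \<rho>)))) \<longlongrightarrow> residue_numerator x \<rho> / ((2 * \<rho> - 1) * deriv zeta1 \<rho>)) (at \<rho>)"
    proof (intro tendsto_intros lim)
      show "residue_numerator x \<midarrow>\<rho>\<rightarrow> residue_numerator x \<rho>"
        using holomorphic_on_imp_continuous_on[OF residue_numerator_holomorphic[OF x]] op \<rho>S
        by (auto simp: continuous_on_eq_continuous_at isCont_def)
    qed (use d0 z in \<open>auto simp: field_simps\<close>)
    moreover have "residue_numerator x s / ((2 * s - 1) * (zeta1 s / (s - \<rho>))) =
        residue_numerator x s / ((2 * s - 1) * zeta1 s) * (s - \<rho>)" for s
      by simp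
    ultimately show "((\<lambda>s. residue_numerator x s / ((2 * s - 1) * zeta1 s) * (s - \<rho>)) \<longlongrightarrow> residue_numerator x \<rho> / ((2 * \<rho> - 1) * deriv zeta1 \<rho>)) (at \<rho>)"
      by simp
  qed
  also have "\<dots> = hker 0 \<rho> * (zeta1 (2 * \<rho>) / (2 * \<rho> - 1)) * ((\<rho> - 1) / (\<rho> - 1)) / deriv zeta \<rho> * of_real (sqrt pi * x) powr (- \<rho>)"
  proof -
    have "h * (Z * r) * X / (D * (r * d)) = h * (Z / D) * (r / r) / d * X" for h Z r X D d :: complex
      by (simp only: divide_inverse inverse_mult_distrib mult_ac)
    moreover have "residue_numerator x \<rho> = hker 0 \<rho> * (zeta1 (2 * \<rho>) * (\<rho> - 1)) * of_real (sqrt pi * x) powr (- \<rho>)"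
      by (rule residue_numerator_eq) (use z in simp_all)
    ultimately show ?thesis unfolding zeta_simple_zero(2)[OF \<rho> simple] by simp
  qed
  also have "(\<rho> - 1) / (\<rho> - 1) = 1" using z by simp
  also have "zeta1 (2 * \<rho>) / (2 * \<rho> - 1) = zeta (2 * \<rho>)"
    using z by (subst zeta_right) (auto simp: field_simps)
  finally have eq: "residue (\<lambda>s. residue_numerator x s / ((2 * s - 1) * zeta1 s)) \<rho> =
      hker 0 \<rho> * zeta (2 * \<rho>) * 1 / deriv zeta \<rho> * of_real (sqrt pi * x) powr (- \<rho>)" .
  show ?thesis
    unfolding eq by (simp only: hker_def of_real_0 diff_zero rGamma_inverse_Gamma divide_inverse mult_1 mult_1_right mult_ac)
qed

section \<open>Assembly of line integrals, residues and heights\<close>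

theorem theorem2p10:
  fixes x :: real
  assumes "x > 0"
    and "\<And>\<rho>. \<rho> \<in> nontrivial_zeros \<Longrightarrow> zorder zeta \<rho> = 1"
  shows "\<exists>T :: nat \<Rightarrow> real. (\<forall>j\<ge>1. T j > 0) \<and> filterlim T at_top sequentially \<and>
    (\<exists>A B L :: complex.
      (\<lambda>n. of_nat (Suc n) * of_int (liouville (Suc n)) *
             of_real (exp (- pi * real (Suc n) ^ 2 * x ^ 2 / 4))) sums A \<and>
      (\<lambda>n. of_nat (Suc n) * of_int (c_coeff (Suc n)) *
             of_real (exp (- pi * real (Suc n) ^ 2 / (8 * x ^ 2))) *
             (Bessel_K (1 / 4) (of_real (pi * real (Suc n) ^ 2 / (8 * x ^ 2))) +
              Bessel_K (3 / 4) (of_real (pi * real (Suc n) ^ 2 / (8 * x ^ 2))))) sums B \<and>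
      (\<lambda>j. \<Sum>\<rho> | \<rho> \<in> nontrivial_zeros \<and> \<bar>Im \<rho>\<bar> < T j.
             zeta (2 * \<rho>) / deriv zeta \<rho> * (Gamma \<rho> / Gamma (\<rho> / 2)) *
             of_real (sqrt pi * x) powr (- \<rho>)) \<longlonglongrightarrow> L \<and>
      of_real (x / 2) * A =
        of_real (1 / (4 * sqrt 2 * x ^ 2)) * B +
        of_real (pi powr (1 / 4)) / (2 * of_real (sqrt x) * Gamma (1 / 4) * zeta (1 / 2)) +
        L)"
proof -
  note x = assms(1) and simple = assms(2)
  have "deriv zeta1 \<rho> \<noteq> 0" if "\<rho> \<in> nontrivial_zeros" for \<rho>
    using zeta_simple_zero[OF that simple[OF that]] nontrivial_zeros_strip(2)[OF that] by simp
  from zeta1_lower_bound_heights[OF this] obtain T0 where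
    T0: "\<forall>T\<ge>T0. \<exists>t\<in>{T..T+1}. \<forall>s. - 1 / 4 \<le> Re s \<and> Re s \<le> 5 / 4 \<and> \<bar>Im s\<bar> = t \<longrightarrow> norm (zeta1 s) \<ge> exp (- t / 4)"
    by blast
  \<comment> \<open>Adding j drives the heights to infinity; max with 1 keeps them in the range |Im
    s| >= 1 of the decay bound.\<close>
  have "\<exists>t. real j + max T0 1 \<le> t \<and> (\<forall>s. - 1 / 4 \<le> Re s \<and> Re s \<le> 5 / 4 \<and> \<bar>Im s\<bar> = t \<longrightarrow> norm (zeta1 s) \<ge> exp (- t / 4))" for j :: nat
  proof -
    have "real j + max T0 1 \<ge> T0" by simp
    with T0 obtain t where "t \<in> {real j + max T0 1..real j + max T0 1 + 1}"
      "\<forall>s. - 1 / 4 \<le> Re s \<and> Re s \<le> 5 / 4 \<and> \<bar>Im s\<bar> = t \<longrightarrow> norm (zeta1 s) \<ge> exp (- t / 4)" by blast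
    then show ?thesis by (intro exI[of _ t] conjI) simp_all
  qed
  then obtain T where T: "\<And>j. real j + max T0 1 \<le> T j"
    and low: "\<And>j s. - 1 / 4 \<le> Re s \<Longrightarrow> Re s \<le> 5 / 4 \<Longrightarrow> \<bar>Im s\<bar> = T j \<Longrightarrow> norm (zeta1 s) \<ge> exp (- T j / 4)"
    by metis
  have T1: "T j \<ge> 1" and Tj: "T j \<ge> real j" for j using T[of j] by linarith+
  have T_pos: "T j > 0" for j using T1[of j] by linarith
  have T_lim: "filterlim T at_top sequentially"
    by (rule filterlim_at_top_mono[OF filterlim_real_sequentially]) (use Tj in auto)
  obtain C where C: "\<And>s. - 1 / 4 \<le> Re s \<Longrightarrow> Re s \<le> 5 / 4 \<Longrightarrow> \<bar>Im s\<bar> \<ge> 1 \<Longrightarrow>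
     norm (zeta1 s) \<ge> exp (- \<bar>Im s\<bar> / 4) \<Longrightarrow>
     norm (residue_numerator x s / ((2 * s - 1) * zeta1 s)) \<le> C * (2 * \<bar>Im s\<bar> + 4) ^ 4 * exp (- \<bar>Im s\<bar> / 4)"
    using residue_integrand_bound[OF x] by blast
  define \<epsilon> where "\<epsilon> = (\<lambda>j. C * ((2 * T j + 4) ^ 4 * exp (- T j / 4)))"
  have "((\<lambda>t::real. (2 * t + 4) ^ 4 * exp (- t / 4)) \<longlongrightarrow> 0) at_top" by real_asymp
  from filterlim_compose[OF this T_lim] have eps: "\<epsilon> \<longlonglongrightarrow> 0"
    unfolding \<epsilon>_def by (rule tendsto_mult_right_zero)
  \<comment> \<open>The possible poles of the quotient in the strip: 2 s - 1 vanishes at 1/2,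
    \<open>zeta1\<close> at the nontrivial zeros.\<close>
  define P where "P = insert (1 / 2) nontrivial_zeros"
  define f where "f = (\<lambda>s. residue_numerator x s / ((2 * s - 1) * zeta1 s))"
  define I1 where "I1 = (LINT t|lborel. residue_integrand x (Complex (5 / 4) t))"
  define I2 where "I2 = (LINT t|lborel. residue_integrand x (Complex (- 1 / 4) t))"
  have f1: "f (Complex (5 / 4) t) = residue_integrand x (Complex (5 / 4) t)" for t
    unfolding f_def by (rule residue_integrand_eq[symmetric]) (auto simp: complex_eq_iff)
  have f2: "f (Complex (- 1 / 4) t) = residue_integrand x (Complex (- 1 / 4) t)" for t
    unfolding f_def by (rule residue_integrand_eq[symmetric]) (auto simp: complex_eq_iff)
  have fin: "finite {\<rho> \<in> nontrivial_zeros. \<bar>Im \<rho>\<bar> < R}" for R by (rule finite_nontrivial_zeros)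
  have "(\<lambda>j. 2 * pi * (\<Sum>p | p \<in> P \<and> \<bar>Im p\<bar> < T j. residue f p)) \<longlonglongrightarrow>
      (LINT t|lborel. f (Complex (5 / 4) t)) - (LINT t|lborel. f (Complex (- 1 / 4) t))"
  \<comment> \<open>The left margin -1/2 is the edge of the domain of
    \<open>residue_numerator\<close>, where 2 s reaches the line Re = -1.\<close>
  proof (rule strip_residue_limit[where a' = "- 1 / 2" and b' = "3 / 2", OF _ _ _ _ _ _ T_pos T_lim _ eps])
    have sub: "{z. - 1 / 2 < Re z \<and> Re z < 3 / 2} - P \<subseteq> {z. Re z > - 1 / 2}" by auto
    have zh: "zeta1 holomorphic_on {z. - 1 / 2 < Re z \<and> Re z < 3 / 2} - P"
      by (rule zeta1_holomorphic) (auto intro: holomorphic_on_ident)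
    have "(2 * s - 1) * zeta1 s \<noteq> 0" if "s \<in> {z. - 1 / 2 < Re z \<and> Re z < 3 / 2} - P" for s
      using that zeta1_eq_0_iff[of s] by (auto simp: P_def field_simps)
    then show "f holomorphic_on {z. - 1 / 2 < Re z \<and> Re z < 3 / 2} - P"
      unfolding f_def
      by (intro holomorphic_on_divide holomorphic_on_mult zh
          holomorphic_on_subset[OF residue_numerator_holomorphic[OF x] sub] holomorphic_intros)
    show "- 1 / 4 < Re p \<and> Re p < 5 / 4" if p: "p \<in> P" for p
    proof (cases "p = 1 / 2")
      case True
      show ?thesis unfolding True by simp
    next
      case False
      then have "p \<in> nontrivial_zeros" using p by (simp add: P_def)
      from nontrivial_zeros_strip(5,6)[OF this] show ?thesis by simp
    qed
    show "finite {p \<in> P. \<bar>Im p\<bar> < R}" for R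
      by (rule finite_subset[OF _ finite.insertI[OF fin[of R], of "1 / 2"]]) (auto simp: P_def)
    \<comment> \<open>A zero at height \<open>T j\<close> would contradict the positive lower bound
      for \<open>zeta1\<close> there.\<close>
    show "\<bar>Im p\<bar> \<noteq> T j" if p: "p \<in> P" for j p
    proof (cases "p = 1 / 2")
      case True
      show ?thesis unfolding True using T_pos[of j] by simp
    next
      case False
      then have \<rho>: "p \<in> nontrivial_zeros" using p by (simp add: P_def)
      note strip = nontrivial_zeros_strip(5,6)[OF \<rho>]
      have z0: "zeta1 p = 0" using zeta1_eq_0_iff[of p] \<rho> strip by simp
      show ?thesis
      proof
        assume "\<bar>Im p\<bar> = T j"
        then have "exp (- T j / 4) \<le> norm (zeta1 p)" using strip by (intro low) auto
        then show False using z0 by simp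
      qed
    qed
    show "norm (f z) \<le> \<epsilon> j" if z: "- 1 / 4 \<le> Re z" "Re z \<le> 5 / 4" "\<bar>Im z\<bar> = T j" for j z
      using C[OF z(1,2)] low[OF z] T1[of j] unfolding f_def \<epsilon>_def z(3) mult.assoc by blast
    show "integrable lborel (\<lambda>t. f (Complex (- 1 / 4) t))"
      unfolding f2 by (rule residue_integrand_left(1)[OF x])
    show "integrable lborel (\<lambda>t. f (Complex (5 / 4) t))"
      unfolding f1 by (rule residue_integrand_right(1)[OF x])
  qed simp_all
  then have LIM: "(\<lambda>j. of_real (2 * pi) * (\<Sum>p | p \<in> P \<and> \<bar>Im p\<bar> < T j. residue f p)) \<longlonglongrightarrow> I1 - I2"
    unfolding f1 f2 I1_def I2_def by simp
  define h where "h = of_real (pi powr (1 / 4)) / (2 * of_real (sqrt x) * Gamma (1 / 4) * zeta (1 / 2))"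
  define S where "S = (\<lambda>j. \<Sum>\<rho> | \<rho> \<in> nontrivial_zeros \<and> \<bar>Im \<rho>\<bar> < T j.
     zeta (2 * \<rho>) / deriv zeta \<rho> * (Gamma \<rho> / Gamma (\<rho> / 2)) * of_real (sqrt pi * x) powr (- \<rho>))"
  have sum: "(\<Sum>p | p \<in> P \<and> \<bar>Im p\<bar> < T j. residue f p) = h + S j" for j
  proof -
    have P: "{p. p \<in> P \<and> \<bar>Im p\<bar> < T j} = insert (1 / 2) {\<rho>. \<rho> \<in> nontrivial_zeros \<and> \<bar>Im \<rho>\<bar> < T j}"
      using T_pos[of j] by (auto simp: P_def)
    have "(1 / 2 :: complex) \<notin> nontrivial_zeros" using nontrivial_zeros_strip(4) by blast
    then have "(\<Sum>p | p \<in> P \<and> \<bar>Im p\<bar> < T j. residue f p) =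
        residue f (1 / 2) + (\<Sum>\<rho> | \<rho> \<in> nontrivial_zeros \<and> \<bar>Im \<rho>\<bar> < T j. residue f \<rho>)"
      unfolding P using fin[of "T j"] by (intro sum.insert) auto
    also have "residue f (1 / 2) = h" unfolding f_def h_def by (rule residue_quotient_at_half[OF x])
    also have "(\<Sum>\<rho> | \<rho> \<in> nontrivial_zeros \<and> \<bar>Im \<rho>\<bar> < T j. residue f \<rho>) = S j"
      unfolding f_def S_def by (intro sum.cong refl residue_quotient_at_zero[OF x] simple) auto
    finally show ?thesis .
  qed
  \<comment> \<open>The two series are read off from the line integrals by removing the constants in
    \<open>residue_integrand_right\<close> and \<open>residue_integrand_left\<close>.\<close>
  define A where "A = I1 / of_real (pi * x)"
  define B where "B = I2 / of_real (pi / (2 * sqrt 2 * x\<^sup>2))"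
  have c1: "complex_of_real (pi * x) \<noteq> 0" and c2: "complex_of_real (pi / (2 * sqrt 2 * x\<^sup>2)) \<noteq> 0"
    using x by simp_all
  have A: "I1 = of_real (pi * x) * A" unfolding A_def using c1 by (simp only: nonzero_mult_div_cancel_left times_divide_eq_right not_False_eq_True)
  have B: "I2 = of_real (pi / (2 * sqrt 2 * x\<^sup>2)) * B" unfolding B_def using c2 by (simp only: nonzero_mult_div_cancel_left times_divide_eq_right not_False_eq_True)
  define L where "L = (I1 - I2) / of_real (2 * pi) - h"
  have "S \<longlonglongrightarrow> L"
  proof -
    have "(\<lambda>j. of_real (2 * pi) * (h + S j) / of_real (2 * pi) - h) \<longlonglongrightarrow> L"
      unfolding L_def by (intro tendsto_diff tendsto_divide LIM[unfolded sum] tendsto_const) simp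
    moreover have "of_real (2 * pi) * (h + S j) / of_real (2 * pi) - h = S j" for j by simp
    ultimately show ?thesis by (simp only:)
  qed
  moreover have "of_real (x / 2) * A = of_real (1 / (4 * sqrt 2 * x ^ 2)) * B + h + L"
  proof -
    have p: "complex_of_real (2 * pi) \<noteq> 0" by simp
    have "pi * x = 2 * pi * (x / 2)" by simp
    then have e1: "I1 = of_real (2 * pi) * (of_real (x / 2) * A)"
      unfolding A mult.assoc[symmetric] of_real_mult[symmetric] by (simp only:)
    have "pi / (2 * sqrt 2 * x\<^sup>2) = 2 * pi * (1 / (4 * sqrt 2 * x ^ 2))" by simp
    then have e2: "I2 = of_real (2 * pi) * (of_real (1 / (4 * sqrt 2 * x ^ 2)) * B)"
      unfolding B mult.assoc[symmetric] of_real_mult[symmetric] by (simp only:)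
    have "L = of_real (x / 2) * A - of_real (1 / (4 * sqrt 2 * x ^ 2)) * B - h"
      unfolding L_def e1 e2 diff_divide_distrib nonzero_mult_div_cancel_left[OF p] ..
    then show ?thesis by (simp only: diff_add_cancel add_diff_cancel algebra_simps)
  qed
  moreover have "(\<lambda>n. of_nat (Suc n) * of_int (liouville (Suc n)) *
             of_real (exp (- pi * real (Suc n) ^ 2 * x ^ 2 / 4))) sums A"
    using residue_integrand_right(2)[OF x] unfolding I1_def[symmetric] A sums_mult_iff[OF c1] .
  moreover have "(\<lambda>n. of_nat (Suc n) * of_int (c_coeff (Suc n)) *
             of_real (exp (- pi * real (Suc n) ^ 2 / (8 * x ^ 2))) *
             (Bessel_K (1 / 4) (of_real (pi * real (Suc n) ^ 2 / (8 * x ^ 2))) +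
              Bessel_K (3 / 4) (of_real (pi * real (Suc n) ^ 2 / (8 * x ^ 2))))) sums B"
    using residue_integrand_left(2)[OF x] unfolding I2_def[symmetric] B sums_mult_iff[OF c2] .
  ultimately show ?thesis
    using T_pos T_lim unfolding S_def h_def by blast
qed

end
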